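(* Let $\underline\lambda$ be the highest weight of an irreducible finite-dimensional $Y_\hbar(\mathfrak g)$-module $V$, and let $\lambda\in\mathfrak h^*$ be the corresponding $\mathfrak g$-weight. Then, for each $w\in W$, we have $$\xi_i(u)|_{V_{w(\lambda)}}=\tau_w(\underline\lambda)_i\cdot\mathrm{Id}_{V_{w(\lambda)}}\qquad\forall\ i\in I.$$ In particular, if $V\cong L(\underline{\mathrm P})$ for a tuple of Drinfeld polynomials $\underline{\mathrm P}$, then for each $i\in I$ one has $$\xi_i(u)|_{V_{w(\lambda)}}=\frac{\mathsf q^{2d_i}\tau_w^{\mathscr M}(\underline{\mathrm P})_i}{\tau_w^{\mathscr M}(\underline{\mathrm P})_i}\cdot\mathrm{Id}_{V_{w(\lambda)}}.$$
   Context: Lie algebra. $\mathfrak g$ is a simple Lie algebra over $\mathbb C$ with Cartan matrix $(a_{ij})_{i,j\in I}$, Cartan subalgebra $\mathfrak h$, Chevalley generators $e_i,h_i,f_i$, minimal symmetrizing integers $d_i$ ($d_ia_{ij}=d_ja_{ji}$), Weyl group $W=\langle s_i\rangle$. $\mathscr B_{\mathfrak g}$ is the braid group with generators $\tau_i$ and relations $\tau_i\tau_j\tau_i\cdots=\tau_j\tau_i\tau_j\cdots$ ($m_{ij}$ factors on each side, $i\ne j$; $m_{ij}=2,3,4,6$ for $a_{ij}a_{ji}=0,1,2,3$). For $w=s_{i_1}\cdots s_{i_\ell}$ reduced, $\tau_w=\tau_{i_1}\cdots\tau_{i_\ell}$. Yangian. Fix $\hbar\in\mathbb C^\times$. $Y=Y_\hbar(\mathfrak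 g)$ is the unital associative $\mathbb C$-algebra generated by $\xi_{i,r},x^\pm_{i,r}$ ($i\in I,r\ge0$) with relations: $[\xi_{i,r},\xi_{j,s}]=0$; $[\xi_{i,0},x^\pm_{j,s}]=\pm d_ia_{ij}x^\pm_{j,s}$; $[\xi_{i,r+1},x^\pm_{j,s}]-[\xi_{i,r},x^\pm_{j,s+1}]=\pm\hbar\frac{d_ia_{ij}}2(\xi_{i,r}x^\pm_{j,s}+x^\pm_{j,s}\xi_{i,r})$; $[x^\pm_{i,r+1},x^\pm_{j,s}]-[x^\pm_{i,r},x^\pm_{j,s+1}]=\pm\hbar\frac{d_ia_{ij}}2(x^\pm_{i,r}x^\pm_{j,s}+x^\pm_{j,s}x^\pm_{i,r})$; $[x^+_{i,r},x^-_{j,s}]=\delta_{ij}\xi_{i,r+s}$; and for $i\ne j$, $m=1-a_{ij}$: $\sum_{\pi\in S_m}[x^\pm_{i,r_{\pi(1)}},[x^\pm_{i,r_{\pi(2)}},\cdots[x^\pm_{i,r_{\pi(m)}},x^\pm_{j,s}]\cdots]]=0$. Set $\xi_i(u)=1+\hbar\sum_{r\ge0}\xi_{i,r}u^{-r-1}$, $x_i^\pm(u)=\hbar\sum_{r\ge0}x^\pm_{i,r}u^{-r-1}$. $U(\mathfrak g)\subset Y$ via $e_i\mapsto d_i^{-1/2}x^+_{i,0}$, $h_i\mapsto d_i^{-1}\xi_{i,0}$, $f_i\mapsto d_i^{-1/2}x^-_{i,0}$; $V_\mu$ denotes the $\mathfrak g$-weight space. A module has highest weight $\underline\lambda=(\lambda_i(u))_{i\in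 I}\in(1+u^{-1}\mathbb C[[u^{-1}]])^I$ if it is generated by $v\neq0$ with $x_i^+(u)v=0$, $\xi_i(u)v=\lambda_i(u)v$ for all $i$; the $\mathfrak g$-weight $\lambda$ is that of $v$. Every finite-dimensional irreducible module is a highest weight module. For monic polynomials $\underline{\mathrm P}=(P_i(u))_{i\in I}$, $L(\underline{\mathrm P})$ is the finite-dimensional irreducible module with $\lambda_i(u)=P_i(u+\hbar d_i)/P_i(u)$. Braid group actions. $\mathscr B_{\mathfrak g}$ acts by group automorphisms on $(1+u^{-1}\mathbb C[[u^{-1}]])^I$ via $\tau_j(\underline\lambda)_i=\lambda_i(u)\prod_{k=0}^{|a_{ji}|-1}\lambda_j\big(u-\frac{\hbar d_j}2(|a_{ji}|-2k)\big)^{(-1)^{\delta_{ij}}}$ ($i$-th component), and on $\mathscr M^I$, $\mathscr M=\bigcup_{k\in\mathbb Z}u^k(1+u^{-1}\mathbb C[[u^{-1}]])$, via $\sigma\mapsto\sigma^{\mathscr M}$ with $\tau_j^{\mathscr M}(\underline\mu)_i=\mu_i(u)\prod_{k=0}^{|a_{ij}|-1}\mu_j\big(u-\frac{\hbar d_i}2(|a_{ij}|-2k)\big)^{(-1)^{\delta_{ij}}}$. $(\mathsf q^{2d_i}f)(u)=f(u+\hbar d_i)$. *)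

theory Defs
  imports
    Complex_Main
    "HOL-Library.Poly_Mapping"
    "HOL-Combinatorics.Permutations"
    "HOL-Computational_Algebra.Formal_Laurent_Series"
    "HOL-Algebra.Algebraic_Closure_Type"
begin

section \<open>Simple complex Lie algebras with Chevalley generators\<close>

definition finite_dim :: "(complex \<Rightarrow> 'v \<Rightarrow> 'v) \<Rightarrow> 'v::ab_group_add itself \<Rightarrow> bool" where
  "finite_dim scale _ \<longleftrightarrow> (\<exists>B. finite B \<and> Modules.module.span scale B = (UNIV :: 'v set))"

locale lie_algebra = vector_space scale
  for scale :: "complex \<Rightarrow> 'g::ab_group_add \<Rightarrow> 'g" +
  fixes br :: "'g \<Rightarrow> 'g \<Rightarrow> 'g"
  assumes br_add_left: "br (x + y) z = br x z + br y z"
    and br_add_right: "br x (y + z) = br x y + br x z"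
    and br_scale_left: "br (scale c x) y = scale c (br x y)"
    and br_scale_right: "br x (scale c y) = scale c (br x y)"
    and br_self: "br x x = 0"
    and jacobi: "br x (br y z) + br y (br z x) + br z (br x y) = 0"

definition lie_subalgebra ::
  "(complex \<Rightarrow> 'g::ab_group_add \<Rightarrow> 'g) \<Rightarrow> ('g \<Rightarrow> 'g \<Rightarrow> 'g) \<Rightarrow> 'g set \<Rightarrow> bool" where
  "lie_subalgebra scale br S \<longleftrightarrow>
     Modules.module.subspace scale S \<and> (\<forall>x\<in>S. \<forall>y\<in>S. br x y \<in> S)"

definition lie_ideal ::
  "(complex \<Rightarrow> 'g::ab_group_add \<Rightarrow> 'g) \<Rightarrow> ('g \<Rightarrow> 'g \<Rightarrow> 'g) \<Rightarrow> 'g set \<Rightarrow> bool" where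
  "lie_ideal scale br S \<longleftrightarrow>
     Modules.module.subspace scale S \<and> (\<forall>x. \<forall>y\<in>S. br x y \<in> S)"

locale simple_lie_algebra = lie_algebra scale br
  for scale :: "complex \<Rightarrow> 'g::ab_group_add \<Rightarrow> 'g" and br :: "'g \<Rightarrow> 'g \<Rightarrow> 'g" +
  assumes finite_dim: "finite_dim scale TYPE('g)"
    and non_abelian: "\<exists>x y. br x y \<noteq> 0"
    and simple: "lie_ideal scale br S \<Longrightarrow> S = {0} \<or> S = UNIV"

definition lie_nilpotent :: "('g::zero \<Rightarrow> 'g \<Rightarrow> 'g) \<Rightarrow> 'g set \<Rightarrow> bool" where
  "lie_nilpotent br S \<longleftrightarrow>
     (\<exists>n. \<forall>xs y. length xs = n \<and> set xs \<subseteq> S \<and> y \<in> S \<longrightarrow> foldr br xs y = 0)"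

definition cartan_subalgebra ::
  "(complex \<Rightarrow> 'g::ab_group_add \<Rightarrow> 'g) \<Rightarrow> ('g \<Rightarrow> 'g \<Rightarrow> 'g) \<Rightarrow> 'g set \<Rightarrow> bool" where
  "cartan_subalgebra scale br H \<longleftrightarrow>
     lie_subalgebra scale br H \<and> lie_nilpotent br H \<and>
     (\<forall>x. (\<forall>y\<in>H. br x y \<in> H) \<longrightarrow> x \<in> H)"

definition symmetrizes :: "('i \<Rightarrow> 'i \<Rightarrow> int) \<Rightarrow> ('i \<Rightarrow> nat) \<Rightarrow> bool" where
  "symmetrizes a d \<longleftrightarrow>
     (\<forall>i. d i > 0) \<and> (\<forall>i j. int (d i) * a i j = int (d j) * a j i)"

definition minimal_symmetrizer :: "('i \<Rightarrow> 'i \<Rightarrow> int) \<Rightarrow> ('i \<Rightarrow> nat) \<Rightarrow> bool" where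
  "minimal_symmetrizer a d \<longleftrightarrow>
     symmetrizes a d \<and> (\<forall>d'. symmetrizes a d' \<longrightarrow> (\<forall>i. d i \<le> d' i))"

text \<open>
  Indecomposable Cartan matrices of finite type: the ones that occur for simple Lie algebras.
\<close>
definition cartan_matrix :: "('i::finite \<Rightarrow> 'i \<Rightarrow> int) \<Rightarrow> bool" where
  "cartan_matrix a \<longleftrightarrow>
     (\<forall>i. a i i = 2) \<and>
     (\<forall>i j. i \<noteq> j \<longrightarrow> a i j \<le> 0) \<and>
     (\<forall>i j. a i j = 0 \<longrightarrow> a j i = 0) \<and>
     (\<exists>d. symmetrizes a d \<and>
        (\<forall>x :: 'i \<Rightarrow> real. (\<exists>i. x i \<noteq> 0) \<longrightarrow>
           (\<Sum>i\<in>UNIV. \<Sum>j\<in>UNIV. real (d i) * real_of_int (a i j) * x i * x j) > 0)) \<and>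
     (\<forall>J. J \<noteq> {} \<and> J \<noteq> UNIV \<longrightarrow> (\<exists>i\<in>J. \<exists>j\<in>-J. a i j \<noteq> 0))"

text \<open>
  The convention is \<open>[h\<^sub>i, e\<^sub>j] = a\<^sub>i\<^sub>j e\<^sub>j\<close>, that is \<open>a\<^sub>i\<^sub>j = \<alpha>\<^sub>j(h\<^sub>i)\<close>.  This agrees with the
  Yangian relation \<open>[\<xi>\<^bsub>i,0\<^esub>, x\<^bsub>j,s\<^esub>] = d\<^sub>i a\<^sub>i\<^sub>j x\<^bsub>j,s\<^esub>\<close> and \<open>h\<^sub>i = d\<^sub>i\<^sup>-\<^sup>1 \<xi>\<^bsub>i,0\<^esub>\<close>.
\<close>
definition chevalley_generators ::
  "(complex \<Rightarrow> 'g::ab_group_add \<Rightarrow> 'g) \<Rightarrow> ('g \<Rightarrow> 'g \<Rightarrow> 'g) \<Rightarrow> 'g set \<Rightarrow> ('i::finite \<Rightarrow> 'i \<Rightarrow> int) \<Rightarrow>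
   ('i \<Rightarrow> 'g) \<Rightarrow> ('i \<Rightarrow> 'g) \<Rightarrow> ('i \<Rightarrow> 'g) \<Rightarrow> bool" where
  "chevalley_generators scale br H a e h f \<longleftrightarrow>
     cartan_matrix a \<and>
     inj h \<and> \<not> Modules.module.dependent scale (range h) \<and> Modules.module.span scale (range h) = H \<and>
     (\<forall>i j. br (h i) (h j) = 0) \<and>
     (\<forall>i j. br (h i) (e j) = scale (of_int (a i j)) (e j)) \<and>
     (\<forall>i j. br (h i) (f j) = scale (- of_int (a i j)) (f j)) \<and>
     (\<forall>i j. br (e i) (f j) = (if i = j then h i else 0)) \<and>
     (\<forall>i j. i \<noteq> j \<longrightarrow> (br (e i) ^^ nat (1 - a i j)) (e j) = 0) \<and>
     (\<forall>i j. i \<noteq> j \<longrightarrow> (br (f i) ^^ nat (1 - a i j)) (f j) = 0) \<and>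
     (\<forall>S. lie_subalgebra scale br S \<and> range e \<union> range h \<union> range f \<subseteq> S \<longrightarrow> S = UNIV)"

section \<open>Weights and the Weyl group\<close>

text \<open>
  A linear functional on the subspace \<open>H\<close> is represented by its extension by zero
  to the whole type, so that equality of functionals is equality of functions.
\<close>
definition dual_space ::
  "(complex \<Rightarrow> 'g::ab_group_add \<Rightarrow> 'g) \<Rightarrow> 'g set \<Rightarrow> ('g \<Rightarrow> complex) set" where
  "dual_space scale H =
     {\<mu>. (\<forall>x\<in>H. \<forall>y\<in>H. \<mu> (x + y) = \<mu> x + \<mu> y) \<and>
          (\<forall>c. \<forall>x\<in>H. \<mu> (scale c x) = c * \<mu> x) \<and>
          (\<forall>x. x \<notin> H \<longrightarrow> \<mu> x = 0)}"

definition simple_root ::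
  "(complex \<Rightarrow> 'g::ab_group_add \<Rightarrow> 'g) \<Rightarrow> ('g \<Rightarrow> 'g \<Rightarrow> 'g) \<Rightarrow> 'g set \<Rightarrow> ('i \<Rightarrow> 'g) \<Rightarrow>
   'i \<Rightarrow> 'g \<Rightarrow> complex" where
  "simple_root scale br H e i x = (if x \<in> H then THE c. br x (e i) = scale c (e i) else 0)"

definition simple_reflection ::
  "(complex \<Rightarrow> 'g::ab_group_add \<Rightarrow> 'g) \<Rightarrow> ('g \<Rightarrow> 'g \<Rightarrow> 'g) \<Rightarrow> 'g set \<Rightarrow> ('i \<Rightarrow> 'g) \<Rightarrow> ('i \<Rightarrow> 'g) \<Rightarrow>
   'i \<Rightarrow> ('g \<Rightarrow> complex) \<Rightarrow> 'g \<Rightarrow> complex" where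
  "simple_reflection scale br H e h i \<mu> = (\<lambda>x. \<mu> x - \<mu> (h i) * simple_root scale br H e i x)"

definition weyl_word ::
  "(complex \<Rightarrow> 'g::ab_group_add \<Rightarrow> 'g) \<Rightarrow> ('g \<Rightarrow> 'g \<Rightarrow> 'g) \<Rightarrow> 'g set \<Rightarrow> ('i \<Rightarrow> 'g) \<Rightarrow> ('i \<Rightarrow> 'g) \<Rightarrow>
   'i list \<Rightarrow> ('g \<Rightarrow> complex) \<Rightarrow> 'g \<Rightarrow> complex" where
  "weyl_word scale br H e h js \<mu> = foldr (simple_reflection scale br H e h) js \<mu>"

text \<open>
  Since simple reflections are involutions, the group they generate consists of the
  products of words in them.
\<close>
definition weyl_group ::
  "(complex \<Rightarrow> 'g::ab_group_add \<Rightarrow> 'g) \<Rightarrow> ('g \<Rightarrow> 'g \<Rightarrow> 'g) \<Rightarrow> 'g set \<Rightarrow> ('i \<Rightarrow> 'g) \<Rightarrow> ('i \<Rightarrow> 'g) \<Rightarrow>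
   (('g \<Rightarrow> complex) \<Rightarrow> 'g \<Rightarrow> complex) set" where
  "weyl_group scale br H e h = range (weyl_word scale br H e h)"

definition reduced_word ::
  "(complex \<Rightarrow> 'g::ab_group_add \<Rightarrow> 'g) \<Rightarrow> ('g \<Rightarrow> 'g \<Rightarrow> 'g) \<Rightarrow> 'g set \<Rightarrow> ('i \<Rightarrow> 'g) \<Rightarrow> ('i \<Rightarrow> 'g) \<Rightarrow>
   (('g \<Rightarrow> complex) \<Rightarrow> 'g \<Rightarrow> complex) \<Rightarrow> 'i list \<Rightarrow> bool" where
  "reduced_word scale br H e h w js \<longleftrightarrow>
     weyl_word scale br H e h js = w \<and>
     (\<forall>ks. weyl_word scale br H e h ks = w \<longrightarrow> length js \<le> length ks)"

section \<open>The Yangian\<close>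

datatype 'a free_monoid = Word "'a list"

instantiation free_monoid :: (type) monoid_add
begin
definition zero_free_monoid :: "'a free_monoid" where
  "0 = Word []"
fun plus_free_monoid :: "'a free_monoid \<Rightarrow> 'a free_monoid \<Rightarrow> 'a free_monoid" where
  "Word xs + Word ys = Word (xs @ ys)"
instance
proof
  fix x y z :: "'a free_monoid"
  show "x + y + z = x + (y + z)"
    by (cases x; cases y; cases z) simp
  show "0 + x = x"
    by (cases x) (simp add: zero_free_monoid_def)
  show "x + 0 = x"
    by (cases x) (simp add: zero_free_monoid_def)
qed
end

text \<open>
  The free associative unital algebra on a set of generators is the monoid algebra of the free
  monoid: its ring structure is the convolution product of finitely supported functions.
\<close>
type_synonym 'a free_algebra = "'a free_monoid \<Rightarrow>\<^sub>0 complex"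

definition gen :: "'a \<Rightarrow> 'a free_algebra" where
  "gen g = Poly_Mapping.single (Word [g]) 1"

definition scalar :: "complex \<Rightarrow> 'a free_algebra" where
  "scalar c = Poly_Mapping.single 0 c"

definition commutator :: "'a::ring \<Rightarrow> 'a \<Rightarrow> 'a" where
  "commutator p q = p * q - q * p"

datatype sign = Plus | Minus

fun sgn_val :: "sign \<Rightarrow> complex" where
  "sgn_val Plus = 1"
| "sgn_val Minus = - 1"

datatype 'i ygen = Xi 'i nat | Xpm sign 'i nat

definition xi :: "'i \<Rightarrow> nat \<Rightarrow> 'i ygen free_algebra" where
  "xi i r = gen (Xi i r)"

definition xpm :: "sign \<Rightarrow> 'i \<Rightarrow> nat \<Rightarrow> 'i ygen free_algebra" where
  "xpm \<epsilon> i r = gen (Xpm \<epsilon> i r)"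

definition sym_entry :: "('i \<Rightarrow> 'i \<Rightarrow> int) \<Rightarrow> ('i \<Rightarrow> nat) \<Rightarrow> 'i \<Rightarrow> 'i \<Rightarrow> complex" where
  "sym_entry a d i j = of_nat (d i) * of_int (a i j)"

inductive_set yangian_relators ::
  "('i \<Rightarrow> 'i \<Rightarrow> int) \<Rightarrow> ('i \<Rightarrow> nat) \<Rightarrow> complex \<Rightarrow> 'i ygen free_algebra set"
  for a d hbar where
  xi_xi: "commutator (xi i r) (xi j s) \<in> yangian_relators a d hbar"
| xi_0_x: "commutator (xi i 0) (xpm \<epsilon> j s) - scalar (sgn_val \<epsilon> * sym_entry a d i j) * xpm \<epsilon> j s
     \<in> yangian_relators a d hbar"
| xi_x: "commutator (xi i (r + 1)) (xpm \<epsilon> j s) - commutator (xi i r) (xpm \<epsilon> j (s + 1))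
     - scalar (sgn_val \<epsilon> * hbar * (sym_entry a d i j / 2)) * (xi i r * xpm \<epsilon> j s + xpm \<epsilon> j s * xi i r)
     \<in> yangian_relators a d hbar"
| x_x: "commutator (xpm \<epsilon> i (r + 1)) (xpm \<epsilon> j s) - commutator (xpm \<epsilon> i r) (xpm \<epsilon> j (s + 1))
     - scalar (sgn_val \<epsilon> * hbar * (sym_entry a d i j / 2)) * (xpm \<epsilon> i r * xpm \<epsilon> j s + xpm \<epsilon> j s * xpm \<epsilon> i r)
     \<in> yangian_relators a d hbar"
| x_plus_x_minus: "commutator (xpm Plus i r) (xpm Minus j s) - (if i = j then xi i (r + s) else 0)
     \<in> yangian_relators a d hbar"
| serre: "i \<noteq> j \<Longrightarrow> m = nat (1 - a i j) \<Longrightarrow>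
     (\<Sum>p | p permutes {..<m}.
        foldr (\<lambda>k y. commutator (xpm \<epsilon> i (r (p k))) y) [0..<m] (xpm \<epsilon> j s))
     \<in> yangian_relators a d hbar"

definition yangian_ideal ::
  "('i \<Rightarrow> 'i \<Rightarrow> int) \<Rightarrow> ('i \<Rightarrow> nat) \<Rightarrow> complex \<Rightarrow> 'i ygen free_algebra set" where
  "yangian_ideal a d hbar = genideal ring_of_type_algebra (yangian_relators a d hbar)"

definition yangian ::
  "('i \<Rightarrow> 'i \<Rightarrow> int) \<Rightarrow> ('i \<Rightarrow> nat) \<Rightarrow> complex \<Rightarrow> 'i ygen free_algebra set ring" where
  "yangian a d hbar = ring_of_type_algebra Quot yangian_ideal a d hbar"

definition ycls ::
  "('i \<Rightarrow> 'i \<Rightarrow> int) \<Rightarrow> ('i \<Rightarrow> nat) \<Rightarrow> complex \<Rightarrow> 'i ygen free_algebra \<Rightarrow> 'i ygen free_algebra set" where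
  "ycls a d hbar p = yangian_ideal a d hbar +>\<^bsub>ring_of_type_algebra\<^esub> p"

text \<open>
  The coefficient of \<open>u\<^sup>-\<^sup>n\<close> in \<open>\<xi>\<^sub>i(u)\<close> and in \<open>x\<^sub>i\<^sup>\<plusminus>(u)\<close>.
\<close>
definition xi_coeff ::
  "('i \<Rightarrow> 'i \<Rightarrow> int) \<Rightarrow> ('i \<Rightarrow> nat) \<Rightarrow> complex \<Rightarrow> 'i \<Rightarrow> int \<Rightarrow> 'i ygen free_algebra set" where
  "xi_coeff a d hbar i n = ycls a d hbar
     (if n < 0 then 0 else if n = 0 then 1 else scalar hbar * xi i (nat (n - 1)))"

definition x_coeff ::
  "('i \<Rightarrow> 'i \<Rightarrow> int) \<Rightarrow> ('i \<Rightarrow> nat) \<Rightarrow> complex \<Rightarrow> sign \<Rightarrow> 'i \<Rightarrow> int \<Rightarrow> 'i ygen free_algebra set" where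
  "x_coeff a d hbar \<epsilon> i n = ycls a d hbar
     (if n \<le> 0 then 0 else scalar hbar * xpm \<epsilon> i (nat (n - 1)))"

section \<open>Modules over the Yangian\<close>

locale yangian_module = vector_space scale
  for a :: "'i::finite \<Rightarrow> 'i \<Rightarrow> int" and d :: "'i \<Rightarrow> nat" and hbar :: complex
    and scale :: "complex \<Rightarrow> 'v::ab_group_add \<Rightarrow> 'v"
    and act :: "'i ygen free_algebra set \<Rightarrow> 'v \<Rightarrow> 'v" +
  assumes act_add_right: "y \<in> carrier (yangian a d hbar) \<Longrightarrow> act y (v + w) = act y v + act y w"
    and act_add_left: "\<lbrakk>y \<in> carrier (yangian a d hbar); z \<in> carrier (yangian a d hbar)\<rbrakk> \<Longrightarrow>
          act (y \<oplus>\<^bsub>yangian a d hbar\<^esub> z) v = act y v + act z v"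
    and act_mult: "\<lbrakk>y \<in> carrier (yangian a d hbar); z \<in> carrier (yangian a d hbar)\<rbrakk> \<Longrightarrow>
          act (y \<otimes>\<^bsub>yangian a d hbar\<^esub> z) v = act y (act z v)"
    and act_one: "act \<one>\<^bsub>yangian a d hbar\<^esub> v = v"
    and act_scalar: "act (ycls a d hbar (scalar c)) v = scale c v"

definition submodule ::
  "('i \<Rightarrow> 'i \<Rightarrow> int) \<Rightarrow> ('i \<Rightarrow> nat) \<Rightarrow> complex \<Rightarrow> (complex \<Rightarrow> 'v::ab_group_add \<Rightarrow> 'v) \<Rightarrow>
   ('i ygen free_algebra set \<Rightarrow> 'v \<Rightarrow> 'v) \<Rightarrow> 'v set \<Rightarrow> bool" where
  "submodule a d hbar scale act S \<longleftrightarrow>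
     Modules.module.subspace scale S \<and>
     (\<forall>y\<in>carrier (yangian a d hbar). \<forall>v\<in>S. act y v \<in> S)"

definition irreducible_module ::
  "('i \<Rightarrow> 'i \<Rightarrow> int) \<Rightarrow> ('i \<Rightarrow> nat) \<Rightarrow> complex \<Rightarrow> (complex \<Rightarrow> 'v::ab_group_add \<Rightarrow> 'v) \<Rightarrow>
   ('i ygen free_algebra set \<Rightarrow> 'v \<Rightarrow> 'v) \<Rightarrow> bool" where
  "irreducible_module a d hbar scale act \<longleftrightarrow>
     (\<exists>v::'v. v \<noteq> 0) \<and>
     (\<forall>S. submodule a d hbar scale act S \<longrightarrow> S = {0} \<or> S = UNIV)"

text \<open>
  The weight space for a functional \<open>\<mu>\<close> on the Cartan subalgebra.  The \<open>h\<^sub>i\<close> form a basis of the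
  Cartan subalgebra, and \<open>h\<^sub>i\<close> acts as \<open>d\<^sub>i\<^sup>-\<^sup>1 \<xi>\<^bsub>i,0\<^esub>\<close>.
\<close>
definition weight_space ::
  "('i \<Rightarrow> 'i \<Rightarrow> int) \<Rightarrow> ('i \<Rightarrow> nat) \<Rightarrow> complex \<Rightarrow> ('i \<Rightarrow> 'g) \<Rightarrow>
   (complex \<Rightarrow> 'v \<Rightarrow> 'v) \<Rightarrow> ('i ygen free_algebra set \<Rightarrow> 'v \<Rightarrow> 'v) \<Rightarrow>
   ('g \<Rightarrow> complex) \<Rightarrow> 'v set" where
  "weight_space a d hbar h scale act \<mu> =
     {v. \<forall>i. act (ycls a d hbar (scalar (1 / of_nat (d i)) * xi i 0)) v = scale (\<mu> (h i)) v}"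

section \<open>Series in \<open>u\<^sup>-\<^sup>1\<close>\<close>

text \<open>
  Formal Laurent series are taken in the variable \<open>u\<^sup>-\<^sup>1\<close>: the library's \<^const>\<open>fls_X\<close> is \<open>u\<^sup>-\<^sup>1\<close>,
  and \<open>fls_nth f n\<close> is the coefficient of \<open>u\<^sup>-\<^sup>n\<close>.  Substituting \<open>u + c\<close> for \<open>u\<close> replaces \<open>u\<^sup>-\<^sup>1\<close> by
  \<open>u\<^sup>-\<^sup>1 / (1 + c u\<^sup>-\<^sup>1)\<close>.
\<close>
definition shift :: "complex \<Rightarrow> complex fls \<Rightarrow> complex fls" where
  "shift c f = fls_compose_fps f (fps_X * inverse (1 + fps_const c * fps_X))"

text \<open>The set \<open>1 + u\<^sup>-\<^sup>1 \<complex>[[u\<^sup>-\<^sup>1]]\<close>.\<close>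
definition unit_series :: "complex fls set" where
  "unit_series = {fps_to_fls (1 + fps_X * g) | g. True}"

definition series_of_poly :: "complex poly \<Rightarrow> complex fls" where
  "series_of_poly P = poly (map_poly fls_const P) fls_X_inv"

text \<open>\<open>xi_acts_by \<dots> i f v\<close> states \<open>\<xi>\<^sub>i(u) v = f(u) v\<close>, coefficient by coefficient.\<close>
definition xi_acts_by ::
  "('i \<Rightarrow> 'i \<Rightarrow> int) \<Rightarrow> ('i \<Rightarrow> nat) \<Rightarrow> complex \<Rightarrow> (complex \<Rightarrow> 'v \<Rightarrow> 'v) \<Rightarrow>
   ('i ygen free_algebra set \<Rightarrow> 'v \<Rightarrow> 'v) \<Rightarrow> 'i \<Rightarrow> complex fls \<Rightarrow> 'v \<Rightarrow> bool" where
  "xi_acts_by a d hbar scale act i f v \<longleftrightarrow>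
     (\<forall>n. act (xi_coeff a d hbar i n) v = scale (fls_nth f n) v)"

definition highest_weight_vector ::
  "('i \<Rightarrow> 'i \<Rightarrow> int) \<Rightarrow> ('i \<Rightarrow> nat) \<Rightarrow> complex \<Rightarrow> (complex \<Rightarrow> 'v::ab_group_add \<Rightarrow> 'v) \<Rightarrow>
   ('i ygen free_algebra set \<Rightarrow> 'v \<Rightarrow> 'v) \<Rightarrow> ('i \<Rightarrow> complex fls) \<Rightarrow> 'v \<Rightarrow> bool" where
  "highest_weight_vector a d hbar scale act \<Lambda> v \<longleftrightarrow>
     (\<forall>i. \<Lambda> i \<in> unit_series) \<and>
     v \<noteq> 0 \<and>
     (\<forall>S. submodule a d hbar scale act S \<and> v \<in> S \<longrightarrow> S = UNIV) \<and>
     (\<forall>i n. act (x_coeff a d hbar Plus i n) v = 0) \<and>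
     (\<forall>i. xi_acts_by a d hbar scale act i (\<Lambda> i) v)"

text \<open>
  The isomorphism class of \<open>L(P)\<close>: the finite-dimensional irreducible module of highest weight
  \<open>(P\<^sub>i(u + \<hbar>d\<^sub>i) / P\<^sub>i(u))\<^sub>i\<close>.
\<close>
definition isomorphic_to_L ::
  "('i \<Rightarrow> 'i \<Rightarrow> int) \<Rightarrow> ('i \<Rightarrow> nat) \<Rightarrow> complex \<Rightarrow> (complex \<Rightarrow> 'v::ab_group_add \<Rightarrow> 'v) \<Rightarrow>
   ('i ygen free_algebra set \<Rightarrow> 'v \<Rightarrow> 'v) \<Rightarrow> ('i \<Rightarrow> complex poly) \<Rightarrow> bool" where
  "isomorphic_to_L a d hbar scale act P \<longleftrightarrow>
     finite_dim scale TYPE('v) \<and> irreducible_module a d hbar scale act \<and>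
     (\<exists>v. highest_weight_vector a d hbar scale act
        (\<lambda>i. shift (hbar * of_nat (d i)) (series_of_poly (P i)) / series_of_poly (P i)) v)"

section \<open>Braid group actions\<close>

definition tau ::
  "('i \<Rightarrow> 'i \<Rightarrow> int) \<Rightarrow> ('i \<Rightarrow> nat) \<Rightarrow> complex \<Rightarrow> 'i \<Rightarrow> ('i \<Rightarrow> complex fls) \<Rightarrow> 'i \<Rightarrow> complex fls" where
  "tau a d hbar j \<Lambda> i = \<Lambda> i *
     (\<Prod>k<nat \<bar>a j i\<bar>.
        shift (- (hbar * of_nat (d j) / 2 * (of_int \<bar>a j i\<bar> - 2 * of_nat k))) (\<Lambda> j)
          powi (if i = j then - 1 else 1))"

definition tau_M ::
  "('i \<Rightarrow> 'i \<Rightarrow> int) \<Rightarrow> ('i \<Rightarrow> nat) \<Rightarrow> complex \<Rightarrow> 'i \<Rightarrow> ('i \<Rightarrow> complex fls) \<Rightarrow> 'i \<Rightarrow> complex fls" where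
  "tau_M a d hbar j \<Lambda> i = \<Lambda> i *
     (\<Prod>k<nat \<bar>a i j\<bar>.
        shift (- (hbar * of_nat (d i) / 2 * (of_int \<bar>a i j\<bar> - 2 * of_nat k))) (\<Lambda> j)
          powi (if i = j then - 1 else 1))"

text \<open>
  The operator by which \<open>\<tau>\<^bsub>i\<^sub>1\<^esub> \<cdots> \<tau>\<^bsub>i\<^sub>l\<^esub>\<close> acts; for a reduced word of \<open>w\<close> this product is \<open>\<tau>\<^sub>w\<close>.
\<close>
definition tau_word ::
  "('i \<Rightarrow> 'i \<Rightarrow> int) \<Rightarrow> ('i \<Rightarrow> nat) \<Rightarrow> complex \<Rightarrow> 'i list \<Rightarrow>
   ('i \<Rightarrow> complex fls) \<Rightarrow> 'i \<Rightarrow> complex fls" where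
  "tau_word a d hbar js \<Lambda> = foldr (tau a d hbar) js \<Lambda>"

definition tau_M_word ::
  "('i \<Rightarrow> 'i \<Rightarrow> int) \<Rightarrow> ('i \<Rightarrow> nat) \<Rightarrow> complex \<Rightarrow> 'i list \<Rightarrow>
   ('i \<Rightarrow> complex fls) \<Rightarrow> 'i \<Rightarrow> complex fls" where
  "tau_M_word a d hbar js \<Lambda> = foldr (tau_M a d hbar) js \<Lambda>"

end

theory Submission
  imports Defs
begin

text \<open>
  The weight spaces \<open>V\<^bsub>\<sigma>\<lambda>\<^esub>\<close> are lines, and along a reduced word \<open>\<sigma> = s\<^sub>j \<sigma>'\<close> one passes from
  \<open>V\<^bsub>\<sigma>'\<lambda>\<^esub>\<close> to \<open>V\<^bsub>\<sigma>\<lambda>\<^esub>\<close> by lowering operators of the single node \<open>j\<close>.  So everything reduces to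
  one step.  Let \<open>u\<close> span \<open>V\<^sub>\<nu>\<close>, \<open>\<nu> = \<sigma>'\<lambda>\<close>, let \<open>\<nu> + \<alpha>\<^sub>j\<close> not be a weight, put
  \<open>n = \<nu>(h\<^sub>j)\<close> and \<open>x\<^sub>r = x\<^sup>-\<^bsub>j,r\<^esub>\<close>.  By \<open>sl\<^sub>2\<close>-theory \<open>w = x\<^sub>0\<^sup>n u\<close> spans \<open>V\<^bsub>s\<^sub>j\<nu>\<^esub>\<close>.  Let
  \<open>\<lambda>\<^sub>i(z)\<close> and \<open>\<kappa>\<^sub>i(z)\<close> be the eigenvalues of \<open>\<xi>\<^sub>i(z)\<close> on \<open>u\<close> and \<open>w\<close>.

  Consider \<open>y(b) = (z + b) x\<^sub>0 - x\<^sub>1\<close>.  Because \<open>V\<^bsub>s\<^sub>j\<nu>\<^esub>\<close> is a line, \<open>y(b)\<^sup>n u = Q(z + b) w\<close> for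
  one monic polynomial \<open>Q\<close> of degree \<open>n\<close>.  The defining relations say exactly that
  \<open>\<xi>\<^sub>i(z) y(c) = y(-c) \<xi>\<^sub>i(z)\<close> with \<open>c = \<hbar> d\<^sub>i a\<^bsub>ij\<^esub> / 2\<close>, and applying this \<open>n\<close> times to \<open>u\<close> gives
  \<open>\<kappa>\<^sub>i(z) Q(z + c) = \<lambda>\<^sub>i(z) Q(z - c)\<close> (lemma \<open>string_eigenvalues\<close>).

  It remains to see that \<open>Q\<close> is a Drinfeld polynomial: \<open>\<lambda>\<^sub>j(z) = Q(z + a) / Q(z)\<close> with
  \<open>a = \<hbar> d\<^sub>j\<close> (lemma \<open>string_drinfeld\<close>).  The operators \<open>y = y(0)\<close> and \<open>x = x\<^sub>0\<close> satisfy the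
  relation \<open>y x = x y + a x\<^sup>2\<close> of the Jordan plane, whence \<open>(y - a x)\<^sup>m = y\<^sup>m - m a x y\<^bsup>m-1\<^esup>\<close>.  With this,
  commuting \<open>x\<^sup>+\<^sub>j(z)\<close> through \<open>y(a)\<^sup>n\<close> gives the closed formula
  \<open>x\<^sup>+\<^sub>j(z) y(a)\<^sup>n u = n a \<lambda>\<^sub>j(z) y\<^bsup>n-1\<^esup> u\<close>.  Apply \<open>x\<^sub>0\<close>, which kills \<open>w\<close>: the left side becomes
  \<open>(1 - \<kappa>\<^sub>j(z)) Q(z + a) w\<close>, the right side \<open>\<lambda>\<^sub>j(z) (Q(z) - Q(z - a)) w\<close>, and
  \<open>\<kappa>\<^sub>j(z) Q(z + a) = \<lambda>\<^sub>j(z) Q(z - a)\<close> cancels two terms.  Once \<open>\<lambda>\<^sub>j\<close> has this form, the product that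
  defines \<open>\<tau>\<^sub>j\<close> telescopes to \<open>Q(z - c) / Q(z + c)\<close> (lemma \<open>tau_quotient\<close>), so
  \<open>\<kappa>\<^sub>i = \<tau>\<^sub>j(\<lambda>)\<^sub>i\<close>.  The same telescoping turns \<open>\<tau>\<close> on quotients \<open>P(z + \<hbar>d\<^sub>i) / P(z)\<close> into
  \<open>\<tau>\<^sup>M\<close> on the \<open>P\<close>, which is the second half of the theorem, because the highest weight of a module
  is unique.

  The condition that \<open>\<sigma>'\<lambda> + \<alpha>\<^sub>j\<close> is no weight is where reducedness enters.  The set of weights is
  stable under reflections and lies in \<open>\<lambda>\<close> minus sums of simple roots, so it is enough that
  \<open>\<sigma>'\<^sup>-\<^sup>1\<alpha>\<^sub>j\<close> is a positive root; this is the exchange argument, for which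
  the sign-coherence of roots is derived from the positive definite form alone.
\<close>

section \<open>Shifts of series and the braid group operators\<close>

abbreviation shift_subst :: "complex \<Rightarrow> complex fps" where
  "shift_subst c \<equiv> fps_X * inverse (1 + fps_const c * fps_X)"

lemma shift_subst_nonzero: "shift_subst c \<noteq> 0" "shift_subst c $ 0 = 0"
proof -
  have "(shift_subst c) $ 1 = 1" by simp
  then show "shift_subst c \<noteq> 0" by (metis fps_zero_nth zero_neq_one)
qed simp

text \<open>
  The substitutions \<open>t \<mapsto> t / (1 + c t)\<close> are the translations \<open>z \<mapsto> z + c\<close> in the coordinate
  \<open>t = 1/z\<close>, so they compose additively.
\<close>
lemma shift_subst_compose: "shift_subst c oo shift_subst b = shift_subst (b + c)"
proof -
  let ?g = "shift_subst b"
  have u: "(1 + fps_const x * fps_X :: complex fps) \<noteq> 0" for x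
  proof
    assume "(1 + fps_const x * fps_X :: complex fps) = 0"
    then have "(1 + fps_const x * fps_X :: complex fps) $ 0 = 0" by simp
    then show False by simp
  qed
  have inv: "inverse (1 + fps_const x * fps_X) * (1 + fps_const x * fps_X :: complex fps) = 1" for x
    by (rule inverse_mult_eq_1) simp
  have "inverse (1 + fps_const c * fps_X) oo ?g = inverse (1 + fps_const c * ?g)"
    by (subst fps_inverse_compose) (simp_all add: fps_compose_add_distrib fps_compose_mult_distrib)
  then have 1: "shift_subst c oo ?g = ?g * inverse (1 + fps_const c * ?g)"
    by (simp add: fps_compose_mult_distrib)
  have "?g * (1 + fps_const (b + c) * fps_X) = 
     fps_X * (inverse (1 + fps_const b * fps_X) * (1 + fps_const b * fps_X)) + fps_X * (fps_const c * ?g)"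
    by (simp add: algebra_simps flip: fps_const_add)
  also have "\<dots> = fps_X * (1 + fps_const c * ?g)"
    unfolding inv by (simp add: algebra_simps)
  finally have 2: "?g * (1 + fps_const (b + c) * fps_X) = fps_X * (1 + fps_const c * ?g)" .
  have "?g * inverse (1 + fps_const c * ?g) * (1 + fps_const (b + c) * fps_X)
     = fps_X * (inverse (1 + fps_const c * ?g) * (1 + fps_const c * ?g))"
    (is "_ * ?J * ?K = _")
  proof -
    have "?g * ?J * ?K = (?g * ?K) * ?J" by (simp only: mult_ac)
    also have "\<dots> = fps_X * (1 + fps_const c * ?g) * ?J" by (simp only: 2)
    finally show ?thesis by (simp only: mult_ac)
  qed
  also have "inverse (1 + fps_const c * ?g) * (1 + fps_const c * ?g) = 1"
    by (rule inverse_mult_eq_1) simp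
  also have "fps_X * 1 = shift_subst (b + c) * (1 + fps_const (b + c) * fps_X)"
    using inv[of "b + c"] by (simp only: mult.assoc)
  finally have "?g * inverse (1 + fps_const c * ?g) = shift_subst (b + c)"
    using u[of "b + c"] mult_right_cancel by blast
  then show ?thesis using 1 by simp
qed

lemma shift_shift: "shift b (shift c f) = shift (b + c) f"
  unfolding shift_def
  by (subst fls_compose_fps_assoc) (use shift_subst_nonzero in \<open>simp_all only: shift_subst_compose, simp_all\<close>)

lemma shift_mult: "shift c (f * g) = shift c f * shift c g"
  and shift_divide: "shift c (f / g) = shift c f / shift c g"
  and shift_add: "shift c (f + g) = shift c f + shift c g"
  and shift_powi: "shift c (f powi k) = shift c f powi k"
  and shift_eq_0_iff: "shift c f = 0 \<longleftrightarrow> f = 0"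
  unfolding shift_def
  using shift_subst_nonzero[of c]
  by (simp_all add: fls_compose_fps_mult fls_compose_fps_divide fls_compose_fps_add
      fls_compose_fps_powi fls_compose_fps_eq_0_iff)

lemma shift_prod: "shift c (\<Prod>k\<in>A. F k) = (\<Prod>k\<in>A. shift c (F k))"
  by (induction A rule: infinite_finite_induct) (simp_all add: shift_mult, simp_all add: shift_def)

lemma shift_0: "shift 0 f = f"
proof -
  have "fls_compose_fps f (fps_const 1 * fps_X) = f"
    by (rule fls_eqI) (subst fls_nth_fls_compose_fps_linear; simp)
  then show ?thesis by (simp add: shift_def)
qed

lemma prod_powi: "(\<Prod>k\<in>A. (F k :: 'a::field) powi n) = (\<Prod>k\<in>A. F k) powi n"
  by (induction A rule: infinite_finite_induct) (simp_all add: power_int_mult_distrib)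

text \<open>
  The arguments of consecutive factors differ by \<open>c\<close>, so the numerator of each factor is
  the denominator of the next one.
\<close>
lemma prod_shift_telescope:
  assumes "M \<noteq> 0"
  shows "(\<Prod>k<m. shift (- (c / 2 * (of_nat m - 2 * of_nat k))) (shift c M / M))
    = shift (c * of_nat m / 2) M / shift (- (c * of_nat m / 2)) M"
proof -
  define T where "T k = shift (- (c / 2 * (of_nat m - 2 * of_nat k))) M" for k
  have "shift (- (c / 2 * (of_nat m - 2 * of_nat k))) (shift c M / M) = T (Suc k) / T k" for k
    unfolding T_def shift_divide shift_shift by (simp add: algebra_simps)
  moreover have "T k \<noteq> 0" for k
    using assms by (simp add: T_def shift_eq_0_iff)
  ultimately have "(\<Prod>k<m. shift (- (c / 2 * (of_nat m - 2 * of_nat k))) (shift c M / M)) = T m / T 0"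
    by (simp add: prod_lessThan_telescope)
  then show ?thesis by (simp add: T_def algebra_simps)
qed

text \<open>
  The form in which \<open>tau\<close> and \<open>tau_M\<close> meet the telescoping product: the exponent \<open>-1\<close>
  on the diagonal and the sign of the off-diagonal Cartan integers produce the same formula.
\<close>
lemma prod_shift_telescope_signed:
  fixes b :: int
  assumes "M \<noteq> 0" and "if P then b = 2 else b \<le> 0"
  shows "(\<Prod>k<nat \<bar>b\<bar>. shift (- (c / 2 * (of_int \<bar>b\<bar> - 2 * of_nat k))) (shift c M / M)
            powi (if P then - 1 else 1))
     = shift (- (c * of_int b / 2)) M / shift (c * of_int b / 2) M"
proof -
  have "(\<Prod>k<nat \<bar>b\<bar>. shift (- (c / 2 * (of_int \<bar>b\<bar> - 2 * of_nat k))) (shift c M / M)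
            powi (if P then - 1 else 1))
      = (shift (c * of_int \<bar>b\<bar> / 2) M / shift (- (c * of_int \<bar>b\<bar> / 2)) M)  powi (if P then - 1 else 1)"
    unfolding prod_powi using prod_shift_telescope[OF assms(1), of c "nat \<bar>b\<bar>"]
    by simp
  also have "\<dots> = shift (- (c * of_int b / 2)) M / shift (c * of_int b / 2) M"
    using assms(2) by (auto split: if_splits simp: power_int_minus)
  finally show ?thesis .
qed

text \<open>
  If \<open>\<Lambda>\<^sub>j\<close> is a quotient of Drinfeld type, then \<open>\<tau>\<^sub>j\<close> multiplies each component by the factor
  that a string of lowering operators produces, see \<open>string_eigenvalues\<close>.
\<close>
lemma tau_quotient:
  assumes "M \<noteq> 0" and "\<Lambda> j = shift (hbar * of_nat (d j)) M / M"
    and "if i = j then a j i = 2 else a j i \<le> 0"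
  shows "tau a d hbar j \<Lambda> i = \<Lambda> i *
    (shift (- (hbar * of_nat (d j) * of_int (a j i) / 2)) M
      / shift (hbar * of_nat (d j) * of_int (a j i) / 2) M)"
  using prod_shift_telescope_signed[OF assms(1,3), of "hbar * of_nat (d j)"]
  unfolding tau_def assms(2) by simp

lemma tau_M_nonzero:
  assumes "\<And>k. M k \<noteq> 0"
  shows "tau_M a d hbar j M i \<noteq> 0"
  using assms by (auto simp: tau_M_def shift_eq_0_iff)

text \<open>
  Both sides telescope to the same quotient: \<open>\<tau>\<^sub>j\<close> uses steps \<open>\<hbar>d\<^sub>j\<close>, there are \<open>|a\<^bsub>ji\<^esub>|\<close> of them,
  and \<open>\<tau>\<^sup>M\<^sub>j\<close> uses \<open>|a\<^bsub>ij\<^esub>|\<close> steps \<open>\<hbar>d\<^sub>i\<close>; the total lengths agree since \<open>d\<^sub>j a\<^bsub>ji\<^esub> = d\<^sub>i a\<^bsub>ij\<^esub>\<close>.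
\<close>
lemma tau_quotient_tau_M:
  assumes M: "\<And>k. M k \<noteq> 0"
    and a: "a j j = 2" "\<And>i. i \<noteq> j \<Longrightarrow> a i j \<le> 0 \<and> a j i \<le> 0"
    and d: "\<And>i. int (d i) * a i j = int (d j) * a j i"
  shows "tau a d hbar j (\<lambda>k. shift (hbar * of_nat (d k)) (M k) / M k) i
    = shift (hbar * of_nat (d i)) (tau_M a d hbar j M i) / tau_M a d hbar j M i"
proof -
  let ?c = "hbar * of_nat (d i)"
  have "of_int (int (d i) * a i j) = (of_int (int (d j) * a j i) :: complex)"
    by (simp only: d)
  then have dd: "hbar * of_nat (d j) * of_int (a j i) = ?c * of_int (a i j)"
    by simp
  define g where "g k = shift (- (?c / 2 * (of_int \<bar>a i j\<bar> - 2 * of_nat k))) (M j)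
          powi (if i = j then - 1 else 1)" for k :: nat
  have g0: "g k \<noteq> 0" for k using M by (simp add: g_def shift_eq_0_iff)
  have "shift ?c (g k) / g k = shift (- (?c / 2 * (of_int \<bar>a i j\<bar> - 2 * of_nat k))) (shift ?c (M j) / M j)
          powi (if i = j then - 1 else 1)" for k
    unfolding g_def shift_powi shift_divide shift_shift power_int_divide_distrib
    by (simp add: add.commute)
  then have "(\<Prod>k<nat \<bar>a i j\<bar>. shift ?c (g k)) / (\<Prod>k<nat \<bar>a i j\<bar>. g k)
     = (\<Prod>k<nat \<bar>a i j\<bar>. shift (- (?c / 2 * (of_int \<bar>a i j\<bar> - 2 * of_nat k))) (shift ?c (M j) / M j)
          powi (if i = j then - 1 else 1))"
    unfolding prod_dividef[symmetric] by simp
  also have "\<dots> = shift (- (?c * of_int (a i j) / 2)) (M j) / shift (?c * of_int (a i j) / 2) (M j)"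
    by (rule prod_shift_telescope_signed) (use M a in auto)
  finally have 1: "(\<Prod>k<nat \<bar>a i j\<bar>. shift ?c (g k)) / (\<Prod>k<nat \<bar>a i j\<bar>. g k) = \<dots>" .
  have 2: "tau a d hbar j (\<lambda>k. shift (hbar * of_nat (d k)) (M k) / M k) i
     = shift ?c (M i) / M i * (shift (- (?c * of_int (a i j) / 2)) (M j) / shift (?c * of_int (a i j) / 2) (M j))"
    unfolding dd[symmetric] by (rule tau_quotient) (use M a in auto)
  have 3: "tau_M a d hbar j M i = M i * (\<Prod>k<nat \<bar>a i j\<bar>. g k)"
    by (simp add: tau_M_def g_def)
  show ?thesis
    unfolding 2 3 shift_mult shift_prod 1[symmetric] by simp
qed

section \<open>Roots and reduced words\<close>

text \<open>
  Elements of the root lattice are coordinate vectors with respect to the simple roots.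
\<close>
definition root_reflection :: "('i::finite \<Rightarrow> 'i \<Rightarrow> int) \<Rightarrow> 'i \<Rightarrow> ('i \<Rightarrow> int) \<Rightarrow> 'i \<Rightarrow> int" where
  "root_reflection a k c = c(k := c k - (\<Sum>l\<in>UNIV. a k l * c l))"

definition unit_vec :: "'i \<Rightarrow> 'i \<Rightarrow> int" where
  "unit_vec k = (\<lambda>l. if l = k then 1 else 0)"

definition functional_reflection ::
  "('i \<Rightarrow> 'x \<Rightarrow> complex) \<Rightarrow> ('i \<Rightarrow> 'x) \<Rightarrow> 'i \<Rightarrow> ('x \<Rightarrow> complex) \<Rightarrow> 'x \<Rightarrow> complex" where
  "functional_reflection \<alpha> h k \<nu> = (\<lambda>x. \<nu> x - \<nu> (h k) * \<alpha> k x)"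

text \<open>
  Off-diagonal entries of a symmetric matrix come in equal pairs, which is the source of the
  additional factor 2.
\<close>
lemma sum_symmetric_dvd:
  fixes f :: "'i \<Rightarrow> 'i \<Rightarrow> int"
  assumes "finite A" "\<And>i j. f i j = f j i" "\<And>i j. m dvd f i j" "\<And>i. 2 * m dvd f i i"
  shows "2 * m dvd (\<Sum>i\<in>A. \<Sum>j\<in>A. f i j)"
  using assms(1)
proof (induction A)
  case (insert x A)
  have "(\<Sum>i\<in>A. f i x) = (\<Sum>j\<in>A. f x j)"
    by (intro sum.cong refl assms(2))
  then have "(\<Sum>i\<in>insert x A. \<Sum>j\<in>insert x A. f i j)
     = f x x + 2 * (\<Sum>j\<in>A. f x j) + (\<Sum>i\<in>A. \<Sum>j\<in>A. f i j)"
    using insert.hyps by (simp add: sum.distrib)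
  moreover have "2 * m dvd 2 * (\<Sum>j\<in>A. f x j)"
    using assms(3) by (simp add: dvd_sum)
  ultimately show ?case using insert.IH assms(4)[of x] by simp
qed simp

locale finite_type_cartan =
  fixes a :: "'i::finite \<Rightarrow> 'i \<Rightarrow> int" and d :: "'i \<Rightarrow> nat"
  assumes diag: "a i i = 2"
    and off_diag: "i \<noteq> j \<Longrightarrow> a i j \<le> 0"
    and d_pos: "d i > 0"
    and symm: "int (d i) * a i j = int (d j) * a j i"
    and pos_def: "\<And>x :: 'i \<Rightarrow> real. x i \<noteq> 0 \<Longrightarrow>
       (\<Sum>i\<in>UNIV. \<Sum>j\<in>UNIV. real (d i) * real_of_int (a i j) * x i * x j) > 0"
begin

definition form :: "('i \<Rightarrow> int) \<Rightarrow> ('i \<Rightarrow> int) \<Rightarrow> int" where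
  "form b c = (\<Sum>i\<in>UNIV. \<Sum>j\<in>UNIV. int (d i) * a i j * b i * c j)"

lemma form_commute: "form b c = form c b"
  unfolding form_def
  by (subst sum.swap, intro sum.cong refl) (subst symm, simp)

lemma form_diff_left: "form (\<lambda>k. b k - c k) x = form b x - form c x"
  by (simp add: form_def algebra_simps sum_subtractf)

lemma form_diff_right: "form x (\<lambda>k. b k - c k) = form x b - form x c"
  by (simp add: form_def algebra_simps sum_subtractf)

lemma form_unit_vec: "form (\<lambda>l. m * unit_vec k l) c = m * int (d k) * (\<Sum>l\<in>UNIV. a k l * c l)"
proof -
  have "form (\<lambda>l. m * unit_vec k l) c
      = (\<Sum>i\<in>UNIV. if i = k then (\<Sum>j\<in>UNIV. int (d i) * a i j * m * c j) else 0)"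
    unfolding form_def by (intro sum.cong refl) (simp add: unit_vec_def)
  then show ?thesis by (simp add: sum_distrib_left algebra_simps)
qed

lemma sum_unit_vec: "(\<Sum>l\<in>UNIV. a k l * (m * unit_vec p l)) = m * a k p"
proof -
  have "(\<Sum>l\<in>UNIV. a k l * (m * unit_vec p l)) = (\<Sum>l\<in>UNIV. if l = p then m * a k l else 0)"
    by (intro sum.cong refl) (simp add: unit_vec_def)
  then show ?thesis by simp
qed

lemma root_reflection_eq:
  "root_reflection a k c = (\<lambda>l. c l - (\<Sum>l\<in>UNIV. a k l * c l) * unit_vec k l)"
  by (auto simp: root_reflection_def unit_vec_def)

lemma form_root_reflection: "form (root_reflection a k c) (root_reflection a k c) = form c c"
proof -
  let ?p = "\<Sum>l\<in>UNIV. a k l * c l"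
  have "form c (\<lambda>l. ?p * unit_vec k l) = ?p * int (d k) * ?p"
    using form_commute form_unit_vec by metis
  then show ?thesis
    unfolding root_reflection_eq form_diff_left form_diff_right form_unit_vec sum_unit_vec diag
    by simp
qed

lemma root_reflection_involution: "root_reflection a k (root_reflection a k c) = c"
proof -
  let ?p = "\<Sum>l\<in>UNIV. a k l * c l"
  have "(\<Sum>l\<in>UNIV. a k l * root_reflection a k c l) = ?p - ?p * 2"
    unfolding root_reflection_eq using sum_unit_vec[of k ?p k]
    by (simp add: algebra_simps sum_subtractf diag)
  then show ?thesis
    by (auto simp: root_reflection_def fun_eq_iff)
qed

lemma foldr_fold_root_reflection:
  "foldr (root_reflection a) js (fold (root_reflection a) js c) = c"
  by (induction js arbitrary: c) (simp_all add: root_reflection_involution)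

text \<open>
  The coroot of a root \<open>\<Sum>\<^sub>k c\<^sub>k \<alpha>\<^sub>k\<close> of norm \<open>2 d\<^sub>i\<close> is \<open>\<Sum>\<^sub>k (d\<^sub>k c\<^sub>k / d\<^sub>i) h\<^sub>k\<close>; the condition
  says that its coordinates are integers.
\<close>
definition coroot_integral :: "'i \<Rightarrow> ('i \<Rightarrow> int) \<Rightarrow> bool" where
  "coroot_integral i c \<longleftrightarrow> (\<forall>k. int (d i) dvd int (d k) * c k)"

lemma coroot_integral_reflection:
  assumes "coroot_integral i c"
  shows "coroot_integral i (root_reflection a k c)"
proof -
  have "int (d k) * (\<Sum>l\<in>UNIV. a k l * c l) = (\<Sum>l\<in>UNIV. a l k * (int (d l) * c l))"
    unfolding sum_distrib_left
  proof (intro sum.cong refl)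
    fix l
    show "int (d k) * (a k l * c l) = a l k * (int (d l) * c l)"
      using symm[of k l] by (metis mult.assoc mult.commute)
  qed
  moreover have "int (d i) dvd (\<Sum>l\<in>UNIV. a l k * (int (d l) * c l))"
    using assms by (intro dvd_sum, intro dvd_mult[of _ "int _ * _"]) (simp add: coroot_integral_def)
  ultimately have "int (d i) dvd int (d k) * (\<Sum>l\<in>UNIV. a k l * c l)" by simp
  then show ?thesis
    using assms unfolding coroot_integral_def root_reflection_def
    by (simp add: right_diff_distrib)
qed

lemma form_pos:
  assumes "c i \<noteq> 0"
  shows "form c c > 0"
proof -
  have "real_of_int (form c c) > 0"
    using pos_def[of "\<lambda>i. real_of_int (c i)" i] assms by (simp add: form_def)
  then show ?thesis by simp
qed

text \<open>
  Coroot integrality makes the form take values in \<open>2 d\<^sub>i \<int>\<close>, so that a nonzero vector of this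
  kind is at least as long as a root.
\<close>
lemma coroot_integral_norm:
  assumes "coroot_integral i c" and "c k \<noteq> 0"
  shows "2 * int (d i) \<le> form c c"
proof -
  have "2 * int (d i) dvd form c c"
    unfolding form_def
  proof (rule sum_symmetric_dvd)
    show "int (d k) * a k l * c k * c l = int (d l) * a l k * c l * c k" for k l
      using symm[of k l] by simp
    have *: "int (d i) dvd int (d k) * c k" for k
      using assms(1) by (simp add: coroot_integral_def)
    have "int (d i) dvd (int (d k) * c k) * (a k l * c l)" for k l
      using *[of k] by (rule dvd_mult2)
    then show "int (d i) dvd int (d k) * a k l * c k * c l" for k l
      by (simp add: ac_simps)
    have "2 * int (d i) dvd (2 * (int (d k) * c k)) * c k" for k
      by (rule dvd_mult2[OF mult_dvd_mono[OF dvd_refl *]])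
    then show "2 * int (d i) dvd int (d k) * a k k * c k * c k" for k
      by (simp add: ac_simps diag)
  qed simp
  then show ?thesis using form_pos[of c k, OF assms(2)] zdvd_imp_le by blast
qed

text \<open>
  Two invariants of the orbit of \<open>\<alpha>\<^sub>i\<close> under reflections; they suffice for the
  sign-coherence of roots.
\<close>
definition root_like :: "'i \<Rightarrow> ('i \<Rightarrow> int) \<Rightarrow> bool" where
  "root_like i c \<longleftrightarrow> coroot_integral i c \<and> form c c = 2 * int (d i)"

lemma root_like_unit_vec: "root_like i (unit_vec i)"
  using form_unit_vec[of 1 i "unit_vec i"] sum_unit_vec[of i 1 i]
  by (simp add: root_like_def coroot_integral_def unit_vec_def diag)

lemma root_like_fold: "root_like i c \<Longrightarrow> root_like i (fold (root_reflection a) js c)"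
  by (induction js arbitrary: c)
    (simp_all add: root_like_def coroot_integral_reflection form_root_reflection)

text \<open>
  Split \<open>c = p - q\<close> into positive and negative part.  Both parts are coroot integral, so each
  of them, if nonzero, has norm at least \<open>2 d\<^sub>i\<close>; as \<open>(p, q) \<le> 0\<close>, the norm of \<open>c\<close> would be at least
  \<open>4 d\<^sub>i\<close>.
\<close>
lemma root_like_sign:
  assumes "root_like i c" and "c k < 0"
  shows "c l \<le> 0"
proof (rule ccontr)
  assume l: "\<not> c l \<le> 0"
  define p where "p = (\<lambda>k. max (c k) 0)"
  define q where "q = (\<lambda>k. max (- c k) 0)"
  have c: "c = (\<lambda>k. p k - q k)" by (auto simp: p_def q_def)
  have "coroot_integral i p" "coroot_integral i q"
    using assms(1) by (auto simp: root_like_def coroot_integral_def p_def q_def max_def)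
  moreover have "p l \<noteq> 0" "q k \<noteq> 0" using l assms(2) by (auto simp: p_def q_def)
  ultimately have "2 * int (d i) \<le> form p p" "2 * int (d i) \<le> form q q"
    by (auto intro: coroot_integral_norm)
  moreover have "form p q \<le> 0"
    unfolding form_def
  proof (intro sum_nonpos)
    fix m n
    show "int (d m) * a m n * p m * q n \<le> 0"
    proof (cases "m = n")
      case True
      then show ?thesis by (auto simp: p_def q_def max_def)
    next
      case False
      then have "int (d m) * a m n \<le> 0" using off_diag by (simp add: mult_nonneg_nonpos)
      moreover have "p m * q n \<ge> 0" by (simp add: p_def q_def)
      ultimately show ?thesis
        by (simp only: mult.assoc[of _ "p m"]) (rule mult_nonpos_nonneg)
    qed
  qed
  moreover have "form c c = form p p + form q q - 2 * form p q"
    using form_commute[of p q] by (simp only: c form_diff_left form_diff_right)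
  ultimately show False using assms(1) d_pos[of i] by (simp add: root_like_def)
qed

lemma root_like_multiple:
  assumes "root_like i c" and "\<And>l. c l \<ge> 0" and "\<And>l. l \<noteq> p \<Longrightarrow> c l = 0"
  shows "c = unit_vec p" and "d p = d i"
proof -
  have c: "c = (\<lambda>l. c p * unit_vec p l)" using assms(3) by (auto simp: unit_vec_def)
  have "form c c = c p * int (d p) * (\<Sum>l\<in>UNIV. a p l * (c p * unit_vec p l))"
    using form_unit_vec[of "c p" p "\<lambda>l. c p * unit_vec p l"] by (simp only: c[symmetric])
  then have n: "int (d i) = c p * (int (d p) * c p)"
    using assms(1) unfolding sum_unit_vec by (simp add: root_like_def diag ac_simps)
  have "c p \<noteq> 0" using n d_pos[of i] by auto
  then have p1: "c p \<ge> 1" using assms(2)[of p] by simp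
  have "int (d i) dvd int (d p) * c p" 
    using assms(1) by (simp add: root_like_def coroot_integral_def)
  then have le: "int (d i) \<le> int (d p) * c p"
    using p1 d_pos[of p] by (intro zdvd_imp_le) simp_all
  have "c p = 1"
  proof (rule ccontr)
    assume "c p \<noteq> 1"
    then have "c p \<ge> 2" using p1 by simp
    then have "2 * (int (d p) * c p) \<le> c p * (int (d p) * c p)"
      using p1 by (intro mult_right_mono) simp_all
    then show False using n le d_pos[of i] by simp
  qed
  then show "c = unit_vec p" "d p = d i" using c n by simp_all
qed

text \<open>
  Follow \<open>\<alpha>\<^sub>j\<close> along the word up to the first reflection \<open>s\<^sub>p\<close> that makes it negative.  Since
  \<open>s\<^sub>p\<close> changes only the coordinate at \<open>p\<close>, the root before this step is supported at \<open>p\<close>, hence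
  equal to \<open>\<alpha>\<^sub>p\<close>.
\<close>
lemma exchange_prefix:
  assumes "fold (root_reflection a) js (unit_vec j) l < 0"
  shows "\<exists>js1 p js2. js = js1 @ p # js2 \<and> fold (root_reflection a) js1 (unit_vec j) = unit_vec p
     \<and> d p = d j"
  using assms
proof (induction js arbitrary: l rule: rev_induct)
  case Nil
  then show ?case by (simp add: unit_vec_def split: if_splits)
next
  case (snoc p js)
  let ?c = "fold (root_reflection a) js (unit_vec j)"
  show ?case
  proof (cases "\<exists>l. ?c l < 0")
    case True
    then show ?thesis using snoc.IH by fastforce
  next
    case False
    then have nonneg: "?c l \<ge> 0" for l by (meson not_less)
    have root: "root_like j ?c" by (intro root_like_fold root_like_unit_vec)
    then have root': "root_like j (root_reflection a p ?c)"
      using root_like_fold[of j ?c "[p]"] by simp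
    have "?c m = 0" if "m \<noteq> p" for m
    proof -
      have "root_reflection a p ?c m \<le> 0"
        using root_like_sign[OF root'] snoc.prems by simp
      then show ?thesis using that nonneg[of m] by (simp add: root_reflection_def)
    qed
    from root_like_multiple[OF root nonneg this] show ?thesis by blast
  qed
qed

lemma roots_independent:
  assumes "\<And>i. (\<Sum>k\<in>UNIV. real_of_int (a i k) * x k) = 0"
  shows "x k = 0"
proof (rule ccontr)
  assume "x k \<noteq> 0"
  then have "(\<Sum>i\<in>UNIV. \<Sum>j\<in>UNIV. real (d i) * real_of_int (a i j) * x i * x j) > 0"
    by (rule pos_def[of x k])
  moreover have "(\<Sum>i\<in>UNIV. \<Sum>j\<in>UNIV. real (d i) * real_of_int (a i j) * x i * x j)
     = (\<Sum>i\<in>UNIV. real (d i) * x i * (\<Sum>j\<in>UNIV. real_of_int (a i j) * x j))"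
    by (simp add: sum_distrib_left algebra_simps)
  ultimately show False using assms by simp
qed

end

text \<open>
  Reflections act on functionals on an arbitrary set that contains the \<open>h\<^sub>i\<close>.  This covers the
  functionals on the Lie algebra and, with \<open>h\<^sub>i = i\<close>, the families \<open>(\<nu>(h\<^sub>i))\<^sub>i\<close> by which the weights of
  a module are recorded.
\<close>
locale reflection_action = finite_type_cartan a d
  for a :: "'i::finite \<Rightarrow> 'i \<Rightarrow> int" and d +
  fixes \<alpha> :: "'i \<Rightarrow> 'x \<Rightarrow> complex" and h :: "'i \<Rightarrow> 'x"
  assumes alpha_h: "\<alpha> k (h i) = of_int (a i k)"
begin

abbreviation refl :: "'i \<Rightarrow> ('x \<Rightarrow> complex) \<Rightarrow> 'x \<Rightarrow> complex" where
  "refl \<equiv> functional_reflection \<alpha> h"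

definition root_functional :: "('i \<Rightarrow> int) \<Rightarrow> 'x \<Rightarrow> complex" where
  "root_functional c = (\<lambda>x. \<Sum>k\<in>UNIV. of_int (c k) * \<alpha> k x)"

text \<open>
  The value of \<open>\<nu>\<close> on the coroot with the coordinates of \<open>coroot_integral\<close>, up to the length
  factor \<open>d\<^sub>i\<close>, which reflections preserve.
\<close>
definition coroot_pairing :: "('x \<Rightarrow> complex) \<Rightarrow> ('i \<Rightarrow> int) \<Rightarrow> complex" where
  "coroot_pairing \<nu> c = (\<Sum>k\<in>UNIV. of_int (int (d k) * c k) * \<nu> (h k))"

lemma root_functional_unit_vec: "root_functional (unit_vec k) = \<alpha> k"
proof
  fix x
  have "root_functional (unit_vec k) x = (\<Sum>l\<in>UNIV. if l = k then \<alpha> l x else 0)"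
    unfolding root_functional_def by (intro sum.cong refl) (simp add: unit_vec_def)
  then show "root_functional (unit_vec k) x = \<alpha> k x" by simp
qed

lemma coroot_pairing_unit_vec: "coroot_pairing \<nu> (unit_vec k) = of_nat (d k) * \<nu> (h k)"
proof -
  have "coroot_pairing \<nu> (unit_vec k) = (\<Sum>l\<in>UNIV. if l = k then of_nat (d l) * \<nu> (h l) else 0)"
    unfolding coroot_pairing_def by (intro sum.cong refl) (simp add: unit_vec_def)
  then show ?thesis by simp
qed

lemma refl_root_functional: "refl k (root_functional c) = root_functional (root_reflection a k c)"
proof
  fix x
  let ?p = "\<Sum>l\<in>UNIV. a k l * c l"
  have "root_functional c (h k) = of_int ?p"
    by (simp add: root_functional_def alpha_h mult.commute)
  moreover have "root_functional (root_reflection a k c) x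
     = root_functional c x - of_int ?p * root_functional (unit_vec k) x"
    unfolding root_functional_def root_reflection_eq
    by (simp add: algebra_simps sum_subtractf sum_distrib_left)
  ultimately show "refl k (root_functional c) x = root_functional (root_reflection a k c) x"
    by (simp add: functional_reflection_def root_functional_unit_vec)
qed

lemma coroot_pairing_refl: "coroot_pairing (refl k \<nu>) c = coroot_pairing \<nu> (root_reflection a k c)"
proof -
  let ?p = "\<Sum>l\<in>UNIV. a k l * c l"
  have "(\<Sum>l\<in>UNIV. of_int (int (d l) * c l) * (\<nu> (h k) * of_int (a l k)))
     = (\<Sum>l\<in>UNIV. of_nat (d k) * \<nu> (h k) * (of_int (a k l) * of_int (c l)))"
  proof (intro sum.cong refl)
    fix l
    have "of_nat (d l) * of_int (a l k) = (of_nat (d k) * of_int (a k l) :: complex)"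
      using arg_cong[OF symm[of l k], of complex_of_int] by simp
    then show "of_int (int (d l) * c l) * (\<nu> (h k) * of_int (a l k))
      = of_nat (d k) * \<nu> (h k) * (of_int (a k l) * of_int (c l))"
      by (metis (no_types, opaque_lifting) mult.assoc mult.commute of_int_mult of_int_of_nat_eq)
  qed
  also have "\<dots> = of_int ?p * (of_nat (d k) * \<nu> (h k))"
    by (simp add: sum_distrib_left sum_distrib_right ac_simps)
  finally have "coroot_pairing (refl k \<nu>) c
      = coroot_pairing \<nu> c - of_int ?p * coroot_pairing \<nu> (unit_vec k)"
    unfolding coroot_pairing_unit_vec
    by (simp add: coroot_pairing_def functional_reflection_def alpha_h right_diff_distrib sum_subtractf)
  also have "\<dots> = coroot_pairing \<nu> (root_reflection a k c)"
    unfolding coroot_pairing_def root_reflection_eq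
    by (simp add: algebra_simps sum_subtractf sum_distrib_left)
  finally show ?thesis .
qed

lemma refl_involution: "refl k (refl k \<nu>) = \<nu>"
  by (simp add: functional_reflection_def alpha_h diag fun_eq_iff)

lemma refl_linear: "refl k (\<lambda>x. \<nu> x + z * \<eta> x) = (\<lambda>x. refl k \<nu> x + z * refl k \<eta> x)"
  by (simp add: functional_reflection_def algebra_simps)

lemma foldr_refl_linear:
  "foldr refl js (\<lambda>x. \<nu> x + z * \<eta> x) = (\<lambda>x. foldr refl js \<nu> x + z * foldr refl js \<eta> x)"
  by (induction js) (simp_all add: refl_linear)

lemma fold_refl_linear:
  "fold refl js (\<lambda>x. \<nu> x + z * \<eta> x) = (\<lambda>x. fold refl js \<nu> x + z * fold refl js \<eta> x)"
  by (induction js arbitrary: \<nu> \<eta>) (simp_all add: refl_linear)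

lemma fold_foldr_refl: "fold refl js (foldr refl js \<nu>) = \<nu>"
  by (induction js) (simp_all add: refl_involution)

lemma fold_refl_root_functional:
  "fold refl js (root_functional c) = root_functional (fold (root_reflection a) js c)"
  by (induction js arbitrary: c) (simp_all add: refl_root_functional)

lemma foldr_refl_root_functional:
  "foldr refl js (root_functional c) = root_functional (foldr (root_reflection a) js c)"
  by (induction js) (simp_all add: refl_root_functional)

lemma coroot_pairing_foldr:
  "coroot_pairing (foldr refl js \<nu>) c = coroot_pairing \<nu> (fold (root_reflection a) js c)"
  by (induction js arbitrary: c) (simp_all add: coroot_pairing_refl)

text \<open>
  This is \<open>s\<^bsub>w\<alpha>\<^esub> = w s\<^sub>\<alpha> w\<^sup>-\<^sup>1\<close>.  The equality \<open>d p = d j\<close> lets the coroots correspond whenever the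
  roots do.
\<close>
lemma reflection_conjugate:
  assumes "fold (root_reflection a) js (unit_vec j) = unit_vec p" and "d p = d j"
  shows "refl j (foldr refl js \<nu>) = foldr refl js (refl p \<nu>)"
proof -
  have "of_nat (d j) * foldr refl js \<nu> (h j) = of_nat (d p) * \<nu> (h p)"
    unfolding coroot_pairing_unit_vec[symmetric] coroot_pairing_foldr assms(1) ..
  then have 1: "foldr refl js \<nu> (h j) = \<nu> (h p)" using d_pos[of j] assms(2) by simp
  have "foldr (root_reflection a) js (unit_vec p) = unit_vec j"
    using foldr_fold_root_reflection[of js "unit_vec j"] assms(1) by simp
  then have "foldr refl js (\<alpha> p) = \<alpha> j"
    using foldr_refl_root_functional[of js "unit_vec p"] by (simp add: root_functional_unit_vec)
  moreover have "refl p \<nu> = (\<lambda>x. \<nu> x + (- \<nu> (h p)) * \<alpha> p x)"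
    by (simp add: functional_reflection_def)
  ultimately have "foldr refl js (refl p \<nu>) = (\<lambda>x. foldr refl js \<nu> x + (- \<nu> (h p)) * \<alpha> j x)"
    by (simp only: foldr_refl_linear)
  then show ?thesis using 1 by (simp add: functional_reflection_def)
qed

text \<open>
  Otherwise the letter found by \<open>exchange_prefix\<close> could be cancelled against \<open>j\<close>, leaving a
  word for the same element that is shorter by two.
\<close>
lemma reduced_word_positive_root:
  assumes "\<And>ks. foldr refl ks = foldr refl (j # js) \<Longrightarrow> length (j # js) \<le> length ks"
  shows "fold (root_reflection a) js (unit_vec j) l \<ge> 0"
proof (rule ccontr)
  assume "\<not> ?thesis"
  then have "fold (root_reflection a) js (unit_vec j) l < 0" by simp
  from exchange_prefix[OF this] obtain js1 p js2 where
    js: "js = js1 @ p # js2" "fold (root_reflection a) js1 (unit_vec j) = unit_vec p" "d p = d j"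
    by blast
  have "foldr refl (js1 @ js2) \<nu> = foldr refl (j # js) \<nu>" for \<nu>
    using reflection_conjugate[OF js(2,3), of "foldr refl (p # js2) \<nu>"]
    by (simp add: js(1) refl_involution)
  then have "foldr refl (js1 @ js2) = foldr refl (j # js)" by blast
  from assms[OF this] show False by (simp add: js(1))
qed

end

section \<open>The Jordan plane\<close>

abbreviation endo :: "(complex \<Rightarrow> 'v::ab_group_add \<Rightarrow> 'v) \<Rightarrow> ('v \<Rightarrow> 'v) \<Rightarrow> bool" where
  "endo s \<equiv> Vector_Spaces.linear s s"

locale complex_vector_space = vector_space scale
  for scale :: "complex \<Rightarrow> 'v::ab_group_add \<Rightarrow> 'v"
begin

lemma endoI:
  assumes "\<And>x y. F (x + y) = F x + F y" "\<And>c x. F (scale c x) = scale c (F x)"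
  shows "endo scale F"
  using assms vector_space_axioms by (simp add: Vector_Spaces.linear_iff)

lemma endo_simps:
  assumes "endo scale F"
  shows "F (x + y) = F x + F y" "F (x - y) = F x - F y" "F (- x) = - F x" "F 0 = 0"
    "F (scale c x) = scale c (F x)" "F (sum g A) = (\<Sum>k\<in>A. F (g k))"
proof -
  interpret Vector_Spaces.linear scale scale F by fact
  show "F (x + y) = F x + F y" "F (x - y) = F x - F y" "F (- x) = - F x" "F 0 = 0"
    "F (scale c x) = scale c (F x)" "F (sum g A) = (\<Sum>k\<in>A. F (g k))"
    by (rule add diff neg zero scale sum)+
qed

lemma endo_funpow: "endo scale F \<Longrightarrow> endo scale (F ^^ n)"
  by (induction n) (auto simp: Vector_Spaces.linear_iff)

text \<open>
  In the Jordan plane \<open>y x = x y + a x\<^sup>2\<close> the power of \<open>y - a x\<close> is linear in \<open>x\<close> because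
  \<open>(y - a x) (y - m a x) = (y - (m + 1) a x) y\<close>.  In the application \<open>Y\<close> and \<open>D\<close> are \<open>y\<close> and \<open>x\<close>
  multiplied by \<open>t = 1/z\<close>.
\<close>
lemma jordan_plane_power:
  assumes "endo scale Y" "endo scale D" and comm: "\<And>x. Y (D x) = D (Y x) + scale a (D (D x))"
  shows "((\<lambda>x. Y x - scale a (D x)) ^^ Suc m) x
    = (Y ^^ Suc m) x - scale (of_nat (Suc m) * a) (D ((Y ^^ m) x))"
proof (induction m)
  case (Suc m)
  show ?case
    unfolding funpow.simps(2)[of "Suc m"] comp_apply Suc of_nat_Suc[of "Suc m"] distrib_right[of 1]
    by (simp add: endo_simps[OF assms(1)] endo_simps[OF assms(2)] comm algebra_simps
        del: of_nat_Suc)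
qed simp

text \<open>
  The commutator of the raising operator \<open>E\<close> with \<open>A = Y + a D\<close> contributes a term in \<open>\<Xi>\<close>, which passes
  the remaining factors \<open>A\<close> and turns them into \<open>Y - a D\<close>, and a weight term.  The \<open>\<Xi>\<close>-terms
  \<open>\<Sum>\<^sub>k A\<^sup>k (Y - a D)\<^bsup>m-k\<^esup>\<close> collapse to \<open>(m + 1) Y\<^sup>m\<close> by the previous lemma; the weight terms sum to
  \<open>a (m + 1) (N - (m + 1))\<close>, which vanishes for a full string, \<open>m + 1 = N\<close>.
\<close>
lemma jordan_plane_raising:
  assumes lin: "endo scale Y" "endo scale D" "endo scale T" "endo scale E" "endo scale \<Xi>"
    and comm: "\<And>x. Y (D x) = D (Y x) + scale a (D (D x))"
    and T: "\<And>x. T (Y x) = Y (T x)" "\<And>x. T (D x) = D (T x)"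
    and E: "\<And>x. E (Y x + scale a (D x)) = Y (E x) + scale a (D (E x)) + T (scale a (\<Xi> x) + H x - scale a x)"
    and \<Xi>: "\<And>x. \<Xi> (Y x + scale a (D x)) = Y (\<Xi> x) - scale a (D (\<Xi> x))"
    and H: "\<And>m. H (((\<lambda>x. Y x + scale a (D x)) ^^ m) u)
      = scale (a * (N - 2 * of_nat m)) (((\<lambda>x. Y x + scale a (D x)) ^^ m) u)"
    and u: "E u = 0"
  shows "E (((\<lambda>x. Y x + scale a (D x)) ^^ Suc m) u) = scale (a * of_nat (Suc m))
     (T ((Y ^^ m) (\<Xi> u) + scale (N - of_nat (Suc m)) (((\<lambda>x. Y x + scale a (D x)) ^^ m) u)))"
proof (induction m)
  case 0
  show ?case
    using H[of 0] by (simp add: E u endo_simps[OF lin(1)] endo_simps[OF lin(2)] endo_simps[OF lin(3)] algebra_simps)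
next
  case (Suc m)
  let ?A = "\<lambda>x. Y x + scale a (D x)"
  note simps = endo_simps[OF lin(1)] endo_simps[OF lin(2)] endo_simps[OF lin(3)]
  have pow: "\<Xi> ((?A ^^ k) u) = ((\<lambda>x. Y x - scale a (D x)) ^^ k) (\<Xi> u)" for k
    by (induction k) (simp_all add: \<Xi>)
  have "E ((?A ^^ Suc (Suc m)) u) = Y (E ((?A ^^ Suc m) u)) + scale a (D (E ((?A ^^ Suc m) u)))
     + T (scale a (\<Xi> ((?A ^^ Suc m) u)) + H ((?A ^^ Suc m) u) - scale a ((?A ^^ Suc m) u))"
    by (simp only: funpow.simps(2)[of "Suc m"] comp_apply E)
  also have "\<dots> = scale (a * of_nat (Suc m)) (T ((Y ^^ Suc m) (\<Xi> u))) + scale a (T ((Y ^^ Suc m) (\<Xi> u)))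
     + (scale (a * of_nat (Suc m) * (N - of_nat (Suc m))) (T ((?A ^^ Suc m) u))
        + scale (a * (N - 2 * of_nat (Suc m)) - a) (T ((?A ^^ Suc m) u)))"
    unfolding Suc H pow jordan_plane_power[OF lin(1,2) comm]
    by (simp add: simps T[symmetric] algebra_simps del: of_nat_Suc)
  also have "\<dots> = scale (a * of_nat (Suc m) + a) (T ((Y ^^ Suc m) (\<Xi> u)))
     + scale (a * of_nat (Suc m) * (N - of_nat (Suc m)) + (a * (N - 2 * of_nat (Suc m)) - a))
        (T ((?A ^^ Suc m) u))"
    by (simp only: scale_left_distrib)
  also have "\<dots> = scale (a * of_nat (Suc (Suc m))) (T ((Y ^^ Suc m) (\<Xi> u)))
     + scale (a * of_nat (Suc (Suc m)) * (N - of_nat (Suc (Suc m)))) (T ((?A ^^ Suc m) u))"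
    by (intro arg_cong2[where f = "(+)"] arg_cong2[where f = scale] refl) (simp_all add: algebra_simps)
  also have "\<dots> = scale (a * of_nat (Suc (Suc m)))
     (T ((Y ^^ Suc m) (\<Xi> u) + scale (N - of_nat (Suc (Suc m))) ((?A ^^ Suc m) u)))"
    by (simp only: simps scale_right_distrib scale_scale)
  finally show ?case .
qed

end

section \<open>Rank one: series of vectors and strings of lowering operators\<close>

context complex_vector_space
begin

text \<open>
  Formal power series in \<open>t = 1/z\<close> with coefficients in the module.  The series \<open>series_operator P\<close>
  is the action of the operator series \<open>\<Sum>\<^sub>k P\<^sub>k t\<^sup>k\<close>, and \<open>tensor f w\<close> is \<open>f(t) w\<close>.
\<close>
definition scale_series :: "complex \<Rightarrow> 'v fps \<Rightarrow> 'v fps" where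
  "scale_series c F = Abs_fps (\<lambda>n. scale c (F $ n))"

definition map_series :: "('v \<Rightarrow> 'v) \<Rightarrow> 'v fps \<Rightarrow> 'v fps" where
  "map_series g F = Abs_fps (\<lambda>n. g (F $ n))"

definition times_t :: "'v fps \<Rightarrow> 'v fps" where
  "times_t F = Abs_fps (\<lambda>n. case n of 0 \<Rightarrow> 0 | Suc m \<Rightarrow> F $ m)"

definition series_operator :: "(nat \<Rightarrow> 'v \<Rightarrow> 'v) \<Rightarrow> 'v fps \<Rightarrow> 'v fps" where
  "series_operator P F = Abs_fps (\<lambda>n. \<Sum>i\<le>n. P i (F $ (n - i)))"

definition tensor :: "complex fps \<Rightarrow> 'v \<Rightarrow> 'v fps" where
  "tensor f w = Abs_fps (\<lambda>n. scale (f $ n) w)"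

lemma series_nth:
  "scale_series c F $ n = scale c (F $ n)"
  "map_series g F $ n = g (F $ n)"
  "times_t F $ 0 = 0" "times_t F $ Suc m = F $ m"
  "series_operator P F $ n = (\<Sum>i\<le>n. P i (F $ (n - i)))"
  "tensor f w $ n = scale (f $ n) w"
  by (simp_all add: scale_series_def map_series_def times_t_def series_operator_def tensor_def)

lemma times_t_nth: "times_t F $ n = (case n of 0 \<Rightarrow> 0 | Suc m \<Rightarrow> F $ m)"
  by (simp add: times_t_def)

lemma complex_vector_space_series: "complex_vector_space scale_series"
  by unfold_locales (simp_all add: fps_eq_iff series_nth scale_right_distrib scale_left_distrib)

interpretation series: complex_vector_space scale_series
  by (rule complex_vector_space_series)

lemma endo_times_t: "endo scale_series times_t"
  by (intro series.endoI) (simp_all add: fps_eq_iff times_t_nth series_nth split: nat.split)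

lemma endo_series_operator: "(\<And>i. endo scale (P i)) \<Longrightarrow> endo scale_series (series_operator P)"
  by (intro series.endoI) (simp_all add: fps_eq_iff series_nth endo_simps sum.distrib scale_sum_right)

lemma tensor_cancel: "w \<noteq> 0 \<Longrightarrow> tensor f w = tensor g w \<longleftrightarrow> f = g"
  by (auto simp: fps_eq_iff series_nth)

lemma tensor_diff: "tensor (f - g) w = tensor f w - tensor g w"
  by (simp add: fps_eq_iff series_nth scale_left_diff_distrib)

lemma tensor_sum: "tensor (\<Sum>k\<in>A. f k) w = (\<Sum>k\<in>A. tensor (f k) w)"
  by (simp add: fps_eq_iff series_nth fps_sum_nth scale_sum_left)

lemma series_operator_eigen:
  assumes "\<And>i. endo scale (P i)" and "\<And>i. P i w = scale (\<kappa> $ i) w"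
  shows "series_operator P (tensor f w) = tensor (\<kappa> * f) w"
  by (simp add: fps_eq_iff series_nth endo_simps[OF assms(1)] assms(2) fps_mult_nth scale_sum_left
      atLeast0AtMost mult.commute)

end

locale lowering_pair = complex_vector_space scale
  for scale :: "complex \<Rightarrow> 'v::ab_group_add \<Rightarrow> 'v" +
  fixes x0 x1 :: "'v \<Rightarrow> 'v"
  assumes endo_x0: "endo scale x0" and endo_x1: "endo scale x1"
begin

sublocale series: complex_vector_space scale_series
  by (rule complex_vector_space_series)

text \<open>
  With \<open>y(b) = (z + b) x\<^sub>0 - x\<^sub>1\<close> as in the introduction, \<open>lower_shifted b\<close> below is \<open>t y(b)\<close>; the factor \<open>t\<close>
  makes it a power series in \<open>t\<close>.
\<close>
definition lower :: "'v fps \<Rightarrow> 'v fps" where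
  "lower F = map_series x0 F - times_t (map_series x1 F)"

definition t_x0 :: "'v fps \<Rightarrow> 'v fps" where
  "t_x0 F = times_t (map_series x0 F)"

abbreviation lower_shifted :: "complex \<Rightarrow> 'v fps \<Rightarrow> 'v fps" where
  "lower_shifted b \<equiv> (\<lambda>F. lower F + scale_series b (t_x0 F))"

lemma lower_shifted_0: "lower_shifted 0 = lower"
  by simp

lemma lower_shifted_nth_0: "lower_shifted b F $ 0 = x0 (F $ 0)"
  by (simp add: lower_def t_x0_def series_nth)

lemma lower_shifted_nth_Suc:
  "lower_shifted b F $ Suc n = x0 (F $ Suc n) + (scale b (x0 (F $ n)) - x1 (F $ n))"
  by (simp add: lower_def t_x0_def series_nth)

lemma endo_t_x0: "endo scale_series t_x0"
  by (intro series.endoI)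
    (simp_all add: fps_eq_iff t_x0_def times_t_nth series_nth endo_simps[OF endo_x0] split: nat.split)

lemma endo_lower_shifted: "endo scale_series (lower_shifted b)"
  by (intro series.endoI)
    (simp_all add: fps_eq_iff lower_def t_x0_def times_t_nth series_nth endo_simps[OF endo_x0]
      endo_simps[OF endo_x1] scale_right_distrib scale_right_diff_distrib mult.commute algebra_simps
      split: nat.split)

lemma endo_lower: "endo scale_series lower"
  using endo_lower_shifted[of 0] by simp

text \<open>
  The coefficients of \<open>(\<alpha> x\<^sub>0 - \<beta> x\<^sub>1)\<^sup>n u\<close> for commuting scalars \<open>\<alpha>\<close>, \<open>\<beta>\<close>:
  \<open>moment u n k\<close> belongs to \<open>\<alpha>\<^bsup>n-k\<^esup> \<beta>\<^sup>k\<close>.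
\<close>
fun moment :: "'v \<Rightarrow> nat \<Rightarrow> nat \<Rightarrow> 'v" where
  "moment u 0 0 = u"
| "moment u 0 (Suc k) = 0"
| "moment u (Suc n) 0 = x0 (moment u n 0)"
| "moment u (Suc n) (Suc k) = x0 (moment u n (Suc k)) - x1 (moment u n k)"

lemma moment_eq_0: "n < k \<Longrightarrow> moment u n k = 0"
proof (induction n arbitrary: k)
  case 0
  then show ?case by (cases k) simp_all
next
  case (Suc n)
  then show ?case by (cases k) (simp_all add: endo_simps[OF endo_x0] endo_simps[OF endo_x1])
qed

lemma moment_0: "moment u n 0 = (x0 ^^ n) u"
  by (induction n) simp_all

abbreviation (input) shift_factor :: "complex \<Rightarrow> complex fps" where
  "shift_factor b \<equiv> 1 + fps_const b * fps_X"

lemma lower_shifted_tensor: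
  "lower_shifted b (tensor g m) = tensor (shift_factor b * g) (x0 m) - tensor (fps_X * g) (x1 m)"
proof (rule fps_ext)
  fix n
  show "lower_shifted b (tensor g m) $ n =
     (tensor (shift_factor b * g) (x0 m) - tensor (fps_X * g) (x1 m)) $ n"
    by (cases n) (simp_all only: lower_shifted_nth_0 lower_shifted_nth_Suc,
      simp_all add: series_nth endo_simps[OF endo_x0] endo_simps[OF endo_x1] distrib_right mult.assoc
        scale_left_distrib)
qed

lemma lower_shifted_power:
  "(lower_shifted b ^^ n) (tensor f u)
    = (\<Sum>k\<le>n. tensor (f * (shift_factor b ^ (n - k) * fps_X ^ k)) (moment u n k))"
proof (induction n)
  case (Suc n)
  let ?S = "shift_factor b"
  let ?T = "\<lambda>n k. f * (?S ^ (n - k) * fps_X ^ k)"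
  have "(lower_shifted b ^^ Suc n) (tensor f u)
      = (\<Sum>k\<le>n. lower_shifted b (tensor (?T n k) (moment u n k)))"
    unfolding funpow.simps comp_apply Suc by (rule series.endo_simps(6)[OF endo_lower_shifted])
  also have "\<dots> = (\<Sum>k\<le>n. tensor (?S * ?T n k) (x0 (moment u n k)))
       - (\<Sum>k\<le>n. tensor (fps_X * ?T n k) (x1 (moment u n k)))"
    unfolding lower_shifted_tensor sum_subtractf ..
  also have "(\<Sum>k\<le>n. tensor (?S * ?T n k) (x0 (moment u n k)))
      = (\<Sum>k\<le>n. tensor (?T (Suc n) k) (x0 (moment u n k)))"
    by (intro sum.cong refl arg_cong2[where f = tensor]) (simp add: Suc_diff_le mult_ac)
  also have "\<dots> = (\<Sum>k\<le>Suc n. tensor (?T (Suc n) k) (x0 (moment u n k)))"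
    by (simp add: moment_eq_0 endo_simps[OF endo_x0] fps_eq_iff series_nth)
  also have "\<dots> = tensor (?T (Suc n) 0) (x0 (moment u n 0)) 
      + (\<Sum>k\<le>n. tensor (?T (Suc n) (Suc k)) (x0 (moment u n (Suc k))))"
    by (rule sum.atMost_Suc_shift)
  also have "(\<Sum>k\<le>n. tensor (fps_X * ?T n k) (x1 (moment u n k)))
      = (\<Sum>k\<le>n. tensor (?T (Suc n) (Suc k)) (x1 (moment u n k)))"
    by (intro sum.cong refl arg_cong2[where f = tensor]) (simp add: mult_ac)
  also have "tensor (?T (Suc n) 0) (x0 (moment u n 0)) 
      + (\<Sum>k\<le>n. tensor (?T (Suc n) (Suc k)) (x0 (moment u n (Suc k))))
      - (\<Sum>k\<le>n. tensor (?T (Suc n) (Suc k)) (x1 (moment u n k)))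
     = tensor (?T (Suc n) 0) (moment u (Suc n) 0) + 
       (\<Sum>k\<le>n. tensor (?T (Suc n) (Suc k)) (moment u (Suc n) (Suc k)))"
    unfolding add_diff_eq[symmetric] sum_subtractf[symmetric]
    by (intro arg_cong2[where f = "(+)"] sum.cong refl)
      (simp_all add: fps_eq_iff series_nth scale_right_diff_distrib del: power_Suc)
  also have "\<dots> = (\<Sum>k\<le>Suc n. tensor (?T (Suc n) k) (moment u (Suc n) k))"
    by (rule sum.atMost_Suc_shift[symmetric])
  finally show ?case .
qed simp

text \<open>
  The generating function form of the relation between \<open>\<xi>\<close> and \<open>x\<^sup>-\<close>, that is
  \<open>\<Xi> y(c) = y(-c) \<Xi>\<close>.
\<close>
lemma series_operator_lower:
  assumes K: "\<And>k. endo scale (K k)" "\<And>v. K 0 v = v"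
    and rel: "\<And>k v. K (Suc k) (x0 v) - x0 (K (Suc k) v) - (K k (x1 v) - x1 (K k v))
      = scale (- c) (K k (x0 v) + x0 (K k v))"
  shows "series_operator K (lower F + scale_series c (t_x0 F))
    = lower (series_operator K F) - scale_series c (t_x0 (series_operator K F))"
proof (rule fps_ext)
  fix n
  note simps = endo_simps[OF endo_x0] endo_simps[OF endo_x1] endo_simps[OF K(1)]
  show "series_operator K (lower_shifted c F) $ n = 
      (lower (series_operator K F) - scale_series c (t_x0 (series_operator K F))) $ n"
  proof (cases n)
    case 0
    then show ?thesis by (simp add: series_nth lower_def t_x0_def K(2))
  next
    case (Suc m)
    have "series_operator K (lower_shifted c F) $ Suc m
      = (\<Sum>i\<le>m. K i (lower_shifted c F $ Suc (m - i))) + K (Suc m) (lower_shifted c F $ 0)"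
      unfolding series_nth(5) by (simp add: Suc_diff_le)
    also have "\<dots> = (\<Sum>i\<le>m. K i (x0 (F $ (Suc m - i)))) + K (Suc m) (x0 (F $ 0)) 
       + (\<Sum>i\<le>m. K i (scale c (x0 (F $ (m - i))) - x1 (F $ (m - i))))"
      unfolding lower_shifted_nth_0 lower_shifted_nth_Suc by (simp add: simps sum.distrib Suc_diff_le)
    also have "(\<Sum>i\<le>m. K i (x0 (F $ (Suc m - i)))) + K (Suc m) (x0 (F $ 0))
       = x0 (F $ Suc m) + (\<Sum>i\<le>m. K (Suc i) (x0 (F $ (m - i))))"
      using sum.atMost_Suc_shift[of "\<lambda>i. K i (x0 (F $ (Suc m - i)))" m] by (simp add: K(2))
    finally have L: "series_operator K (lower_shifted c F) $ Suc m = x0 (F $ Suc m) 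
       + (\<Sum>i\<le>m. K (Suc i) (x0 (F $ (m - i))) + K i (scale c (x0 (F $ (m - i))) - x1 (F $ (m - i))))"
      by (simp add: sum.distrib)
    have "lower_shifted (- c) (series_operator K F) $ Suc m 
       = x0 (\<Sum>i\<le>Suc m. K i (F $ (Suc m - i))) 
        + (\<Sum>i\<le>m. scale (- c) (x0 (K i (F $ (m - i)))) - x1 (K i (F $ (m - i))))"
      unfolding lower_shifted_nth_Suc series_nth(5) by (simp add: simps sum_subtractf scale_sum_right sum_negf)
    also have "(\<Sum>i\<le>Suc m. K i (F $ (Suc m - i))) = F $ Suc m + (\<Sum>i\<le>m. K (Suc i) (F $ (m - i)))"
      using sum.atMost_Suc_shift[of "\<lambda>i. K i (F $ (Suc m - i))" m] by (simp add: K(2))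
    finally have "lower_shifted (- c) (series_operator K F) $ Suc m = x0 (F $ Suc m)
       + (\<Sum>i\<le>m. x0 (K (Suc i) (F $ (m - i))) + (scale (- c) (x0 (K i (F $ (m - i)))) - x1 (K i (F $ (m - i)))))"
      by (simp add: simps sum.distrib)
    also have "\<dots> = series_operator K (lower_shifted c F) $ Suc m"
      unfolding L
    proof (rule arg_cong2[where f = "(+)", OF refl sum.cong[OF refl]])
      fix i
      show "x0 (K (Suc i) (F $ (m - i))) + (scale (- c) (x0 (K i (F $ (m - i)))) - x1 (K i (F $ (m - i))))
       = K (Suc i) (x0 (F $ (m - i))) + K i (scale c (x0 (F $ (m - i))) - x1 (F $ (m - i)))"
        using rel[of i "F $ (m - i)"] by (simp add: simps scale_right_distrib algebra_simps)
    qed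
    finally show ?thesis by (simp add: Suc)
  qed
qed

text \<open>
  The generating function form of \<open>[x\<^sup>+\<^sub>r, x\<^sup>-\<^sub>s] = \<xi>\<^bsub>r+s\<^esub>\<close>.  In the commutator with \<open>t y(c)\<close> the
  contributions of \<open>x\<^sub>0\<close> and \<open>t x\<^sub>1\<close> are the same series up to its lowest terms and cancel, which
  leaves \<open>c \<Xi>\<close> and boundary terms.
\<close>
lemma series_operator_raise:
  assumes K: "\<And>k. endo scale (K k)" "\<And>v. K 0 v = v"
    and R: "\<And>k. endo scale (R k)" "\<And>v. R 0 v = 0"
    and rel: "\<And>k v. R (Suc k) (x0 v) - x0 (R (Suc k) v) = K (Suc k) v"
      "\<And>k v. R (Suc k) (x1 v) - x1 (R (Suc k) v) = K (Suc (Suc k)) v"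
  shows "series_operator R (lower F + scale_series c (t_x0 F))
    = lower (series_operator R F) + scale_series c (t_x0 (series_operator R F))
      + times_t (scale_series c (series_operator K F) + map_series (K 1) F - scale_series c F)"
    (is "?l = ?r")
proof (rule fps_ext)
  fix n
  note simps = endo_simps[OF endo_x0] endo_simps[OF endo_x1] endo_simps[OF K(1)] endo_simps[OF R(1)]
  show "?l $ n = ?r $ n"
  proof (cases n)
    case 0
    then show ?thesis by (simp add: series_nth lower_def t_x0_def R(2) simps)
  next
    case (Suc m)
    have "?l $ Suc m
      = (\<Sum>i\<le>m. R i (lower_shifted c F $ Suc (m - i))) + R (Suc m) (lower_shifted c F $ 0)"
      unfolding series_nth(5) by (simp add: Suc_diff_le)
    also have "\<dots> = (\<Sum>i\<le>m. R i (x0 (F $ (Suc m - i)))) + R (Suc m) (x0 (F $ 0)) 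
       + (\<Sum>i\<le>m. R i (scale c (x0 (F $ (m - i))) - x1 (F $ (m - i))))"
      unfolding lower_shifted_nth_0 lower_shifted_nth_Suc by (simp add: simps sum.distrib Suc_diff_le)
    also have "(\<Sum>i\<le>m. R i (x0 (F $ (Suc m - i)))) + R (Suc m) (x0 (F $ 0))
       = (\<Sum>i\<le>m. R (Suc i) (x0 (F $ (m - i))))"
      using sum.atMost_Suc_shift[of "\<lambda>i. R i (x0 (F $ (Suc m - i)))" m] by (simp add: R(2))
    finally have L: "?l $ Suc m =
       (\<Sum>i\<le>m. R (Suc i) (x0 (F $ (m - i))) + R i (scale c (x0 (F $ (m - i))) - x1 (F $ (m - i))))"
      by (simp add: sum.distrib)
    have "lower_shifted c (series_operator R F) $ Suc m 
       = x0 (\<Sum>i\<le>Suc m. R i (F $ (Suc m - i))) 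
        + (\<Sum>i\<le>m. scale c (x0 (R i (F $ (m - i)))) - x1 (R i (F $ (m - i))))"
      unfolding lower_shifted_nth_Suc series_nth(5) by (simp add: simps sum_subtractf scale_sum_right sum_negf)
    also have "(\<Sum>i\<le>Suc m. R i (F $ (Suc m - i))) = (\<Sum>i\<le>m. R (Suc i) (F $ (m - i)))"
      using sum.atMost_Suc_shift[of "\<lambda>i. R i (F $ (Suc m - i))" m] by (simp add: R(2))
    finally have M: "lower_shifted c (series_operator R F) $ Suc m = 
       (\<Sum>i\<le>m. x0 (R (Suc i) (F $ (m - i))) + (scale c (x0 (R i (F $ (m - i)))) - x1 (R i (F $ (m - i)))))"
      by (simp add: simps sum.distrib)
    have "?l $ Suc m - lower_shifted c (series_operator R F) $ Suc m
      = (\<Sum>i\<le>m. scale c (K i (F $ (m - i))) + (if i = 0 then K 1 (F $ m) - scale c (F $ m) else 0))"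
      unfolding L M sum_subtractf[symmetric]
    proof (intro sum.cong refl)
      fix i
      let ?v = "F $ (m - i)"
      show "R (Suc i) (x0 ?v) + R i (scale c (x0 ?v) - x1 ?v)
        - (x0 (R (Suc i) ?v) + (scale c (x0 (R i ?v)) - x1 (R i ?v)))
        = scale c (K i ?v) + (if i = 0 then K 1 (F $ m) - scale c (F $ m) else 0)"
      proof (cases i)
        case 0
        then show ?thesis using rel(1)[of 0 ?v] by (simp add: R(2) simps K(2))
      next
        case (Suc l)
        have "scale c (R (Suc l) (x0 ?v)) - scale c (x0 (R (Suc l) ?v)) = scale c (K (Suc l) ?v)"
          unfolding rel(1)[symmetric] by (rule scale_right_diff_distrib[symmetric])
        then show ?thesis using rel(1)[of i ?v] rel(2)[of l ?v]
          by (simp add: simps Suc algebra_simps)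
      qed
    qed
    also have "\<dots> = scale c (\<Sum>i\<le>m. K i (F $ (m - i))) + (K 1 (F $ m) - scale c (F $ m))"
      by (simp add: sum.distrib scale_sum_right)
    also have "\<dots> = times_t (scale_series c (series_operator K F) + map_series (K 1) F - scale_series c F) $ Suc m"
      by (simp add: series_nth)
    finally show ?thesis by (simp add: Suc algebra_simps)
  qed
qed

end

text \<open>
  All vectors that arise from \<open>u\<close> by \<open>n\<close> lowerings lie on the line through \<open>w = x\<^sub>0\<^sup>n u\<close>; the
  numbers \<open>m k\<close> are their coordinates.
\<close>
locale lowering_string = lowering_pair scale x0 x1
  for scale :: "complex \<Rightarrow> 'v::ab_group_add \<Rightarrow> 'v" and x0 x1 +
  fixes u w :: 'v and n :: nat and m :: "nat \<Rightarrow> complex"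
  assumes w_nonzero: "w \<noteq> 0" and moments: "\<And>k. k \<le> n \<Longrightarrow> moment u n k = scale (m k) w"
    and m_0: "m 0 = 1"
begin

text \<open>
  This is \<open>t\<^sup>n Q(z + b)\<close> for the monic polynomial \<open>Q(z) = \<Sum>\<^sub>k m\<^sub>k z\<^bsup>n-k\<^esup>\<close>.
\<close>
definition drinfeld :: "complex \<Rightarrow> complex fps" where
  "drinfeld b = (\<Sum>k\<le>n. fps_const (m k) * ((1 + fps_const b * fps_X) ^ (n - k) * fps_X ^ k))"

lemma drinfeld_nth_0: "drinfeld b $ 0 = 1"
proof -
  have "drinfeld b $ 0 = (\<Sum>k\<le>n. if k = 0 then 1 else 0)"
    unfolding drinfeld_def fps_sum_nth by (intro sum.cong refl) (simp add: m_0 fps_nth_power_0)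
  then show ?thesis by simp
qed

lemma drinfeld_nonzero: "drinfeld b \<noteq> 0"
  using drinfeld_nth_0[of b] by (metis fps_zero_nth zero_neq_one)

lemma lower_shifted_string: "(lower_shifted b ^^ n) (tensor f u) = tensor (f * drinfeld b) w"
proof -
  have "(lower_shifted b ^^ n) (tensor f u)
     = (\<Sum>k\<le>n. tensor (f * (fps_const (m k) * ((1 + fps_const b * fps_X) ^ (n - k) * fps_X ^ k))) w)"
    unfolding lower_shifted_power
  proof (intro sum.cong refl)
    fix k assume "k \<in> {..n}"
    then have k: "moment u n k = scale (m k) w" by (simp add: moments)
    have e: "f * (fps_const (m k) * g) = fps_const (m k) * (f * g)" for g by (simp add: mult_ac)
    show "tensor (f * ((1 + fps_const b * fps_X) ^ (n - k) * fps_X ^ k)) (moment u n k)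
       = tensor (f * (fps_const (m k) * ((1 + fps_const b * fps_X) ^ (n - k) * fps_X ^ k))) w"
      unfolding k e by (simp add: fps_eq_iff series_nth mult.commute)
  qed
  then show ?thesis by (simp add: drinfeld_def sum_distrib_left tensor_sum)
qed

text \<open>
  Move \<open>\<Xi>\<close> through the \<open>n\<close> factors \<open>y(c)\<close> in \<open>y(c)\<^sup>n u = Q(z + c) w\<close>, which turns each of them
  into \<open>y(-c)\<close>.
\<close>
lemma string_eigenvalues:
  assumes K: "\<And>k. endo scale (K k)" "\<And>v. K 0 v = v"
    and rel: "\<And>k v. K (Suc k) (x0 v) - x0 (K (Suc k) v) - (K k (x1 v) - x1 (K k v))
      = scale (- c) (K k (x0 v) + x0 (K k v))"
    and eigen: "\<And>k. K k u = scale (\<phi> $ k) u" "\<And>k. K k w = scale (\<psi> $ k) w"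
  shows "\<psi> * drinfeld c = \<phi> * drinfeld (- c)"
proof -
  have pow: "series_operator K ((lower_shifted c ^^ k) F) = (lower_shifted (- c) ^^ k) (series_operator K F)" for k F
  proof (induction k)
    case (Suc k)
    then show ?case
      using series_operator_lower[of K c, OF K rel] by simp
  qed simp
  have "tensor (\<psi> * drinfeld c) w = series_operator K ((lower_shifted c ^^ n) (tensor 1 u))"
    unfolding lower_shifted_string by (simp add: series_operator_eigen[OF K(1) eigen(2)])
  also have "\<dots> = tensor (\<phi> * drinfeld (- c)) w"
    unfolding pow unfolding series_operator_eigen[OF K(1) eigen(1)] lower_shifted_string mult_1_right ..
  finally show ?thesis by (simp only: tensor_cancel[OF w_nonzero])
qed

text \<open>
  The full string \<open>m + 1 = n\<close> of \<open>jordan_plane_raising\<close> gives \<open>E y(a)\<^sup>n u = n a \<phi> y\<^bsup>n-1\<^esup> u\<close>, with \<open>E\<close> the raising series.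
  After applying \<open>x\<^sub>0\<close> the left side is known because \<open>x\<^sub>0\<close> kills \<open>w\<close>, and the right side is
  \<open>\<phi> (y\<^sup>n - y(-a)\<^sup>n) u\<close> by \<open>jordan_plane_power\<close>.
\<close>
lemma string_drinfeld:
  assumes K: "\<And>k. endo scale (K k)" "\<And>v. K 0 v = v"
    and rel: "\<And>k v. K (Suc k) (x0 v) - x0 (K (Suc k) v) - (K k (x1 v) - x1 (K k v))
      = scale (- a) (K k (x0 v) + x0 (K k v))"
    and xx: "\<And>v. x0 (x1 v) = x1 (x0 v) + scale a (x0 (x0 v))"
    and K_x1: "\<And>v. K 1 (x1 v) = x1 (K 1 v) - scale (2 * a) (x1 v)"
    and R: "\<And>k. endo scale (R k)" "\<And>v. R 0 v = 0"
    and rel_R: "\<And>k v. R (Suc k) (x0 v) - x0 (R (Suc k) v) = K (Suc k) v"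
      "\<And>k v. R (Suc k) (x1 v) - x1 (R (Suc k) v) = K (Suc (Suc k)) v"
    and eigen: "\<And>k. K k u = scale (\<phi> $ k) u" "\<And>k. K k w = scale (\<psi> $ k) w"
    and highest: "\<And>k. R k u = 0" and lowest: "x0 w = 0"
    and weight: "K 1 u = scale (a * of_nat n) u"
  shows "\<phi> * drinfeld 0 = drinfeld a"
proof -
  note simps = endo_simps[OF endo_x0] endo_simps[OF endo_x1] endo_simps[OF K(1)] endo_simps[OF R(1)]
  let ?L = "tensor \<phi> u"
  have jordan: "lower (t_x0 F) = t_x0 (lower F) + scale_series a (t_x0 (t_x0 F))" for F
    by (simp add: fps_eq_iff lower_def t_x0_def series_nth times_t_nth simps xx split: nat.split)
  have K1: "K 1 (x0 v) = x0 (K 1 v) - scale (2 * a) (x0 v)" for v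
  proof -
    have "K 1 (x0 v) - x0 (K 1 v) = scale (- a) (x0 v + x0 v)"
      using rel[of 0 v] by (simp add: K(2))
    also have "\<dots> = - scale (2 * a) (x0 v)" 
      by (simp only: mult_2 scale_left_distrib scale_right_distrib scale_minus_left minus_add_distrib)
    finally show ?thesis by (simp add: algebra_simps)
  qed
  have H: "map_series (K 1) ((lower_shifted a ^^ k) (tensor 1 u))
      = scale_series (a * (of_nat n - 2 * of_nat k)) ((lower_shifted a ^^ k) (tensor 1 u))" for k
  proof (induction k)
    case 0
    then show ?case by (simp add: fps_eq_iff series_nth weight[unfolded One_nat_def] simps mult.commute)
  next
    case (Suc k)
    let ?G = "(lower_shifted a ^^ k) (tensor 1 u)"
    have "map_series (K 1) (lower_shifted a F)
        = lower_shifted a (map_series (K 1) F) - scale_series (2 * a) (lower_shifted a F)" for F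
      by (simp add: fps_eq_iff lower_def t_x0_def series_nth times_t_nth simps
          K1[unfolded One_nat_def] K_x1[unfolded One_nat_def] scale_right_diff_distrib
          algebra_simps split: nat.split)
    then have "map_series (K 1) (lower_shifted a ?G) = lower_shifted a
        (scale_series (a * (of_nat n - 2 * of_nat k)) ?G) - scale_series (2 * a) (lower_shifted a ?G)"
      by (simp only: Suc.IH)
    also have "\<dots> = scale_series (a * (of_nat n - 2 * of_nat k) - 2 * a) (lower_shifted a ?G)"
      by (simp only: series.endo_simps(5)[OF endo_lower_shifted] series.scale_left_diff_distrib)
    also have "a * (of_nat n - 2 * of_nat k) - 2 * a = a * (of_nat n - 2 * of_nat (Suc k))"
      by (simp add: algebra_simps)
    finally show ?case by simp
  qed
  let ?E = "series_operator R"
  have "\<psi> $ 0 = 1"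
    using eigen(2)[of 0] w_nonzero scale_right_imp_eq[of w 1 "\<psi> $ 0"] by (simp add: K(2))
  \<comment> \<open>On the lowest vector \<open>w\<close> the commutator of the raising operator with \<open>x\<^sub>0\<close> reduces to one term.\<close>
  then have lower_raise: "x0 (R i w) = scale ((1 - \<psi>) $ i) w" for i
    using rel_R(1)[of "i - 1" w] eigen(2)[of i] by (cases i) (simp_all add: R(2) lowest simps, metis minus_minus)
  have "tensor ((1 - \<psi>) * drinfeld a) w = series_operator (\<lambda>i v. x0 (R i v)) (tensor (drinfeld a) w)"
    by (rule series_operator_eigen[symmetric]) (auto intro!: endoI simp: simps lower_raise)
  also have "\<dots> = map_series x0 (?E (tensor (drinfeld a) w))"
    by (simp add: fps_eq_iff series_nth simps)
  also have "tensor (drinfeld a) w = (lower_shifted a ^^ n) (tensor 1 u)"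
    by (simp add: lower_shifted_string)
  also have "map_series x0 (?E ((lower_shifted a ^^ n) (tensor 1 u)))
     = (lower ^^ n) ?L - (lower_shifted (- a) ^^ n) ?L"
  proof (cases n)
    case 0
    then show ?thesis by (simp add: fps_eq_iff series_nth simps highest)
  next
    case (Suc p)
    have L: "series_operator K (tensor 1 u) = ?L"
      using series_operator_eigen[OF K(1) eigen(1)] by simp
    \<comment> \<open>As \<open>n = Suc p\<close>, the second summand has coefficient 0.\<close>
    have "?E ((lower_shifted a ^^ Suc p) (tensor 1 u)) = scale_series (a * of_nat (Suc p))
       (times_t ((lower ^^ p) (series_operator K (tensor 1 u))
          + scale_series (of_nat n - of_nat (Suc p)) ((lower_shifted a ^^ p) (tensor 1 u))))"
    proof (rule series.jordan_plane_raising[OF endo_lower endo_t_x0 endo_times_t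
          endo_series_operator[OF R(1)] endo_series_operator[OF K(1)] jordan, where H = "map_series (K 1)"])
      show "times_t (lower x) = lower (times_t x)" "times_t (t_x0 x) = t_x0 (times_t x)" for x
        by (simp_all add: fps_eq_iff lower_def t_x0_def series_nth times_t_nth simps split: nat.split)
      show "?E (tensor 1 u) = 0" by (simp add: fps_eq_iff series_nth simps highest)
    qed (rule series_operator_raise[OF K R rel_R] series_operator_lower[OF K rel] H)+
    then have "?E ((lower_shifted a ^^ n) (tensor 1 u))
        = scale_series (of_nat n * a) (times_t ((lower ^^ p) ?L))"
      by (simp add: Suc L mult.commute)
    then have "map_series x0 (?E ((lower_shifted a ^^ n) (tensor 1 u)))
        = scale_series (of_nat n * a) (t_x0 ((lower ^^ p) ?L))"
      by (simp add: fps_eq_iff series_nth times_t_nth t_x0_def simps split: nat.split)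
    also have "\<dots> = (lower ^^ n) ?L - (lower_shifted (- a) ^^ n) ?L"
      using series.jordan_plane_power[OF endo_lower endo_t_x0 jordan, of p ?L]
      by (simp add: Suc del: funpow.simps of_nat_Suc)
    finally show ?thesis .
  qed
  also have "\<dots> = tensor (\<phi> * drinfeld 0) w - tensor (\<phi> * drinfeld (- a)) w"
    using lower_shifted_string[of 0 \<phi>] by (simp only: lower_shifted_string lower_shifted_0)
  finally have "(1 - \<psi>) * drinfeld a = \<phi> * drinfeld 0 - \<phi> * drinfeld (- a)"
    by (simp only: tensor_diff[symmetric] tensor_cancel[OF w_nonzero])
  moreover have "\<psi> * drinfeld a = \<phi> * drinfeld (- a)"
    by (rule string_eigenvalues[OF K rel eigen])
  ultimately show ?thesis by (simp add: algebra_simps)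
qed

lemma drinfeld_shift:
  "fps_to_fls (drinfeld b) = fls_X ^ n * shift b (fps_to_fls (drinfeld 0) / fls_X ^ n)"
proof -
  let ?S = "fps_to_fls (1 + fps_const b * fps_X :: complex fps)"
  have S: "?S \<noteq> 0"
  proof
    assume "?S = 0"
    moreover have "fls_nth ?S 0 = 1" by simp
    ultimately show False by (metis fls_zero_nth zero_neq_one)
  qed
  have "?S * fps_to_fls (inverse (1 + fps_const b * fps_X)) = 1"
    unfolding fls_times_fps_to_fls[symmetric] by (subst inverse_mult_eq_1') simp_all
  then have X: "shift b fls_X = fls_X / ?S"
    using S by (simp add: shift_def fls_times_fps_to_fls field_simps)
  have pow: "shift b (f ^ k) = shift b f ^ k" for f k
    using shift_powi[of b f "int k"] by simp
  have const: "shift b (fls_const c) = fls_const c" for c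
    by (simp add: shift_def)
  have sum: "shift b (\<Sum>k\<in>A. f k) = (\<Sum>k\<in>A. shift b (f k))" for f and A :: "nat set"
    by (induction A rule: infinite_finite_induct) (simp_all add: shift_add, simp_all add: shift_def)
  have to_fls_sum: "fps_to_fls (\<Sum>k\<in>A. f k) = (\<Sum>k\<in>A. fps_to_fls (f k))"
    for f :: "nat \<Rightarrow> complex fps" and A
    by (induction A rule: infinite_finite_induct) simp_all
  have "fps_to_fls (drinfeld 0) = (\<Sum>k\<le>n. fls_const (m k) * fls_X ^ k)"
    by (simp add: drinfeld_def to_fls_sum fls_times_fps_to_fls fps_to_fls_power)
  then have "fls_X ^ n * shift b (fps_to_fls (drinfeld 0) / fls_X ^ n)
      = (\<Sum>k\<le>n. fls_const (m k) * (fls_X / ?S) ^ k) * ?S ^ n"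
  proof -
    have "x ^ n * (A / (x / ?S) ^ n) = A * ?S ^ n" if "x \<noteq> 0" for x A :: "complex fls"
      using that S by (simp add: power_divide)
    from this[of fls_X] show ?thesis
      unfolding \<open>fps_to_fls (drinfeld 0) = _\<close> shift_divide pow sum shift_mult const X by simp
  qed
  also have "\<dots> = (\<Sum>k\<le>n. fls_const (m k) * (?S ^ (n - k) * fls_X ^ k))"
    unfolding sum_distrib_right
  proof (intro sum.cong refl)
    fix k assume "k \<in> {..n}"
    then have "?S ^ n = ?S ^ (n - k) * ?S ^ k" by (simp add: power_add[symmetric])
    then show "fls_const (m k) * (fls_X / ?S) ^ k * ?S ^ n = fls_const (m k) * (?S ^ (n - k) * fls_X ^ k)"
      using S by (simp add: power_divide)
  qed
  also have "\<dots> = fps_to_fls (drinfeld b)"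
    by (simp add: drinfeld_def to_fls_sum fls_times_fps_to_fls fps_to_fls_power)
  finally show ?thesis ..
qed

end

section \<open>Weights and \<open>sl\<^sub>2\<close>-strings\<close>

context complex_vector_space
begin

text \<open>
  The usual \<open>sl\<^sub>2\<close>-computation on a string \<open>F\<^sup>k y\<close>; the scalar \<open>\<delta>\<close> allows for generators that are
  not normalised.
\<close>
lemma string_step:
  assumes "endo scale F" and top: "E y = 0"
    and comm: "\<And>k. E (F ((F ^^ k) y)) = F (E ((F ^^ k) y)) + scale (\<delta> * (c - 2 * of_nat k)) ((F ^^ k) y)"
  shows "E ((F ^^ Suc k) y) = scale (\<delta> * of_nat (Suc k) * (c - of_nat k)) ((F ^^ k) y)"
proof (induction k)
  case 0
  then show ?case using comm[of 0] by (simp add: top endo_simps[OF assms(1)])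
next
  case (Suc k)
  have "E ((F ^^ Suc (Suc k)) y) = F (E ((F ^^ Suc k) y))
      + scale (\<delta> * (c - 2 * of_nat (Suc k))) ((F ^^ Suc k) y)"
    using comm[of "Suc k"] by simp
  also have "\<dots> = scale (\<delta> * of_nat (Suc k) * (c - of_nat k) + \<delta> * (c - 2 * of_nat (Suc k))) ((F ^^ Suc k) y)"
    unfolding Suc by (simp add: endo_simps[OF assms(1)] scale_left_distrib del: of_nat_Suc)
  also have "\<delta> * of_nat (Suc k) * (c - of_nat k) + \<delta> * (c - 2 * of_nat (Suc k))
      = \<delta> * of_nat (Suc (Suc k)) * (c - of_nat (Suc k))"
    by (simp add: algebra_simps)
  finally show ?case .
qed

lemma string_terminates:
  assumes "endo scale F" "endo scale E" and top: "E y = 0"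
    and comm: "\<And>k. E (F ((F ^^ k) y)) = F (E ((F ^^ k) y)) + scale (\<delta> * (c - 2 * of_nat k)) ((F ^^ k) y)"
    and "\<delta> \<noteq> 0" "y \<noteq> 0" "\<exists>k. (F ^^ k) y = 0"
  shows "\<exists>n. c = of_nat n \<and> (F ^^ n) y \<noteq> 0 \<and> (F ^^ Suc n) y = 0"
proof -
  define k where "k = (LEAST k. (F ^^ k) y = 0)"
  have k: "(F ^^ k) y = 0" unfolding k_def by (rule LeastI_ex) fact
  have "k \<noteq> 0" using k \<open>y \<noteq> 0\<close> by (intro notI) simp
  then obtain n where n: "k = Suc n" using not0_implies_Suc by blast
  have nz: "(F ^^ n) y \<noteq> 0" using not_less_Least[of n "\<lambda>k. (F ^^ k) y = 0"] n k_def by auto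
  have "scale (\<delta> * of_nat (Suc n) * (c - of_nat n)) ((F ^^ n) y) = 0"
    using string_step[of F E y \<delta> c n, OF assms(1,3) comm] k n by (simp add: endo_simps[OF assms(2)])
  then have "c = of_nat n" using nz \<open>\<delta> \<noteq> 0\<close> by (simp del: of_nat_Suc)
  then show ?thesis using nz k n by blast
qed

lemma string_return:
  assumes "endo scale F" "endo scale E" and top: "E y = 0"
    and comm: "\<And>k. E (F ((F ^^ k) y)) = F (E ((F ^^ k) y)) + scale (\<delta> * (c - 2 * of_nat k)) ((F ^^ k) y)"
  shows "(E ^^ k) ((F ^^ k) y) = scale (\<Prod>m<k. \<delta> * of_nat (Suc m) * (c - of_nat m)) y"
proof (induction k)
  case (Suc k)
  have "(E ^^ Suc k) ((F ^^ Suc k) y) = (E ^^ k) (E ((F ^^ Suc k) y))"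
    by (simp only: funpow_Suc_right comp_apply)
  also have "\<dots> = scale (\<delta> * of_nat (Suc k) * (c - of_nat k)) ((E ^^ k) ((F ^^ k) y))"
    unfolding string_step[of F E y \<delta> c k, OF assms(1) top comm]
    by (rule endo_simps(5)[OF endo_funpow[OF assms(2)]])
  finally show ?case unfolding Suc by (simp add: mult.commute)
qed simp

end

fun opposite :: "sign \<Rightarrow> sign" where
  "opposite Plus = Minus" | "opposite Minus = Plus"

text \<open>
  The operators by which the generators of the Yangian act on a finite-dimensional module.  Here
  \<open>K i k\<close> is the coefficient of \<open>u\<^bsup>-k\<^esup>\<close> in \<open>\<xi>\<^sub>i(u)\<close>.  Since \<open>K i 0\<close> is the identity, the axiom
  \<open>K_X\<close> for \<open>k = 0\<close> is the relation with \<open>\<xi>\<^bsub>i,0\<^esub>\<close>.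
\<close>
locale yangian_operators = complex_vector_space scale + finite_type_cartan a d
  for scale :: "complex \<Rightarrow> 'v::ab_group_add \<Rightarrow> 'v"
    and a :: "'i::finite \<Rightarrow> 'i \<Rightarrow> int" and d :: "'i \<Rightarrow> nat" +
  fixes hbar :: complex
    and xop :: "sign \<Rightarrow> 'i \<Rightarrow> nat \<Rightarrow> 'v \<Rightarrow> 'v"
    and K :: "'i \<Rightarrow> nat \<Rightarrow> 'v \<Rightarrow> 'v"
  assumes hbar: "hbar \<noteq> 0"
    and endo_xop: "endo scale (xop \<epsilon> i r)" and endo_K: "endo scale (K i k)"
    and K_0: "K i 0 v = v"
    and K_K: "K i k (K j l v) = K j l (K i k v)"
    and K_X: "K i (Suc k) (xop \<epsilon> j s v) - xop \<epsilon> j s (K i (Suc k) v)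
        - (K i k (xop \<epsilon> j (Suc s) v) - xop \<epsilon> j (Suc s) (K i k v))
      = scale (sgn_val \<epsilon> * (hbar * sym_entry a d i j / 2)) (K i k (xop \<epsilon> j s v) + xop \<epsilon> j s (K i k v))"
    and X_X: "xop \<epsilon> i 1 (xop \<epsilon> i 0 v) - xop \<epsilon> i 0 (xop \<epsilon> i 1 v)
      = scale (sgn_val \<epsilon> * (hbar * of_nat (d i))) (xop \<epsilon> i 0 (xop \<epsilon> i 0 v))"
    and X_Plus_Minus: "scale hbar (xop Plus i r (xop Minus j s v) - xop Minus j s (xop Plus i r v))
      = (if i = j then K i (Suc (r + s)) v else 0)"
    and finite_span: "\<exists>B. finite B \<and> span B = UNIV"
begin

sublocale weights: reflection_action a d "\<lambda>k i. of_int (a i k)" "\<lambda>i. i"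
  by unfold_locales simp

text \<open>
  A weight is recorded by its values \<open>\<nu>\<^sub>i = \<nu>(h\<^sub>i)\<close>, and \<open>K i 1 = \<hbar> \<xi>\<^bsub>i,0\<^esub> = \<hbar> d\<^sub>i h\<^sub>i\<close>.
\<close>
definition wt :: "('i \<Rightarrow> complex) \<Rightarrow> 'v set" where
  "wt \<nu> = {v. \<forall>i. K i 1 v = scale (hbar * of_nat (d i) * \<nu> i) v}"

definition is_weight :: "('i \<Rightarrow> complex) \<Rightarrow> bool" where
  "is_weight \<nu> \<longleftrightarrow> (\<exists>v\<in>wt \<nu>. v \<noteq> 0)"

lemmas X_simps = endo_simps[OF endo_xop]
lemmas K_simps = endo_simps[OF endo_K]

lemma subspace_wt: "subspace (wt \<nu>)"
  by (rule subspaceI) (simp_all add: wt_def K_simps[unfolded One_nat_def] scale_right_distrib mult.commute K_simps)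

lemma K_1_X: "K i 1 (xop \<epsilon> j s v)
   = xop \<epsilon> j s (K i 1 v) + scale (sgn_val \<epsilon> * (hbar * sym_entry a d i j)) (xop \<epsilon> j s v)"
proof -
  have "K i 1 (xop \<epsilon> j s v) - xop \<epsilon> j s (K i 1 v)
     = scale (sgn_val \<epsilon> * (hbar * sym_entry a d i j / 2)) (xop \<epsilon> j s v + xop \<epsilon> j s v)"
    using K_X[of i 0 \<epsilon> j s v] by (simp add: K_0)
  also have "\<dots> = scale (sgn_val \<epsilon> * (hbar * sym_entry a d i j)) (xop \<epsilon> j s v)"
    by (simp only: scale_right_distrib scale_left_distrib[symmetric]) simp
  finally show ?thesis by (simp add: algebra_simps)
qed

lemma X_wt:
  assumes "v \<in> wt \<nu>"
  shows "xop \<epsilon> j s v \<in> wt (\<lambda>i. \<nu> i + sgn_val \<epsilon> * of_int (a i j))"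
proof -
  have "K i 1 (xop \<epsilon> j s v) = scale (hbar * of_nat (d i) * (\<nu> i + sgn_val \<epsilon> * of_int (a i j))) (xop \<epsilon> j s v)" for i
  proof -
    have "K i 1 v = scale (hbar * of_nat (d i) * \<nu> i) v" using assms by (simp add: wt_def)
    then have "K i 1 (xop \<epsilon> j s v) = scale (hbar * of_nat (d i) * \<nu> i) (xop \<epsilon> j s v)
        + scale (sgn_val \<epsilon> * (hbar * sym_entry a d i j)) (xop \<epsilon> j s v)"
      unfolding K_1_X by (simp only: X_simps)
    then show ?thesis by (simp add: sym_entry_def algebra_simps)
  qed
  then show ?thesis by (simp add: wt_def)
qed

lemma K_wt: "v \<in> wt \<nu> \<Longrightarrow> K i k v \<in> wt \<nu>"
  using K_K[of _ 1 i k v] by (simp add: wt_def K_simps)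

lemma X_pow_wt:
  assumes "v \<in> wt \<nu>"
  shows "(xop \<epsilon> j s ^^ k) v \<in> wt (\<lambda>i. \<nu> i + of_nat k * (sgn_val \<epsilon> * of_int (a i j)))"
proof (induction k)
  case 0
  then show ?case using assms by simp
next
  case (Suc k)
  show ?case using X_wt[OF Suc, of \<epsilon> j s] by (simp add: algebra_simps)
qed

lemma wt_unique:
  assumes "v \<in> wt \<nu>" "v \<in> wt \<nu>'" "v \<noteq> 0"
  shows "\<nu> = \<nu>'"
proof
  fix i
  have "scale (hbar * of_nat (d i) * \<nu> i) v = scale (hbar * of_nat (d i) * \<nu>' i) v"
    using assms(1,2) by (simp add: wt_def) metis
  then show "\<nu> i = \<nu>' i"
    using assms(3) hbar d_pos[of i] by simp
qed

lemma wt_independent: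
  assumes "finite I" "inj_on \<kappa> I" "\<And>i. i \<in> I \<Longrightarrow> t i \<in> wt (\<kappa> i)" "(\<Sum>i\<in>I. t i) = 0" "i \<in> I"
  shows "t i = 0"
  using assms
proof (induction I arbitrary: t i)
  case (insert x I)
  have zero: "t i = 0" if i: "i \<in> I" for i
  proof -
    have "\<kappa> i \<noteq> \<kappa> x" using insert.prems(1) insert.hyps(2) i by (auto simp: inj_on_def)
    then obtain l where l: "\<kappa> i l \<noteq> \<kappa> x l" by blast
    \<comment> \<open>The operator \<open>K l 1\<close> minus its eigenvalue at \<open>x\<close> removes the summand at \<open>x\<close>.\<close>
    define t' where "t' i = scale (hbar * of_nat (d l) * (\<kappa> i l - \<kappa> x l)) (t i)" for i
    have t': "t' i = K l 1 (t i) - scale (hbar * of_nat (d l) * \<kappa> x l) (t i)" if "i \<in> insert x I" for i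
      using insert.prems(2)[OF that]
      by (simp add: t'_def wt_def right_diff_distrib scale_left_diff_distrib)
    have "(\<Sum>i\<in>insert x I. t' i) = (\<Sum>i\<in>insert x I. K l 1 (t i) - scale (hbar * of_nat (d l) * \<kappa> x l) (t i))"
      by (intro sum.cong refl t')
    also have "\<dots> = K l 1 (\<Sum>i\<in>insert x I. t i) - scale (hbar * of_nat (d l) * \<kappa> x l) (\<Sum>i\<in>insert x I. t i)"
      by (simp only: K_simps sum_subtractf scale_sum_right)
    also have "\<dots> = 0" by (simp only: insert.prems(3) K_simps scale_zero_right diff_self)
    finally have "(\<Sum>i\<in>I. t' i) = 0" using insert.hyps by (simp add: t'_def)
    moreover have "t' i \<in> wt (\<kappa> i)" if "i \<in> I" for i
      unfolding t'_def using that insert.prems(2) subspace_wt subspace_scale by blast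
    ultimately have "t' i = 0"
      using insert.IH[of t' i] insert.prems(1) i by (auto simp: inj_on_def)
    then show ?thesis using l hbar d_pos[of l] by (simp add: t'_def)
  qed
  then have "t x = 0" using insert.prems(3) insert.hyps by simp
  then show ?case using zero insert.prems(4) by auto
qed simp

text \<open>
  The vectors \<open>x\<^sup>k v\<close> lie in pairwise different weight spaces, so finitely many of them can be
  nonzero.
\<close>
lemma X_nilpotent:
  assumes "v \<in> wt \<nu>"
  shows "\<exists>k. (xop \<epsilon> j s ^^ k) v = 0"
proof (rule ccontr)
  assume "\<nexists>k. (xop \<epsilon> j s ^^ k) v = 0"
  then have nz: "(xop \<epsilon> j s ^^ k) v \<noteq> 0" for k by blast
  define y where "y k = (xop \<epsilon> j s ^^ k) v" for k
  define \<kappa> where "\<kappa> k = (\<lambda>i. \<nu> i + of_nat k * (sgn_val \<epsilon> * of_int (a i j)))" for k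
  have y: "y k \<in> wt (\<kappa> k)" for k
    unfolding y_def \<kappa>_def by (rule X_pow_wt) fact
  have inj: "inj \<kappa>"
  proof (rule injI)
    fix k l assume "\<kappa> k = \<kappa> l"
    from fun_cong[OF this, of j] show "k = l"
      by (cases \<epsilon>) (simp_all add: \<kappa>_def diag)
  qed
  have "inj y"
    using wt_unique[OF y] y nz inj by (metis (no_types, opaque_lifting) injD injI y_def)
  have "independent (range y)"
    unfolding dependent_explicit
  proof safe
    fix t u assume t: "finite t" "t \<subseteq> range y" "(\<Sum>v\<in>t. scale (u v) v) = 0"
    fix v assume v: "v \<in> t" "u v \<noteq> 0"
    obtain I where I: "finite I" "t = y ` I" using t(1,2) by (meson finite_subset_image)
    obtain k where k: "k \<in> I" "v = y k" using I v by blast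
    have "(\<Sum>k\<in>I. scale (u (y k)) (y k)) = 0"
      using t(3) \<open>inj y\<close> unfolding I(2) by (subst (asm) sum.reindex) (auto intro: inj_on_subset)
    then have "scale (u (y k)) (y k) = 0"
      using inj I(1) k(1) y subspace_scale[OF subspace_wt]
      by (intro wt_independent[of I \<kappa> "\<lambda>k. scale (u (y k)) (y k)" k]) (auto intro: inj_on_subset)
    then show False using v(2) nz k(2) by (simp add: y_def)
  qed
  moreover obtain B where "finite B" "span B = UNIV" using finite_span by blast
  ultimately have "finite (range y)" using independent_span_bound[of B "range y"] by simp
  then show False using \<open>inj y\<close> finite_imageD infinite_UNIV_nat by blast
qed

lemma X_commutator:
  assumes "v \<in> wt \<nu>"
  shows "xop (opposite \<epsilon>) j 0 (xop \<epsilon> j 0 v) = xop \<epsilon> j 0 (xop (opposite \<epsilon>) j 0 v)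
      + scale (- sgn_val \<epsilon> * of_nat (d j) * \<nu> j) v"
proof -
  have "scale hbar (xop Plus j 0 (xop Minus j 0 v) - xop Minus j 0 (xop Plus j 0 v)) = K j 1 v"
    by (simp add: X_Plus_Minus)
  also have "\<dots> = scale hbar (scale (of_nat (d j) * \<nu> j) v)"
    using assms by (simp add: wt_def mult.assoc)
  finally have "xop Plus j 0 (xop Minus j 0 v) - xop Minus j 0 (xop Plus j 0 v) = scale (of_nat (d j) * \<nu> j) v"
    using hbar scale_cancel_left by blast
  then show ?thesis by (cases \<epsilon>) (simp_all add: algebra_simps)
qed

text \<open>
  Strings in both directions at once: for \<open>\<epsilon> = Minus\<close> the vector \<open>v\<close> is a highest weight vector,
  for \<open>\<epsilon> = Plus\<close> a lowest weight vector.
\<close>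
lemma X_string:
  assumes v: "v \<in> wt \<nu>" "v \<noteq> 0" and top: "xop (opposite \<epsilon>) j 0 v = 0"
  shows "\<exists>n z. - sgn_val \<epsilon> * \<nu> j = of_nat n \<and> (xop \<epsilon> j 0 ^^ n) v \<noteq> 0 \<and> (xop \<epsilon> j 0 ^^ Suc n) v = 0
    \<and> (xop (opposite \<epsilon>) j 0 ^^ n) ((xop \<epsilon> j 0 ^^ n) v) = scale z v \<and> z \<noteq> 0"
proof -
  let ?F = "xop \<epsilon> j 0" and ?E = "xop (opposite \<epsilon>) j 0" and ?c = "- sgn_val \<epsilon> * \<nu> j"
  have comm: "?E (?F ((?F ^^ k) v)) = ?F (?E ((?F ^^ k) v)) 
      + scale (of_nat (d j) * (?c - 2 * of_nat k)) ((?F ^^ k) v)" for k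
    using X_commutator[OF X_pow_wt[OF v(1), where \<epsilon> = \<epsilon> and j = j and s = 0 and k = k], where \<epsilon> = \<epsilon> and j = j]
    by (cases \<epsilon>) (simp_all add: diag algebra_simps)
  have d: "of_nat (d j) \<noteq> (0::complex)" using d_pos[of j] by simp
  obtain n where n: "?c = of_nat n" "(?F ^^ n) v \<noteq> 0" "(?F ^^ Suc n) v = 0"
    using string_terminates[of ?F ?E v "of_nat (d j)" ?c, OF endo_xop endo_xop top comm d v(2) X_nilpotent[OF v(1)]]
    by blast
  have "(\<Prod>m<n. of_nat (d j) * of_nat (Suc m) * (?c - of_nat m)) \<noteq> 0"
    unfolding n(1) using d by (simp del: of_nat_Suc)
  then show ?thesis
    using n string_return[of ?F ?E v "of_nat (d j)" ?c n, OF endo_xop endo_xop top comm] by blast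
qed

lemma funpow_nonzero:
  assumes "endo scale F" "(F ^^ n) v \<noteq> 0" "k \<le> n"
  shows "(F ^^ k) v \<noteq> 0"
proof
  assume "(F ^^ k) v = 0"
  moreover have "(F ^^ n) v = (F ^^ (n - k)) ((F ^^ k) v)"
    using assms(3) by (simp add: funpow_add[symmetric] flip: comp_apply[of "F ^^ (n - k)"])
  ultimately show False
    using assms(2) endo_simps(4)[OF endo_funpow[OF assms(1)]] by simp
qed

text \<open>
  Go from a weight vector to the end of its string in the direction opposite to \<open>\<epsilon>\<close> and come back
  \<open>m + l\<close> steps, where \<open>l\<close> is the number of steps taken.  The full string has \<open>n = m + 2 l\<close>
  steps, so this is possible if \<open>m \<ge> 0\<close>.
\<close>
lemma reflect_weight_half:
  assumes "is_weight \<nu>"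
  shows "\<exists>m::int. - sgn_val \<epsilon> * \<nu> j = of_int m \<and> (m \<ge> 0 \<longrightarrow> is_weight (weights.refl j \<nu>))"
proof -
  let ?F = "xop \<epsilon> j 0" and ?E = "xop (opposite \<epsilon>) j 0"
  obtain v where v: "v \<in> wt \<nu>" "v \<noteq> 0" using assms by (auto simp: is_weight_def)
  define k where "k = (LEAST k. (?E ^^ k) v = 0)"
  have k: "(?E ^^ k) v = 0" unfolding k_def by (rule LeastI_ex) (rule X_nilpotent[OF v(1)])
  have "k \<noteq> 0" using k v(2) by (intro notI) simp
  then obtain l where l: "k = Suc l" using not0_implies_Suc by blast
  define y where "y = (?E ^^ l) v"
  have y: "y \<noteq> 0" "?E y = 0"
    using not_less_Least[of l "\<lambda>k. (?E ^^ k) v = 0"] l k k_def by (auto simp: y_def)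
  have ywt: "y \<in> wt (\<lambda>i. \<nu> i + of_nat l * (sgn_val (opposite \<epsilon>) * of_int (a i j)))"
    unfolding y_def by (rule X_pow_wt[OF v(1)])
  have s: "sgn_val (opposite \<epsilon>) = - sgn_val \<epsilon>" "sgn_val \<epsilon> * sgn_val \<epsilon> = 1" by (cases \<epsilon>; simp)+
  obtain n where n: "- sgn_val \<epsilon> * (\<nu> j + of_nat l * (sgn_val (opposite \<epsilon>) * of_int (a j j))) = of_nat n"
     "(?F ^^ n) y \<noteq> 0"
    using X_string[OF ywt y] by blast
  define m where "m = int n - 2 * int l"
  have "of_nat n = - sgn_val \<epsilon> * \<nu> j + (sgn_val \<epsilon> * sgn_val \<epsilon>) * (2 * of_nat l)"
    unfolding n(1)[symmetric] s(1) diag by (simp add: algebra_simps)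
  then have m: "- sgn_val \<epsilon> * \<nu> j = of_int m" by (simp add: m_def s(2))
  have "is_weight (weights.refl j \<nu>)" if "m \<ge> 0"
  proof -
    have le: "nat m + l \<le> n" using that by (simp add: m_def)
    have "sgn_val \<epsilon> * of_int m = - (sgn_val \<epsilon> * sgn_val \<epsilon>) * \<nu> j" unfolding m[symmetric] by simp
    then have nu: "sgn_val \<epsilon> * of_int m = - \<nu> j" by (simp add: s(2))
    have "(?F ^^ (nat m + l)) y \<noteq> 0" using funpow_nonzero[OF endo_xop n(2) le] .
    moreover have "(?F ^^ (nat m + l)) y \<in> wt (\<lambda>i. (\<nu> i + of_nat l * (sgn_val (opposite \<epsilon>) * of_int (a i j)))
        + of_nat (nat m + l) * (sgn_val \<epsilon> * of_int (a i j)))"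
      by (rule X_pow_wt[OF ywt])
    moreover have "(\<lambda>i. (\<nu> i + of_nat l * (sgn_val (opposite \<epsilon>) * of_int (a i j)))
        + of_nat (nat m + l) * (sgn_val \<epsilon> * of_int (a i j))) = weights.refl j \<nu>"
    proof
      fix i
      have "(\<nu> i + of_nat l * (sgn_val (opposite \<epsilon>) * of_int (a i j)))
        + of_nat (nat m + l) * (sgn_val \<epsilon> * of_int (a i j)) = \<nu> i + sgn_val \<epsilon> * of_int m * of_int (a i j)"
        using that by (simp add: s(1) algebra_simps)
      then show "(\<nu> i + of_nat l * (sgn_val (opposite \<epsilon>) * of_int (a i j)))
        + of_nat (nat m + l) * (sgn_val \<epsilon> * of_int (a i j)) = weights.refl j \<nu> i"
        unfolding nu by (simp add: functional_reflection_def)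
    qed
    ultimately show ?thesis unfolding is_weight_def by metis
  qed
  then show ?thesis using m by blast
qed

lemma reflect_weight:
  assumes "is_weight \<nu>"
  shows "is_weight (weights.refl j \<nu>)"
proof -
  obtain m where m: "- sgn_val Minus * \<nu> j = of_int m" "m \<ge> 0 \<longrightarrow> is_weight (weights.refl j \<nu>)"
    using reflect_weight_half[OF assms, of Minus j] by blast
  obtain m' where m': "- sgn_val Plus * \<nu> j = of_int m'" "m' \<ge> 0 \<longrightarrow> is_weight (weights.refl j \<nu>)"
    using reflect_weight_half[OF assms, of Plus j] by blast
  have "(of_int m' :: complex) = of_int (- m)" using m(1) m'(1) by simp
  then have "m' = - m" using of_int_eq_iff by blast
  then show ?thesis using m m' by linarith
qed

text \<open>
  Group an expansion over \<open>B\<close> by weights and use the independence of the weight spaces.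
\<close>
lemma wt_span:
  assumes t: "t \<in> span B" "t \<in> wt \<nu>" and B: "\<And>b. b \<in> B \<Longrightarrow> b \<in> wt (\<kappa> b)"
  shows "t \<in> span {b \<in> B. \<kappa> b = \<nu>}"
proof -
  obtain T r where T: "finite T" "T \<subseteq> B" "t = (\<Sum>b\<in>T. scale (r b) b)"
    using t(1) by (auto simp: span_explicit)
  define s where "s \<eta> = (\<Sum>b\<in>{b \<in> T. \<kappa> b = \<eta>}. scale (r b) b)" for \<eta>
  have s: "s \<eta> \<in> span {b \<in> B. \<kappa> b = \<eta>}" for \<eta>
    unfolding s_def using T(2) by (intro span_sum span_scale span_base) auto
  have s_wt: "s \<eta> \<in> wt \<eta>" for \<eta>
    unfolding s_def using T(2) B by (intro subspace_sum subspace_scale subspace_wt) auto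
  have "t = (\<Sum>\<eta>\<in>\<kappa> ` T. s \<eta>)"
    unfolding T(3) s_def by (rule sum.image_gen[OF T(1)])
  also have "\<dots> = (\<Sum>\<eta>\<in>insert \<nu> (\<kappa> ` T). s \<eta>)"
  proof (rule sum.mono_neutral_left)
    show "\<forall>\<eta>\<in>insert \<nu> (\<kappa> ` T) - \<kappa> ` T. s \<eta> = 0"
    proof
      fix \<eta> assume "\<eta> \<in> insert \<nu> (\<kappa> ` T) - \<kappa> ` T"
      then have "{b \<in> T. \<kappa> b = \<eta>} = {}" by blast
      then show "s \<eta> = 0" by (simp only: s_def sum.empty)
    qed
  qed (use T(1) in auto)
  finally have "(\<Sum>\<eta>\<in>insert \<nu> (\<kappa> ` T). s \<eta> - (if \<eta> = \<nu> then t else 0)) = 0"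
    using T(1) by (simp add: sum_subtractf)
  then have "s \<nu> - (if \<nu> = \<nu> then t else 0) = 0"
    using T(1) t(2) s_wt subspace_diff[OF subspace_wt]
    by (intro wt_independent[of "insert \<nu> (\<kappa> ` T)" "\<lambda>\<eta>. \<eta>"
          "\<lambda>\<eta>. s \<eta> - (if \<eta> = \<nu> then t else 0)" \<nu>]) auto
  then show ?thesis using s[of \<nu>] by simp
qed

end

section \<open>Extremal weight spaces of a highest weight module\<close>

text \<open>
  The closure condition \<open>generates\<close> is that of a submodule, phrased with the generators.
\<close>
locale highest_weight_operators = yangian_operators scale a d hbar xop K
  for scale :: "complex \<Rightarrow> 'v::ab_group_add \<Rightarrow> 'v"
    and a :: "'i::finite \<Rightarrow> 'i \<Rightarrow> int" and d hbar xop K +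
  fixes v :: 'v and \<mu> :: "'i \<Rightarrow> complex" and \<Lambda> :: "'i \<Rightarrow> complex fls"
  assumes v_nonzero: "v \<noteq> 0" and v_wt: "v \<in> wt \<mu>"
    and v_highest: "xop Plus i r v = 0"
    and v_eigen: "K i k v = scale (fls_nth (\<Lambda> i) (int k)) v"
    and \<Lambda>_unit: "\<Lambda> i \<in> unit_series"
    and generates: "\<lbrakk>subspace S; v \<in> S; \<And>\<epsilon> i r u. u \<in> S \<Longrightarrow> xop \<epsilon> i r u \<in> S;
       \<And>i k u. u \<in> S \<Longrightarrow> K i k u \<in> S\<rbrakk> \<Longrightarrow> S = UNIV"
begin

definition word :: "('i \<times> nat) list \<Rightarrow> 'v" where
  "word rs = foldr (\<lambda>(j, r). xop Minus j r) rs v"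

definition letter_count :: "('i \<times> nat) list \<Rightarrow> 'i \<Rightarrow> nat" where
  "letter_count rs k = length (filter (\<lambda>p. fst p = k) rs)"

definition below :: "('i \<Rightarrow> nat) \<Rightarrow> 'i \<Rightarrow> complex" where
  "below c = (\<lambda>i. \<mu> i - (\<Sum>k\<in>UNIV. of_nat (c k) * of_int (a i k)))"

lemma word_simps: "word [] = v" "word ((j, r) # rs) = xop Minus j r (word rs)"
  by (simp_all add: word_def)

lemma word_wt: "word rs \<in> wt (below (letter_count rs))"
proof (induction rs)
  case Nil
  then show ?case using v_wt by (simp add: word_simps below_def letter_count_def)
next
  case (Cons p rs)
  obtain j r where p: "p = (j, r)" by fastforce
  have "(\<Sum>k\<in>UNIV. of_nat (letter_count (p # rs) k) * of_int (a i k))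
    = (\<Sum>k\<in>UNIV. of_nat (letter_count rs k) * of_int (a i k)) + (of_int (a i j) :: complex)" for i
  proof -
    have "(\<Sum>k\<in>UNIV. of_nat (letter_count (p # rs) k) * of_int (a i k))
      = (\<Sum>k\<in>UNIV. of_nat (letter_count rs k) * of_int (a i k) + (if k = j then of_int (a i k) else (0::complex)))"
      by (intro sum.cong refl) (auto simp: letter_count_def p algebra_simps)
    then show ?thesis by (simp add: sum.distrib)
  qed
  then have "below (letter_count (p # rs)) = (\<lambda>i. below (letter_count rs) i + sgn_val Minus * of_int (a i j))"
    by (simp add: below_def fun_eq_iff)
  then show ?case using X_wt[OF Cons, of Minus j r] by (simp add: p word_simps)
qed

lemma endo_span:
  assumes "endo scale F" "\<And>b. b \<in> B \<Longrightarrow> F b \<in> span C" "t \<in> span B"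
  shows "F t \<in> span C"
  using assms(3)
proof (induction rule: span_induct_alt)
  case (step c x y)
  then show ?case using assms(2) by (simp add: endo_simps[OF assms(1)] span_add span_scale)
qed (simp add: endo_simps[OF assms(1)] span_zero)

lemma xop_Minus_span: "t \<in> span (range word) \<Longrightarrow> xop Minus j r t \<in> span (range word)"
proof (rule endo_span[OF endo_xop])
  fix b assume "b \<in> range word"
  then obtain rs where "b = word rs" by blast
  then have "xop Minus j r b = word ((j, r) # rs)" by (simp add: word_simps)
  then show "xop Minus j r b \<in> span (range word)" by (simp add: span_base)
qed

text \<open>
  The relation expresses \<open>K i (k+1)\<close> on a word through shorter words and operators with smaller \<open>k\<close>,
  at the price of raising the mode of the first letter; hence the induction on \<open>k\<close> inside that on the word.
\<close>
lemma K_word_span: "K i k (word rs) \<in> span (range word)"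
proof (induction rs arbitrary: i k)
  case Nil
  have "v \<in> span (range word)" by (metis rangeI span_base word_simps(1))
  then show ?case by (simp add: word_simps v_eigen span_scale)
next
  case (Cons p rs)
  obtain j r where p: "p = (j, r)" by fastforce
  have "K i k (xop Minus j r (word rs)) \<in> span (range word)" for r
  proof (induction k arbitrary: r)
    case 0
    then show ?case by (metis K_0 rangeI span_base word_simps(2))
  next
    case (Suc k)
    have "K i (Suc k) (xop Minus j r (word rs)) = xop Minus j r (K i (Suc k) (word rs))
       + (K i k (xop Minus j (Suc r) (word rs)) - xop Minus j (Suc r) (K i k (word rs)))
       + scale (sgn_val Minus * (hbar * sym_entry a d i j / 2)) (K i k (xop Minus j r (word rs)) + xop Minus j r (K i k (word rs)))"
      unfolding K_X[symmetric] by simp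
    then show ?case
      by (simp only:) (intro span_add span_diff span_scale xop_Minus_span Cons.IH Suc.IH)
  qed
  then show ?case by (simp add: p word_simps)
qed

lemma xop_Plus_word_span: "xop Plus i r (word rs) \<in> span (range word)"
proof (induction rs)
  case Nil
  then show ?case by (simp add: word_simps v_highest span_zero)
next
  case (Cons p rs)
  obtain j s where p: "p = (j, s)" by fastforce
  have "scale hbar (xop Plus i r (xop Minus j s (word rs)) - xop Minus j s (xop Plus i r (word rs))) \<in> span (range word)"
    unfolding X_Plus_Minus by (simp add: K_word_span span_zero)
  then have "scale (1 / hbar) (scale hbar (xop Plus i r (xop Minus j s (word rs)) - xop Minus j s (xop Plus i r (word rs)))) \<in> span (range word)"
    by (rule span_scale)
  then have "xop Plus i r (xop Minus j s (word rs)) - xop Minus j s (xop Plus i r (word rs)) \<in> span (range word)"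
    using hbar by simp
  then have "(xop Plus i r (xop Minus j s (word rs)) - xop Minus j s (xop Plus i r (word rs)))
     + xop Minus j s (xop Plus i r (word rs)) \<in> span (range word)"
    by (intro span_add xop_Minus_span Cons.IH)
  then show ?case by (simp add: p word_simps)
qed

lemma span_words: "span (range word) = UNIV"
proof (rule generates)
  show "v \<in> span (range word)" by (metis rangeI span_base word_simps(1))
  fix \<epsilon> i r u assume u: "u \<in> span (range word)"
  show "xop \<epsilon> i r u \<in> span (range word)"
  proof (cases \<epsilon>)
    case Plus
    show ?thesis unfolding Plus
      by (rule endo_span[OF endo_xop _ u]) (auto intro: xop_Plus_word_span)
  qed (use u xop_Minus_span in simp)
next
  fix i k u assume u: "u \<in> span (range word)"
  show "K i k u \<in> span (range word)"
    by (rule endo_span[OF endo_K _ u]) (auto intro: K_word_span)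
qed simp

definition word_weight :: "'v \<Rightarrow> 'i \<Rightarrow> complex" where
  "word_weight b = below (letter_count (SOME rs. word rs = b))"

lemma wt_words:
  assumes "t \<in> wt \<nu>"
  shows "t \<in> span {b \<in> range word. word_weight b = \<nu>}"
proof (rule wt_span[OF _ assms])
  show "t \<in> span (range word)" by (simp add: span_words)
  fix b assume "b \<in> range word"
  then have "word (SOME rs. word rs = b) = b" by (metis (mono_tags) rangeE someI_ex)
  then show "b \<in> wt (word_weight b)" using word_wt unfolding word_weight_def by metis
qed

lemma weight_below:
  assumes "is_weight \<nu>"
  shows "\<exists>c. \<nu> = below c"
proof -
  obtain t where "t \<in> wt \<nu>" "t \<noteq> 0" using assms by (auto simp: is_weight_def)
  then have "{b \<in> range word. word_weight b = \<nu>} \<noteq> {}" using wt_words[of t \<nu>] span_empty by (metis singletonD)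
  then show ?thesis by (auto simp: word_weight_def)
qed

text \<open>
  Simple roots are linearly independent as families of values on the \<open>h\<^sub>i\<close>.
\<close>
lemma complex_roots_independent:
  fixes c :: "'i \<Rightarrow> int"
  assumes "\<And>i. (\<Sum>k\<in>UNIV. of_int (c k) * of_int (a i k)) = (0 :: complex)"
  shows "c k = 0"
proof -
  have "(of_int (\<Sum>k\<in>UNIV. a i k * c k) :: complex) = of_int 0" for i
    using assms[of i] by (simp add: mult.commute)
  then have "(\<Sum>k\<in>UNIV. a i k * c k) = 0" for i by (simp only: of_int_eq_iff)
  then have "(\<Sum>k\<in>UNIV. real_of_int (a i k) * real_of_int (c k)) = 0" for i
    by (metis (mono_tags, lifting) of_int_0 of_int_mult of_int_sum sum.cong)
  from roots_independent[of "\<lambda>k. real_of_int (c k)", OF this] show ?thesis by simp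
qed

lemma top_wt: "t \<in> wt \<mu> \<Longrightarrow> t \<in> span {v}"
proof -
  assume "t \<in> wt \<mu>"
  moreover have "{b \<in> range word. word_weight b = \<mu>} \<subseteq> {v}"
  proof clarify
    fix rs assume *: "word_weight (word rs) = \<mu>"
    define rs' where "rs' = (SOME rs'. word rs' = word rs)"
    have w: "word rs' = word rs" unfolding rs'_def by (rule someI_ex) blast
    have "(\<Sum>k\<in>UNIV. of_int (int (letter_count rs' k)) * of_int (a i k)) = (0::complex)" for i
      using fun_cong[OF *, of i] by (simp add: word_weight_def below_def rs'_def)
    then have "int (letter_count rs' (fst (hd rs'))) = 0" by (rule complex_roots_independent)
    then have "rs' = []" by (cases rs') (simp_all add: letter_count_def)
    then show "word rs = v" using w by (simp add: word_simps)
  qed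
  ultimately show ?thesis using wt_words span_mono by blast
qed

text \<open>
  Reflecting back along the word turns \<open>w\<mu> + \<alpha>\<^sub>j\<close> into \<open>\<mu>\<close> plus a positive root, which is not of
  the form \<open>\<mu>\<close> minus a sum of simple roots.
\<close>
lemma above_not_weight:
  assumes pos: "\<And>l. fold (root_reflection a) js (unit_vec j) l \<ge> 0"
  shows "\<not> is_weight (\<lambda>i. foldr weights.refl js \<mu> i + of_int (a i j))"
proof
  assume "is_weight (\<lambda>i. foldr weights.refl js \<mu> i + of_int (a i j))"
  moreover have "is_weight \<nu> \<Longrightarrow> is_weight (fold weights.refl js \<nu>)" for \<nu>
    by (induction js arbitrary: \<nu>) (simp_all add: reflect_weight)
  ultimately have "is_weight (fold weights.refl js
      (\<lambda>i. foldr weights.refl js \<mu> i + weights.root_functional (unit_vec j) i))"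
    by (simp add: weights.root_functional_unit_vec)
  moreover have "fold weights.refl js (\<lambda>i. foldr weights.refl js \<mu> i + weights.root_functional (unit_vec j) i)
     = (\<lambda>i. \<mu> i + weights.root_functional (fold (root_reflection a) js (unit_vec j)) i)"
    using weights.fold_refl_linear[of js "foldr weights.refl js \<mu>" 1 "weights.root_functional (unit_vec j)"]
    by (simp add: weights.fold_foldr_refl weights.fold_refl_root_functional)
  ultimately have "is_weight (\<lambda>i. \<mu> i + weights.root_functional (fold (root_reflection a) js (unit_vec j)) i)"
    by simp
  then obtain c where c: "(\<lambda>i. \<mu> i + weights.root_functional (fold (root_reflection a) js (unit_vec j)) i) = below c"
    using weight_below by blast
  let ?g = "fold (root_reflection a) js (unit_vec j)"
  have "(\<Sum>k\<in>UNIV. of_int (?g k + int (c k)) * of_int (a i k)) = (0::complex)" for i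
    using fun_cong[OF c, of i]
    by (simp add: below_def weights.root_functional_def distrib_right sum.distrib eq_neg_iff_add_eq_0[symmetric])
  then have "?g k + int (c k) = 0" for k by (rule complex_roots_independent)
  then have "?g k = 0" for k using pos[of k] by (metis add_nonneg_eq_0_iff of_nat_0_le_iff)
  then have "?g = (\<lambda>l. 0)" by blast
  then have "root_like j (\<lambda>l. 0)" using root_like_fold[OF root_like_unit_vec, of j js] by simp
  then show False using d_pos[of j] by (simp add: root_like_def form_def)
qed

text \<open>
  The invariant of the induction along a reduced word: the weight space is a line, and the family \<open>T\<close>
  gives the eigenvalues of all \<open>\<xi>\<^sub>i(u)\<close> on it.
\<close>
definition extremal :: "('i \<Rightarrow> complex) \<Rightarrow> ('i \<Rightarrow> complex fls) \<Rightarrow> bool" where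
  "extremal \<nu> T \<longleftrightarrow> (\<exists>u \<phi>. u \<noteq> 0 \<and> u \<in> wt \<nu> \<and> wt \<nu> \<subseteq> span {u}
     \<and> (\<forall>i k. K i k u = scale (fps_nth (\<phi> i) k) u) \<and> (\<forall>i. T i = fps_to_fls (\<phi> i)))"

lemma extremal_top: "extremal \<mu> \<Lambda>"
proof -
  have "\<exists>\<phi>. \<Lambda> i = fps_to_fls \<phi>" for i
    using \<Lambda>_unit[of i] unfolding unit_series_def by blast
  then obtain \<phi> where \<phi>: "\<Lambda> i = fps_to_fls (\<phi> i)" for i by metis
  have "K i k v = scale (fps_nth (\<phi> i) k) v" for i k
    using v_eigen[of i k] by (simp add: \<phi>)
  then show ?thesis
    unfolding extremal_def using v_nonzero v_wt top_wt \<phi> by blast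
qed

lemma sym_entry_eq: "sym_entry a d i j = of_nat (d j) * of_int (a j i)"
  using arg_cong[OF symm[of i j], of complex_of_int] by (simp add: sym_entry_def)

text \<open>
  The step of the induction.  The \<open>sl\<^sub>2\<close>-string from \<open>\<nu>\<close> down to \<open>s\<^sub>j\<nu>\<close> shows that the new weight
  space is again a line; then the rank one results identify the eigenvalues on it.
\<close>
lemma extremal_step:
  assumes ext: "extremal \<nu> T" and above: "\<not> is_weight (\<lambda>i. \<nu> i + of_int (a i j))"
  shows "extremal (weights.refl j \<nu>) (tau a d hbar j T)"
proof -
  obtain u \<phi> where u: "u \<noteq> 0" "u \<in> wt \<nu>" "wt \<nu> \<subseteq> span {u}"
    and \<phi>: "\<And>i k. K i k u = scale (fps_nth (\<phi> i) k) u" "\<And>i. T i = fps_to_fls (\<phi> i)"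
    using ext by (auto simp: extremal_def)
  let ?x = "xop Minus j 0" and ?\<rho> = "weights.refl j \<nu>"
  have raise: "xop Plus j r u = 0" for r
    using X_wt[OF u(2), of Plus j r] above by (auto simp: is_weight_def)
  obtain n where n: "\<nu> j = of_nat n" "(?x ^^ n) u \<noteq> 0" "(?x ^^ Suc n) u = 0"
    using X_string[OF u(2,1), of Minus j] raise[of 0] by auto
  define w where "w = (?x ^^ n) u"
  have w: "w \<noteq> 0" "?x w = 0" using n by (simp_all add: w_def)
  have \<rho>: "?\<rho> = (\<lambda>i. \<nu> i + of_nat n * (sgn_val Minus * of_int (a i j)))"
    by (simp add: functional_reflection_def n(1))
  have w_wt: "w \<in> wt ?\<rho>" unfolding w_def \<rho> by (rule X_pow_wt[OF u(2)])
  have span_w: "\<exists>c. t = scale c w" if t: "t \<in> wt ?\<rho>" for t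
  proof (cases "t = 0")
    case True
    then show ?thesis by (intro exI[of _ 0]) simp
  next
    case False
    \<comment> \<open>A weight below \<open>s\<^sub>j\<nu>\<close> in direction \<open>\<alpha>\<^sub>j\<close> would reflect to \<open>\<nu> + \<alpha>\<^sub>j\<close>.\<close>
    have low: "?x t = 0"
    proof (rule ccontr)
      assume "?x t \<noteq> 0"
      then have "is_weight (\<lambda>i. ?\<rho> i + sgn_val Minus * of_int (a i j))"
        using X_wt[OF t, of Minus j 0] by (auto simp: is_weight_def)
      then have "is_weight (weights.refl j (\<lambda>i. ?\<rho> i + sgn_val Minus * of_int (a i j)))"
        by (rule reflect_weight)
      moreover have "weights.refl j (\<lambda>i. ?\<rho> i + sgn_val Minus * of_int (a i j)) = (\<lambda>i. \<nu> i + of_int (a i j))"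
        by (simp add: functional_reflection_def diag fun_eq_iff algebra_simps)
      ultimately show False using above by simp
    qed
    obtain p z where p: "- sgn_val Plus * ?\<rho> j = of_nat p" 
       "(?x ^^ p) ((xop Plus j 0 ^^ p) t) = scale z t" "z \<noteq> 0"
      using X_string[OF t False, of Plus j] low by auto
    have "(of_nat p :: complex) = of_nat n"
      unfolding p(1)[symmetric] by (simp add: functional_reflection_def diag n(1))
    then have pn: "p = n" by simp
    have "(xop Plus j 0 ^^ n) t \<in> wt \<nu>"
      using X_pow_wt[OF t, where \<epsilon> = Plus and j = j and s = 0 and k = n] by (simp add: \<rho>)
    then obtain \<beta> where \<beta>: "(xop Plus j 0 ^^ n) t = scale \<beta> u" using u(3) span_singleton by blast
    \<comment> \<open>The vector \<open>t\<close> is recovered, up to \<open>z \<noteq> 0\<close>, by raising it to the line of \<open>u\<close> and lowering it again.\<close>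
    have "scale z t = scale \<beta> w"
      using p(2) by (simp add: pn \<beta> w_def endo_simps[OF endo_funpow[OF endo_xop]])
    then have "scale (inverse z) (scale z t) = scale (inverse z * \<beta>) w" by simp
    then show ?thesis using p(3) by auto
  qed
  have "\<exists>c. K i k w = scale c w" for i k using span_w K_wt[OF w_wt] by blast
  then obtain \<psi>' where \<psi>': "K i k w = scale (\<psi>' i k) w" for i k by metis
  define \<psi> where "\<psi> i = Abs_fps (\<psi>' i)" for i
  have \<psi>: "K i k w = scale (fps_nth (\<psi> i) k) w" for i k by (simp add: \<psi>_def \<psi>')
  interpret L: lowering_pair scale ?x "xop Minus j 1"
    by unfold_locales (simp_all add: X_simps)
  have mom_wt: "L.moment u m k \<in> wt (\<lambda>i. \<nu> i + of_nat m * (sgn_val Minus * of_int (a i j)))" for m k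
  proof (induction m arbitrary: k)
    case 0
    then show ?case using u(2) subspace_0[OF subspace_wt] by (cases k) (simp_all only: L.moment.simps, simp_all)
  next
    case (Suc m)
    have *: "xop Minus j r (L.moment u m k) \<in> wt (\<lambda>i. \<nu> i + of_nat (Suc m) * (sgn_val Minus * of_int (a i j)))" for r k
      using X_wt[OF Suc, of Minus j r] by (simp add: algebra_simps)
    show ?case using * subspace_diff[OF subspace_wt * *] by (cases k) (simp_all only: L.moment.simps)
  qed
  have "\<exists>c. L.moment u n k = scale c w \<and> (k = 0 \<longrightarrow> c = 1)" for k
  proof (cases k)
    case 0
    have "L.moment u n 0 = scale 1 w" by (simp only: L.moment_0 w_def scale_one)
    then show ?thesis unfolding 0 by blast
  next
    case (Suc l)
    then show ?thesis using span_w[OF mom_wt[of n k, folded \<rho>]] by auto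
  qed
  then obtain m where m: "L.moment u n k = scale (m k) w" "k = 0 \<longrightarrow> m k = 1" for k by metis
  interpret S: lowering_string scale ?x "xop Minus j 1" u w n m
    by unfold_locales (use w m in auto)
  let ?c = "\<lambda>i. hbar * sym_entry a d i j / 2"
  let ?a = "hbar * of_nat (d j)"
  have rel: "K i (Suc k) (?x t) - ?x (K i (Suc k) t) - (K i k (xop Minus j 1 t) - xop Minus j 1 (K i k t))
      = scale (- ?c i) (K i k (?x t) + ?x (K i k t))" for i k t
    using K_X[of i k Minus j 0 t] by simp
  have cj: "?c j = ?a" by (simp add: sym_entry_def diag)
  have own: "\<phi> j * S.drinfeld 0 = S.drinfeld ?a"
  proof (rule S.string_drinfeld[where K = "K j" and \<phi> = "\<phi> j" and \<psi> = "\<psi> j" and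
        R = "\<lambda>k t. case k of 0 \<Rightarrow> 0 | Suc s \<Rightarrow> scale hbar (xop Plus j s t)", OF endo_K K_0])
    show "K j (Suc k) (?x t) - ?x (K j (Suc k) t) - (K j k (xop Minus j 1 t) - xop Minus j 1 (K j k t))
      = scale (- ?a) (K j k (?x t) + ?x (K j k t))" for k t
      using rel[of j k t] unfolding cj .
    show "K j 1 (xop Minus j 1 t) = xop Minus j 1 (K j 1 t) - scale (2 * ?a) (xop Minus j 1 t)" for t
      unfolding K_1_X by (simp add: sym_entry_def diag mult_ac)
    have "xop Minus j 1 (?x t) - ?x (xop Minus j 1 t) = - scale ?a (?x (?x t))" for t
      using X_X[of Minus j t] by simp
    then show "?x (xop Minus j 1 t) = xop Minus j 1 (?x t) + scale ?a (?x (?x t))" for t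
      by (metis add.commute diff_add_cancel minus_diff_eq minus_minus)
    show "endo scale (\<lambda>t. case k of 0 \<Rightarrow> 0 | Suc s \<Rightarrow> scale hbar (xop Plus j s t))" for k
      by (cases k) (auto intro!: endoI simp: X_simps scale_right_distrib mult.commute)
    have R: "scale hbar (xop Plus j k (xop Minus j s t)) - xop Minus j s (scale hbar (xop Plus j k t))
       = K j (Suc (k + s)) t" for k s t
      using X_Plus_Minus[of j k j s t] by (simp add: scale_right_diff_distrib X_simps)
    show "(case Suc k of 0 \<Rightarrow> 0 | Suc s \<Rightarrow> scale hbar (xop Plus j s (?x t)))
      - ?x (case Suc k of 0 \<Rightarrow> 0 | Suc s \<Rightarrow> scale hbar (xop Plus j s t)) = K j (Suc k) t" for k t
      using R[of k 0 t] by simp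
    show "(case Suc k of 0 \<Rightarrow> 0 | Suc s \<Rightarrow> scale hbar (xop Plus j s (xop Minus j 1 t)))
      - xop Minus j 1 (case Suc k of 0 \<Rightarrow> 0 | Suc s \<Rightarrow> scale hbar (xop Plus j s t)) = K j (Suc (Suc k)) t" for k t
      using R[of k 1 t] by simp
    show "(case k of 0 \<Rightarrow> 0 | Suc s \<Rightarrow> scale hbar (xop Plus j s u)) = 0" for k
      by (cases k) (simp_all add: raise)
    show "K j 1 u = scale (?a * of_nat n) u" using u(2) by (simp add: wt_def n(1))
  qed (use \<phi> \<psi> w in auto)
  \<comment> \<open>The series of the polynomial \<open>Q(z)\<close>, which has a pole of order \<open>n\<close> at \<open>t = 0\<close>.\<close>
  define Q where "Q = fps_to_fls (S.drinfeld 0) / fls_X ^ n"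
  have Q: "Q \<noteq> 0"
    using S.drinfeld_nonzero[of 0] unfolding Q_def divide_eq_0_iff by simp
  have shifted: "fps_to_fls (S.drinfeld b) = fls_X ^ n * shift b Q" for b
    unfolding Q_def by (rule S.drinfeld_shift)
  have "fps_to_fls (\<phi> j) * (fls_X ^ n * Q) = fls_X ^ n * shift ?a Q"
    using arg_cong[OF own, of fps_to_fls] shifted[of 0] shifted[of ?a]
    by (simp add: fls_times_fps_to_fls shift_0)
  then have Tj: "T j = shift ?a Q / Q" using Q by (simp add: \<phi>(2) field_simps)
  have "tau a d hbar j T i = fps_to_fls (\<psi> i)" for i
  proof -
    have "\<psi> i * S.drinfeld (?c i) = \<phi> i * S.drinfeld (- ?c i)"
      by (rule S.string_eigenvalues[where K = "K i", OF endo_K K_0 rel \<phi>(1) \<psi>])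
    from arg_cong[OF this, of fps_to_fls]
    have "fps_to_fls (\<psi> i) * (fls_X ^ n * shift (?c i) Q) = fps_to_fls (\<phi> i) * (fls_X ^ n * shift (- ?c i) Q)"
      by (simp only: fls_times_fps_to_fls shifted)
    then have "fps_to_fls (\<psi> i) = T i * (shift (- ?c i) Q / shift (?c i) Q)"
      using Q by (simp add: \<phi>(2) field_simps shift_eq_0_iff)
    moreover have "tau a d hbar j T i = T i * (shift (- ?c i) Q / shift (?c i) Q)"
      using tau_quotient[of Q T j hbar d i a, OF Q Tj] diag off_diag
      by (simp add: sym_entry_eq mult.assoc)
    ultimately show ?thesis by simp
  qed
  then show ?thesis
    unfolding extremal_def using w w_wt span_w \<psi>
    by (intro exI[of _ w] exI[of _ \<psi>]) (auto simp: span_singleton image_iff)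
qed

text \<open>
  The hypothesis is what \<open>reduced_word_positive_root\<close> yields for the suffixes of a reduced word.
\<close>
lemma extremal_word:
  assumes "\<And>js1 j js2. js = js1 @ j # js2 \<Longrightarrow> (\<forall>l. fold (root_reflection a) js2 (unit_vec j) l \<ge> 0)"
  shows "extremal (foldr weights.refl js \<mu>) (tau_word a d hbar js \<Lambda>)"
  using assms
proof (induction js)
  case Nil
  then show ?case using extremal_top by (simp add: tau_word_def)
next
  case (Cons j js)
  have "extremal (foldr weights.refl js \<mu>) (tau_word a d hbar js \<Lambda>)"
    using Cons.prems[of "j # _"] by (intro Cons.IH) auto
  moreover have "\<forall>l. fold (root_reflection a) js (unit_vec j) l \<ge> 0"
    using Cons.prems[of "[]"] by simp
  ultimately show ?case
    using extremal_step[OF _ above_not_weight] by (simp add: tau_word_def)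
qed

end

section \<open>Yangian modules as systems of operators\<close>

lemma poly_mapping_sum_single:
  "(p :: 'a \<Rightarrow>\<^sub>0 'b::comm_monoid_add)
    = (\<Sum>k\<in>Poly_Mapping.keys p. Poly_Mapping.single k (Poly_Mapping.lookup p k))"
  by (rule poly_mapping_eqI)
    (auto simp: lookup_sum lookup_single when_def not_in_keys_iff_lookup_eq_zero)

lemma scalar_commutes: "p * scalar c = scalar c * (p :: 'a free_algebra)"
proof -
  let ?s = "\<lambda>k. Poly_Mapping.single k (Poly_Mapping.lookup p k)"
  have "?s k * scalar c = scalar c * ?s k" for k
    by (simp add: scalar_def mult_single mult.commute)
  then have "(\<Sum>k\<in>Poly_Mapping.keys p. ?s k) * scalar c = scalar c * (\<Sum>k\<in>Poly_Mapping.keys p. ?s k)"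
    by (simp add: sum_distrib_left sum_distrib_right)
  then show ?thesis using poly_mapping_sum_single[of p] by simp
qed

lemma free_algebra_induct [case_names add scalar gen]:
  fixes p :: "'a free_algebra"
  assumes add: "\<And>p q. P p \<Longrightarrow> P q \<Longrightarrow> P (p + q)"
    and scalar: "\<And>c. P (scalar c)"
    and gen: "\<And>g p. P p \<Longrightarrow> P (gen g * p)"
  shows "P p"
proof -
  have word: "P (Poly_Mapping.single (Word gs) c)" for gs c
  proof (induction gs)
    case Nil
    then show ?case using scalar[of c] by (simp add: scalar_def zero_free_monoid_def)
  next
    case (Cons g gs)
    have "gen g * Poly_Mapping.single (Word gs) c = Poly_Mapping.single (Word (g # gs)) c"
      by (simp add: gen_def mult_single)
    then show ?case using gen[OF Cons, of g] by simp
  qed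
  have "P 0" using scalar[of 0] by (simp add: scalar_def)
  have "P (\<Sum>k\<in>A. Poly_Mapping.single k (Poly_Mapping.lookup p k))" if "finite A" for A
    using that
  proof induction
    case (insert k A)
    then show ?case using word by (cases k) (simp add: add)
  qed (simp add: \<open>P 0\<close>)
  from this[OF finite_keys[of p]] show ?thesis by (simp only: poly_mapping_sum_single[symmetric])
qed

lemma ring_of_type_algebra_ring: "ring (ring_of_type_algebra :: 'a::ring_1 ring)"
proof -
  have "\<exists>y. x + y = 0" for x :: 'a
    using add.right_inverse by blast
  then show ?thesis
    unfolding ring_of_type_algebra_def using add.right_inverse
    by unfold_locales (auto simp: algebra_simps Units_def)
qed

lemma ideal_yangian_ideal: "ideal (yangian_ideal a d hbar) ring_of_type_algebra"
  unfolding yangian_ideal_def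
  by (rule ring.genideal_ideal[OF ring_of_type_algebra_ring])
    (simp add: ring_of_type_algebra_def)

lemma ycls_ring_hom: "ycls a d hbar \<in> ring_hom ring_of_type_algebra (yangian a d hbar)"
  using ideal.rcos_ring_hom[OF ideal_yangian_ideal, of a d hbar]
  unfolding yangian_def ycls_def[abs_def] .

lemma ycls_hom:
  "ycls a d hbar p \<in> carrier (yangian a d hbar)"
  "ycls a d hbar (p + q) = ycls a d hbar p \<oplus>\<^bsub>yangian a d hbar\<^esub> ycls a d hbar q"
  "ycls a d hbar (p * q) = ycls a d hbar p \<otimes>\<^bsub>yangian a d hbar\<^esub> ycls a d hbar q"
  "ycls a d hbar 1 = \<one>\<^bsub>yangian a d hbar\<^esub>"
  using ring_hom_closed[OF ycls_ring_hom, of p] ring_hom_add[OF ycls_ring_hom, of p q]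
    ring_hom_mult[OF ycls_ring_hom, of p q] ring_hom_one[OF ycls_ring_hom]
  by (simp_all add: ring_of_type_algebra_def)

lemma yangian_carrier:
  assumes "y \<in> carrier (yangian a d hbar)"
  shows "\<exists>p. y = ycls a d hbar p"
  using assms
  by (auto simp: yangian_def FactRing_def A_RCOSETS_def' ycls_def)

lemma ycls_relator:
  assumes "p \<in> yangian_relators a d hbar"
  shows "ycls a d hbar p = ycls a d hbar 0"
proof -
  interpret I: ideal "yangian_ideal a d hbar" ring_of_type_algebra
    by (rule ideal_yangian_ideal)
  have "p \<in> yangian_ideal a d hbar"
    unfolding yangian_ideal_def
    using ring.genideal_self[OF ring_of_type_algebra_ring, of "yangian_relators a d hbar"] assms
    by (auto simp: ring_of_type_algebra_def)
  moreover have "0 \<in> yangian_ideal a d hbar"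
    using additive_subgroup.zero_closed[OF I.additive_subgroup_axioms] by (simp add: ring_of_type_algebra_def)
  ultimately show ?thesis
    using I.a_rcos_const by (simp add: ycls_def)
qed

context yangian_module
begin

definition op :: "'i ygen free_algebra \<Rightarrow> 'v \<Rightarrow> 'v" where
  "op p v = act (ycls a d hbar p) v"

lemma op_simps:
  "op p (v + w) = op p v + op p w" "op (p + q) v = op p v + op q v"
  "op (p * q) v = op p (op q v)" "op 1 v = v" "op (scalar c) v = scale c v"
  by (simp_all add: op_def ycls_hom act_add_right act_add_left act_mult act_one act_scalar)

lemma op_0: "op 0 v = 0"
  using op_simps(2)[of 0 0 v] by simp

lemma op_diff: "op (p - q) v = op p v - op q v"
  using op_simps(2)[of "p - q" q v] by (simp add: algebra_simps)

lemma op_relator: "p \<in> yangian_relators a d hbar \<Longrightarrow> op p v = 0"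
  using op_0[of v] by (simp add: op_def ycls_relator)

lemma op_scale: "op p (scale c v) = scale c (op p v)"
  using op_simps(3)[of p "scalar c" v] op_simps(3)[of "scalar c" p v]
  by (simp add: scalar_commutes op_simps(5))

text \<open>
  Scalars and generators generate the free algebra, and cosets act through
  representatives.
\<close>
lemma submodule_iff:
  assumes "subspace S"
  shows "submodule a d hbar scale act S \<longleftrightarrow>
     (\<forall>u\<in>S. (\<forall>i r. op (xi i r) u \<in> S) \<and> (\<forall>\<epsilon> i r. op (xpm \<epsilon> i r) u \<in> S))" (is "_ \<longleftrightarrow> ?r")
proof
  assume "submodule a d hbar scale act S"
  then show ?r unfolding submodule_def op_def using ycls_hom(1) by blast
next
  assume r: ?r
  have "\<forall>u\<in>S. op p u \<in> S" for p
  proof (induction p rule: free_algebra_induct)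
    case (add p q)
    then show ?case using subspace_add[OF assms] by (simp add: op_simps)
  next
    case (scalar c)
    then show ?case using subspace_scale[OF assms] by (simp add: op_simps)
  next
    case (gen g p)
    then show ?case using r by (cases g) (simp_all add: op_simps xi_def xpm_def)
  qed
  then have "act y u \<in> S" if "y \<in> carrier (yangian a d hbar)" "u \<in> S" for y u
    using yangian_carrier[OF that(1)] that(2) by (auto simp: op_def)
  then show "submodule a d hbar scale act S" using assms by (simp add: submodule_def)
qed

text \<open>
  The coefficient of \<open>u\<^bsup>-k\<^esup>\<close> in \<open>\<xi>\<^sub>i(u)\<close>.
\<close>
fun xi_op :: "'i \<Rightarrow> nat \<Rightarrow> 'v \<Rightarrow> 'v" where
  "xi_op i 0 v = v"
| "xi_op i (Suc k) v = scale hbar (op (xi i k) v)"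

lemma op_commutator: "op (commutator p q) v = op p (op q v) - op q (op p v)"
  by (simp add: commutator_def op_diff op_simps)

lemma endo_op: "endo scale (op p)"
  by (intro complex_vector_space.endoI[OF complex_vector_space.intro[OF vector_space_axioms]])
    (simp_all add: op_simps op_scale)

lemma xi_xpm_0:
  "op (xi i 0) (op (xpm \<epsilon> j s) v) - op (xpm \<epsilon> j s) (op (xi i 0) v)
    = scale (sgn_val \<epsilon> * sym_entry a d i j) (op (xpm \<epsilon> j s) v)"
  using op_relator[OF yangian_relators.xi_0_x, of i \<epsilon> j s v]
  by (simp add: op_diff op_commutator op_simps)

lemma xi_xpm:
  "op (xi i (Suc r)) (op (xpm \<epsilon> j s) v) - op (xpm \<epsilon> j s) (op (xi i (Suc r)) v)
     - (op (xi i r) (op (xpm \<epsilon> j (Suc s)) v) - op (xpm \<epsilon> j (Suc s)) (op (xi i r) v))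
    = scale (sgn_val \<epsilon> * hbar * (sym_entry a d i j / 2))
       (op (xi i r) (op (xpm \<epsilon> j s) v) + op (xpm \<epsilon> j s) (op (xi i r) v))"
  using op_relator[OF yangian_relators.xi_x, of i r \<epsilon> j s v]
  by (simp add: op_diff op_commutator op_simps scale_right_distrib)

lemma xpm_xpm:
  "op (xpm \<epsilon> i (Suc r)) (op (xpm \<epsilon> j s) v) - op (xpm \<epsilon> j s) (op (xpm \<epsilon> i (Suc r)) v)
     - (op (xpm \<epsilon> i r) (op (xpm \<epsilon> j (Suc s)) v) - op (xpm \<epsilon> j (Suc s)) (op (xpm \<epsilon> i r) v))
    = scale (sgn_val \<epsilon> * hbar * (sym_entry a d i j / 2))
       (op (xpm \<epsilon> i r) (op (xpm \<epsilon> j s) v) + op (xpm \<epsilon> j s) (op (xpm \<epsilon> i r) v))"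
  using op_relator[OF yangian_relators.x_x, of \<epsilon> i r j s v]
  by (simp add: op_diff op_commutator op_simps scale_right_distrib)

lemma xpm_plus_minus:
  "op (xpm Plus i r) (op (xpm Minus j s) v) - op (xpm Minus j s) (op (xpm Plus i r) v)
    = (if i = j then op (xi i (r + s)) v else 0)"
  using op_relator[OF yangian_relators.x_plus_x_minus, of i r j s v]
  by (simp add: op_diff op_commutator op_simps op_0 split: if_splits)

lemma xi_xi: "op (xi i r) (op (xi j s) v) = op (xi j s) (op (xi i r) v)"
  using op_relator[OF yangian_relators.xi_xi, of i r j s v] by (simp add: op_commutator)

lemma act_xi_coeff: "act (xi_coeff a d hbar i n) v = (if n < 0 then 0 else xi_op i (nat n) v)"
proof (cases "n \<le> 0")
  case True
  then show ?thesis
    using op_0[of v] op_simps(4)[of v] by (auto simp: xi_coeff_def op_def)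
next
  case False
  then obtain k where "nat n = Suc k" "nat (n - 1) = k" by (cases "nat n") auto
  then show ?thesis using False op_simps(3)[of "scalar hbar" "xi i k" v]
    by (simp add: xi_coeff_def op_def[symmetric] op_simps)
qed

lemma act_x_coeff: "act (x_coeff a d hbar \<epsilon> i (int (Suc r))) v = scale hbar (op (xpm \<epsilon> i r) v)"
  using op_simps(3)[of "scalar hbar" "xpm \<epsilon> i r" v]
  by (simp add: x_coeff_def op_def[symmetric] op_simps)

lemma xi_acts_by_fps:
  "xi_acts_by a d hbar scale act i (fps_to_fls \<phi>) v \<longleftrightarrow> (\<forall>k. xi_op i k v = scale (fps_nth \<phi> k) v)"
  unfolding xi_acts_by_def act_xi_coeff
  by (auto simp: fps_to_fls_nth) (metis nat_int of_nat_less_0_iff)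

end

section \<open>The finite-dimensional module\<close>

text \<open>
  A Cartan matrix comes with some symmetrizer for which the form is positive definite.  As the matrix
  is indecomposable, any other symmetrizer is a constant multiple of that one.
\<close>
lemma finite_type_cartan_symmetrizer:
  assumes "cartan_matrix a" and "symmetrizes a d"
  shows "finite_type_cartan a d"
proof -
  note cartan = assms(1)[unfolded cartan_matrix_def]
  obtain d0 where d0: "symmetrizes a d0" and
    pos: "\<forall>x :: 'a \<Rightarrow> real. (\<exists>i. x i \<noteq> 0) \<longrightarrow>
           (\<Sum>i\<in>UNIV. \<Sum>j\<in>UNIV. real (d0 i) * real_of_int (a i j) * x i * x j) > 0"
    using cartan[THEN conjunct2, THEN conjunct2, THEN conjunct2, THEN conjunct1] by (elim exE conjE)
  have conn: "\<forall>J. J \<noteq> {} \<and> J \<noteq> UNIV \<longrightarrow> (\<exists>i\<in>J. \<exists>j\<in>-J. a i j \<noteq> 0)"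
    and diag: "\<And>i. a i i = 2" and off: "\<And>i j. i \<noteq> j \<Longrightarrow> a i j \<le> 0"
    using cartan by simp_all
  fix i0 :: 'a
  \<comment> \<open>The nodes at which both symmetrizers have the same ratio as at \<open>i0\<close> form a component.\<close>
  define J where "J = {i. d i * d0 i0 = d i0 * d0 i}"
  have "J = UNIV"
  proof (rule ccontr)
    assume "J \<noteq> UNIV"
    moreover have "J \<noteq> {}" by (auto simp: J_def)
    ultimately obtain i j where ij: "i \<in> J" "j \<notin> J" "a i j \<noteq> 0" using conn by (metis ComplD)
    have e: "int (d i) * a i j = int (d j) * a j i" "int (d0 i) * a i j = int (d0 j) * a j i"
      using assms(2) d0 by (auto simp: symmetrizes_def)
    have i: "int (d i) * int (d0 i0) = int (d i0) * int (d0 i)"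
      using ij(1) by (simp add: J_def flip: of_nat_mult)
    have "d i \<noteq> 0" using assms(2) by (metis less_numeral_extra(3) symmetrizes_def)
    then have "a j i \<noteq> 0" using e(1) ij(3) by (intro notI) simp
    have "a j i * (int (d j) * int (d0 i0)) = (int (d i) * int (d0 i0)) * a i j"
      using e(1) by (simp add: mult_ac)
    also have "\<dots> = int (d i0) * (int (d0 i) * a i j)" unfolding i by (simp add: mult_ac)
    also have "\<dots> = a j i * (int (d i0) * int (d0 j))" unfolding e(2) by (simp add: mult_ac)
    finally have "int (d j) * int (d0 i0) = int (d i0) * int (d0 j)"
      using \<open>a j i \<noteq> 0\<close> by simp
    then have "j \<in> J" by (simp add: J_def flip: of_nat_mult)
    then show False using ij(2) by simp
  qed
  then have ratio: "real (d i) * real (d0 i0) = real (d i0) * real (d0 i)" for i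
    unfolding of_nat_mult[symmetric] by (auto simp: J_def set_eq_iff)
  have d_pos: "\<And>i. d i > 0" "\<And>i. d0 i > 0" using assms(2) d0 by (auto simp: symmetrizes_def)
  show ?thesis
  proof
    fix x :: "'a \<Rightarrow> real" and i
    assume "x i \<noteq> 0"
    then have "0 < real (d i0) * (\<Sum>i\<in>UNIV. \<Sum>j\<in>UNIV. real (d0 i) * real_of_int (a i j) * x i * x j)"
      using pos[rule_format, of x] d_pos by (intro mult_pos_pos) auto
    also have "\<dots> = (\<Sum>i\<in>UNIV. \<Sum>j\<in>UNIV. (real (d i0) * real (d0 i)) * real_of_int (a i j) * x i * x j)"
      by (simp add: sum_distrib_left mult_ac)
    also have "\<dots> = real (d0 i0) * (\<Sum>i\<in>UNIV. \<Sum>j\<in>UNIV. real (d i) * real_of_int (a i j) * x i * x j)"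
      unfolding ratio[symmetric] by (simp add: sum_distrib_left mult_ac)
    finally show "(\<Sum>i\<in>UNIV. \<Sum>j\<in>UNIV. real (d i) * real_of_int (a i j) * x i * x j) > 0"
      using d_pos by (simp add: zero_less_mult_iff)
  qed (use diag off d_pos assms(2) in \<open>auto simp: symmetrizes_def\<close>)
qed

lemma simple_root_h:
  assumes "simple_lie_algebra scale_g br" and "chevalley_generators scale_g br H a e h f"
  shows "simple_root scale_g br H e k (h i) = of_int (a i k)"
proof -
  interpret simple_lie_algebra scale_g br by fact
  have c: "\<not> dependent (range h)" "span (range h) = H" "\<And>i j. br (h i) (e j) = scale_g (of_int (a i j)) (e j)"
    "\<And>i. br (e i) (f i) = h i"
    using assms(2) unfolding chevalley_generators_def by auto
  have "h k \<noteq> 0" using c(1) dependent_zero by (metis rangeI)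
  moreover have "br 0 (f k) = 0" using br_scale_left[of 0 0 "f k"] by simp
  ultimately have "e k \<noteq> 0" using c(4)[of k] by auto
  then have "(THE c. br (h i) (e k) = scale_g c (e k)) = of_int (a i k)"
    unfolding c(3) by (intro the_equality) simp_all
  moreover have "h i \<in> H" using c(2) span_base by (metis rangeI)
  ultimately show ?thesis by (simp add: simple_root_def)
qed

lemma simple_reflection_eq:
  "simple_reflection scale_g br H e h = functional_reflection (simple_root scale_g br H e) h"
  by (auto simp: simple_reflection_def functional_reflection_def fun_eq_iff)

context yangian_module
begin

lemma yangian_operators_op:
  assumes "finite_type_cartan a d" and "hbar \<noteq> 0" and "finite_dim scale TYPE('v)"
  shows "yangian_operators scale a d hbar (\<lambda>\<epsilon> i r. op (xpm \<epsilon> i r)) xi_op"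
proof -
  interpret complex_vector_space scale by unfold_locales
  interpret C: finite_type_cartan a d by fact
  have two: "w + w = scale 2 w" for w :: 'v
    using scale_left_distrib[of 1 1 w] by simp
  show ?thesis
  proof (intro yangian_operators.intro yangian_operators_axioms.intro)
    show "complex_vector_space scale" "finite_type_cartan a d" by unfold_locales
    show "\<exists>B. finite B \<and> span B = UNIV" using assms(3) by (simp add: finite_dim_def)
    show "endo scale (op (xpm \<epsilon> i r))" for \<epsilon> i r by (rule endo_op)
    show "endo scale (xi_op i k)" for i k
      by (cases k) (auto intro!: endoI simp: op_simps op_scale scale_right_distrib mult.commute)
    show "xi_op i k (xi_op j l v) = xi_op j l (xi_op i k v)" for i k j l v
      by (cases k; cases l) (simp_all add: op_scale xi_xi mult.commute)
    show "xi_op i (Suc k) (op (xpm \<epsilon> j s) v) - op (xpm \<epsilon> j s) (xi_op i (Suc k) v)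
        - (xi_op i k (op (xpm \<epsilon> j (Suc s)) v) - op (xpm \<epsilon> j (Suc s)) (xi_op i k v))
      = scale (sgn_val \<epsilon> * (hbar * sym_entry a d i j / 2))
         (xi_op i k (op (xpm \<epsilon> j s) v) + op (xpm \<epsilon> j s) (xi_op i k v))" for i k \<epsilon> j s v
    proof (cases k)
      case 0
      have "scale hbar (op (xi i 0) (op (xpm \<epsilon> j s) v) - op (xpm \<epsilon> j s) (op (xi i 0) v))
         = scale hbar (scale (sgn_val \<epsilon> * sym_entry a d i j) (op (xpm \<epsilon> j s) v))"
        by (simp only: xi_xpm_0)
      then show ?thesis by (simp add: 0 op_scale scale_right_diff_distrib two mult_ac)
    next
      case (Suc l)
      have "scale hbar (op (xi i (Suc l)) (op (xpm \<epsilon> j s) v) - op (xpm \<epsilon> j s) (op (xi i (Suc l)) v)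
           - (op (xi i l) (op (xpm \<epsilon> j (Suc s)) v) - op (xpm \<epsilon> j (Suc s)) (op (xi i l) v)))
         = scale hbar (scale (sgn_val \<epsilon> * hbar * (sym_entry a d i j / 2))
              (op (xi i l) (op (xpm \<epsilon> j s) v) + op (xpm \<epsilon> j s) (op (xi i l) v)))"
        by (simp only: xi_xpm)
      then show ?thesis
        by (simp add: Suc op_scale scale_right_diff_distrib scale_right_distrib mult_ac)
    qed
    show "op (xpm \<epsilon> i 1) (op (xpm \<epsilon> i 0) v) - op (xpm \<epsilon> i 0) (op (xpm \<epsilon> i 1) v)
      = scale (sgn_val \<epsilon> * (hbar * of_nat (d i))) (op (xpm \<epsilon> i 0) (op (xpm \<epsilon> i 0) v))" for \<epsilon> i v
    proof -
      let ?A = "op (xpm \<epsilon> i 1) (op (xpm \<epsilon> i 0) v)" and ?B = "op (xpm \<epsilon> i 0) (op (xpm \<epsilon> i 1) v)"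
      have "scale 2 (?A - ?B) = ?A - ?B - (?B - ?A)"
        by (simp add: two[symmetric])
      also have "\<dots> = scale 2 (scale (sgn_val \<epsilon> * (hbar * of_nat (d i))) (op (xpm \<epsilon> i 0) (op (xpm \<epsilon> i 0) v)))"
        using xpm_xpm[of \<epsilon> i 0 i 0 v] by (simp add: sym_entry_def C.diag two mult_ac)
      finally show ?thesis by (metis scale_cancel_left zero_neq_numeral)
    qed
    show "scale hbar (op (xpm Plus i r) (op (xpm Minus j s) v) - op (xpm Minus j s) (op (xpm Plus i r) v))
      = (if i = j then xi_op i (Suc (r + s)) v else 0)" for i j r s v
      by (simp add: xpm_plus_minus)
  qed (use assms(2) in simp_all)
qed

lemma highest_weight_operators_op:
  assumes "finite_type_cartan a d" and "hbar \<noteq> 0" and "finite_dim scale TYPE('v)"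
    and hw: "highest_weight_vector a d hbar scale act \<Lambda> v"
    and wt: "\<And>i. xi_op i 1 v = scale (hbar * of_nat (d i) * \<mu> i) v"
  shows "highest_weight_operators scale a d hbar (\<lambda>\<epsilon> i r. op (xpm \<epsilon> i r)) xi_op v \<mu> \<Lambda>"
proof -
  interpret Y: yangian_operators scale a d hbar "\<lambda>\<epsilon> i r. op (xpm \<epsilon> i r)" xi_op
    by (rule yangian_operators_op) fact+
  show ?thesis
  proof
    show "v \<noteq> 0" "\<And>i. \<Lambda> i \<in> unit_series" using hw by (auto simp: highest_weight_vector_def)
    show "v \<in> Y.wt \<mu>" unfolding Y.wt_def using wt by blast
    show "op (xpm Plus i r) v = 0" for i r
    proof -
      have "scale hbar (op (xpm Plus i r) v) = 0"
        using hw act_x_coeff[of Plus i r v] unfolding highest_weight_vector_def by metis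
      then show ?thesis using assms(2) by simp
    qed
    show "xi_op i k v = scale (fls_nth (\<Lambda> i) (int k)) v" for i k
      using hw act_xi_coeff[of i "int k" v]
      by (simp add: highest_weight_vector_def xi_acts_by_def)
    fix S
    assume S: "subspace S" "v \<in> S" "\<And>\<epsilon> i r u. u \<in> S \<Longrightarrow> op (xpm \<epsilon> i r) u \<in> S"
      "\<And>i k u. u \<in> S \<Longrightarrow> xi_op i k u \<in> S"
    have "op (xi i r) u \<in> S" if "u \<in> S" for i r u
    proof -
      have "scale (1 / hbar) (xi_op i (Suc r) u) \<in> S"
        using S(1,4) that subspace_scale by blast
      then show ?thesis using assms(2) by simp
    qed
    then have "submodule a d hbar scale act S" using S(3) by (simp add: submodule_iff[OF S(1)])
    then show "S = UNIV" using hw S(2) by (simp add: highest_weight_vector_def)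
  qed
qed

lemma weight_space_iff:
  assumes "hbar \<noteq> 0" and "\<And>i. d i > 0"
  shows "u \<in> weight_space a d hbar h scale act \<mu>
    \<longleftrightarrow> (\<forall>i. xi_op i 1 u = scale (hbar * of_nat (d i) * \<mu> (h i)) u)"
proof -
  have "act (ycls a d hbar (scalar (1 / of_nat (d i)) * xi i 0)) u = scale (\<mu> (h i)) u
     \<longleftrightarrow> xi_op i 1 u = scale (hbar * of_nat (d i) * \<mu> (h i)) u" for i
  proof -
    have d: "of_nat (d i) \<noteq> (0 :: complex)" using assms(2)[of i] by simp
    have "act (ycls a d hbar (scalar (1 / of_nat (d i)) * xi i 0)) u = scale (1 / of_nat (d i)) (op (xi i 0) u)"
      using op_simps(3)[of "scalar (1 / of_nat (d i))" "xi i 0" u] by (simp add: op_def[symmetric] op_simps)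
    moreover have "scale (1 / of_nat (d i)) (op (xi i 0) u) = scale (\<mu> (h i)) u
       \<longleftrightarrow> scale (hbar * of_nat (d i)) (scale (1 / of_nat (d i)) (op (xi i 0) u))
          = scale (hbar * of_nat (d i)) (scale (\<mu> (h i)) u)"
      using assms(1) d by (simp only: scale_cancel_left) simp
    ultimately show ?thesis using d by simp
  qed
  then show ?thesis by (simp add: weight_space_def)
qed

text \<open>
  The weights of two highest weight vectors lie below each other, so they coincide, and the weight
  space of the highest weight is a line.
\<close>
lemma highest_weight_unique:
  assumes "finite_type_cartan a d" and hbar: "hbar \<noteq> 0" and "finite_dim scale TYPE('v)"
    and hw: "highest_weight_vector a d hbar scale act \<Lambda> v"
    and hw': "highest_weight_vector a d hbar scale act \<Lambda>' v'"
  shows "\<Lambda> = \<Lambda>'"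
proof -
  interpret C: finite_type_cartan a d by fact
  interpret Y: yangian_operators scale a d hbar "\<lambda>\<epsilon> i r. op (xpm \<epsilon> i r)" xi_op
    by (rule yangian_operators_op) fact+
  have ex: "\<exists>\<mu>. highest_weight_operators scale a d hbar (\<lambda>\<epsilon> i r. op (xpm \<epsilon> i r)) xi_op v \<mu> \<Lambda>"
    if hw: "highest_weight_vector a d hbar scale act \<Lambda> v" for \<Lambda> v
  proof
    define \<mu> where "\<mu> i = fls_nth (\<Lambda> i) 1 / (hbar * of_nat (d i))" for i
    show "highest_weight_operators scale a d hbar (\<lambda>\<epsilon> i r. op (xpm \<epsilon> i r)) xi_op v \<mu> \<Lambda>"
    proof (rule highest_weight_operators_op[OF assms(1-3) hw])
      fix i
      have "xi_op i (nat 1) v = scale (fls_nth (\<Lambda> i) 1) v"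
        using hw act_xi_coeff[of i 1 v] by (simp add: highest_weight_vector_def xi_acts_by_def)
      then show "xi_op i 1 v = scale (hbar * of_nat (d i) * \<mu> i) v"
        using hbar C.d_pos[of i] by (simp add: \<mu>_def)
    qed
  qed
  obtain \<mu> where "highest_weight_operators scale a d hbar (\<lambda>\<epsilon> i r. op (xpm \<epsilon> i r)) xi_op v \<mu> \<Lambda>"
    using ex[OF hw] by blast
  then interpret A: highest_weight_operators scale a d hbar "\<lambda>\<epsilon> i r. op (xpm \<epsilon> i r)" xi_op v \<mu> \<Lambda> .
  obtain \<mu>' where "highest_weight_operators scale a d hbar (\<lambda>\<epsilon> i r. op (xpm \<epsilon> i r)) xi_op v' \<mu>' \<Lambda>'"
    using ex[OF hw'] by blast
  then interpret B: highest_weight_operators scale a d hbar "\<lambda>\<epsilon> i r. op (xpm \<epsilon> i r)" xi_op v' \<mu>' \<Lambda>' .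
  obtain c where c: "\<mu>' = A.below c"
    using A.weight_below B.v_nonzero B.v_wt by (auto simp: Y.is_weight_def)
  obtain c' where c': "\<mu> = B.below c'"
    using B.weight_below A.v_nonzero A.v_wt by (auto simp: Y.is_weight_def)
  have "(\<Sum>k\<in>UNIV. of_int (int (c k) + int (c' k)) * of_int (a i k)) = (0 :: complex)" for i
  proof -
    have "(\<Sum>k\<in>UNIV. of_nat (c k) * of_int (a i k)) = \<mu> i - \<mu>' i"
      using fun_cong[OF c, of i] by (simp add: A.below_def)
    moreover have "(\<Sum>k\<in>UNIV. of_nat (c' k) * of_int (a i k)) = \<mu>' i - \<mu> i"
      using fun_cong[OF c', of i] by (simp add: B.below_def)
    ultimately show ?thesis by (simp add: distrib_right sum.distrib)
  qed
  then have "int (c k) + int (c' k) = 0" for k by (rule A.complex_roots_independent)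
  then have "c k = 0" for k by (metis add_is_0 of_nat_0_eq_iff of_nat_add)
  then have "\<mu>' = \<mu>" using c by (simp add: A.below_def fun_eq_iff)
  then obtain z where z: "v' = scale z v" using A.top_wt[of v'] B.v_wt span_singleton by blast
  have "fls_nth (\<Lambda> i) n = fls_nth (\<Lambda>' i) n" for i n
  proof -
    have "act (xi_coeff a d hbar i n) v = scale (fls_nth (\<Lambda> i) n) v"
      using hw by (simp add: highest_weight_vector_def xi_acts_by_def)
    moreover have "act (xi_coeff a d hbar i n) v' = scale (fls_nth (\<Lambda>' i) n) v'"
      using hw' by (simp add: highest_weight_vector_def xi_acts_by_def)
    moreover have "act (xi_coeff a d hbar i n) v' = scale z (act (xi_coeff a d hbar i n) v)"
      unfolding z act_xi_coeff using Y.K_simps by simp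
    ultimately have "scale (fls_nth (\<Lambda> i) n) v' = scale (fls_nth (\<Lambda>' i) n) v'"
      by (metis scale_left_commute z)
    then show ?thesis using B.v_nonzero by simp
  qed
  then show ?thesis by (simp add: fun_eq_iff fls_eq_iff)
qed

lemma extremal_weight_space:
  assumes "finite_type_cartan a d" and hbar: "hbar \<noteq> 0" and "finite_dim scale TYPE('v)"
    and hw: "highest_weight_vector a d hbar scale act \<Lambda> v"
    and \<alpha>: "\<And>k i. \<alpha> k (h i) = of_int (a i k)"
    and v: "v \<in> weight_space a d hbar h scale act \<mu>"
    and reduced: "\<And>ks. foldr (functional_reflection \<alpha> h) ks = foldr (functional_reflection \<alpha> h) js
        \<Longrightarrow> length js \<le> length ks"
    and u: "u \<in> weight_space a d hbar h scale act (foldr (functional_reflection \<alpha> h) js \<mu>)"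
  shows "xi_acts_by a d hbar scale act i (tau_word a d hbar js \<Lambda> i) u"
proof -
  interpret C: finite_type_cartan a d by fact
  interpret R: reflection_action a d \<alpha> h by unfold_locales (rule \<alpha>)
  note ws = weight_space_iff[OF hbar C.d_pos]
  interpret A: highest_weight_operators scale a d hbar "\<lambda>\<epsilon> i r. op (xpm \<epsilon> i r)" xi_op v "\<lambda>i. \<mu> (h i)" \<Lambda>
    by (rule highest_weight_operators_op[OF assms(1-4)]) (use v ws in blast)
  have word: "foldr R.refl js \<mu> (h i) = foldr A.weights.refl js (\<lambda>i. \<mu> (h i)) i" for js i
    by (induction js arbitrary: i) (simp_all add: functional_reflection_def \<alpha>)
  have "A.extremal (foldr A.weights.refl js (\<lambda>i. \<mu> (h i))) (tau_word a d hbar js \<Lambda>)"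
  proof (rule A.extremal_word)
    fix js1 j js2 assume js: "js = js1 @ j # js2"
    have "length (j # js2) \<le> length ks" if "foldr R.refl ks = foldr R.refl (j # js2)" for ks
    proof -
      have "foldr R.refl (js1 @ ks) = foldr R.refl js" unfolding js foldr_append that ..
      from reduced[OF this] show ?thesis by (simp add: js)
    qed
    then show "\<forall>l. fold (root_reflection a) js2 (unit_vec j) l \<ge> 0"
      using R.reduced_word_positive_root by blast
  qed
  moreover have "u \<in> A.wt (foldr A.weights.refl js (\<lambda>i. \<mu> (h i)))"
    using u unfolding A.wt_def ws by (simp add: word)
  ultimately obtain u0 \<phi> z where "u = scale z u0" "tau_word a d hbar js \<Lambda> i = fps_to_fls (\<phi> i)"
    "\<And>i k. xi_op i k u0 = scale (fps_nth (\<phi> i) k) u0"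
    unfolding A.extremal_def by (auto simp: span_singleton image_iff subset_iff)
  then show ?thesis
    by (simp add: xi_acts_by_fps A.K_simps mult.commute)
qed

end

lemma tau_word_quotient:
  assumes "\<And>k. M k \<noteq> 0" and a: "\<And>i. a i i = 2" "\<And>i j. i \<noteq> j \<Longrightarrow> a i j \<le> 0"
    and d: "\<And>i j. int (d i) * a i j = int (d j) * a j i"
  shows "tau_word a d hbar js (\<lambda>k. shift (hbar * of_nat (d k)) (M k) / M k)
    = (\<lambda>i. shift (hbar * of_nat (d i)) (tau_M_word a d hbar js M i) / tau_M_word a d hbar js M i)
    \<and> (\<forall>i. tau_M_word a d hbar js M i \<noteq> 0)"
proof (induction js)
  case (Cons j js)
  let ?N = "tau_M_word a d hbar js M"
  have N: "?N k \<noteq> 0" for k using Cons by blast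
  have "tau a d hbar j (\<lambda>k. shift (hbar * of_nat (d k)) (?N k) / ?N k) i
    = shift (hbar * of_nat (d i)) (tau_M a d hbar j ?N i) / tau_M a d hbar j ?N i" for i
    by (rule tau_quotient_tau_M[OF N]) (use a d in auto)
  then show ?case using Cons tau_M_nonzero[of ?N, OF N]
    by (simp add: tau_word_def tau_M_word_def)
qed (use assms in \<open>simp add: tau_word_def tau_M_word_def\<close>)

theorem proposition4p8:
  fixes scale_g :: "complex \<Rightarrow> 'g::ab_group_add \<Rightarrow> 'g" and br :: "'g \<Rightarrow> 'g \<Rightarrow> 'g" and H :: "'g set"
    and a :: "'i::finite \<Rightarrow> 'i \<Rightarrow> int" and d :: "'i \<Rightarrow> nat" and e h f :: "'i \<Rightarrow> 'g"
    and hbar :: complex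
    and scale :: "complex \<Rightarrow> 'v::ab_group_add \<Rightarrow> 'v"
    and act :: "'i ygen free_algebra set \<Rightarrow> 'v \<Rightarrow> 'v"
    and \<Lambda> :: "'i \<Rightarrow> complex fls" and v :: 'v and \<mu> :: "'g \<Rightarrow> complex"
  assumes "simple_lie_algebra scale_g br"
    and "cartan_subalgebra scale_g br H"
    and "chevalley_generators scale_g br H a e h f"
    and "minimal_symmetrizer a d"
    and "hbar \<noteq> 0"
    and "yangian_module a d hbar scale act"
    and "finite_dim scale TYPE('v)"
    and "irreducible_module a d hbar scale act"
    and "highest_weight_vector a d hbar scale act \<Lambda> v"
    and "\<mu> \<in> dual_space scale_g H"
    and "v \<in> weight_space a d hbar h scale act \<mu>"
  shows "(\<forall>w\<in>weyl_group scale_g br H e h. \<forall>js. reduced_word scale_g br H e h w js \<longrightarrow>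
            (\<forall>i. \<forall>u\<in>weight_space a d hbar h scale act (w \<mu>).
               xi_acts_by a d hbar scale act i (tau_word a d hbar js \<Lambda> i) u)) \<and>
         (\<forall>P. (\<forall>i. lead_coeff (P i) = 1) \<and> isomorphic_to_L a d hbar scale act P \<longrightarrow>
            (\<forall>w\<in>weyl_group scale_g br H e h. \<forall>js. reduced_word scale_g br H e h w js \<longrightarrow>
               (\<forall>i. \<forall>u\<in>weight_space a d hbar h scale act (w \<mu>).
                  xi_acts_by a d hbar scale act i
                    (shift (hbar * of_nat (d i)) (tau_M_word a d hbar js (\<lambda>k. series_of_poly (P k)) i)
                       / tau_M_word a d hbar js (\<lambda>k. series_of_poly (P k)) i) u)))"
proof -
  interpret yangian_module a d hbar scale act by fact
  have "cartan_matrix a" using assms(3) by (simp add: chevalley_generators_def)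
  moreover have "symmetrizes a d" using assms(4) by (simp add: minimal_symmetrizer_def)
  ultimately have cartan: "finite_type_cartan a d" by (rule finite_type_cartan_symmetrizer)
  interpret C: finite_type_cartan a d by fact
  have weyl: "weyl_word scale_g br H e h js = foldr (functional_reflection (simple_root scale_g br H e) h) js" for js
    by (simp add: weyl_word_def fun_eq_iff simple_reflection_eq)
  have main: "xi_acts_by a d hbar scale act i (tau_word a d hbar js \<Lambda> i) u"
    if "reduced_word scale_g br H e h w js" "u \<in> weight_space a d hbar h scale act (w \<mu>)" for w js i u
    by (rule extremal_weight_space[OF cartan assms(5,7,9) simple_root_h[OF assms(1,3)] assms(11)])
      (use that in \<open>auto simp: reduced_word_def weyl\<close>)
  have "tau_word a d hbar js \<Lambda> i = shift (hbar * of_nat (d i)) (tau_M_word a d hbar js (\<lambda>k. series_of_poly (P k)) i)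
                       / tau_M_word a d hbar js (\<lambda>k. series_of_poly (P k)) i"
    if L: "isomorphic_to_L a d hbar scale act P" for P js i
  proof -
    let ?M = "\<lambda>k. series_of_poly (P k)"
    let ?L = "\<lambda>k. shift (hbar * of_nat (d k)) (?M k) / ?M k"
    obtain v' where v': "highest_weight_vector a d hbar scale act ?L v'"
      using L by (auto simp: isomorphic_to_L_def)
    have "\<Lambda> = ?L" by (rule highest_weight_unique[OF cartan assms(5,7,9) v'])
    \<comment> \<open>Division by 0 gives 0, which is not a series with constant term 1.\<close>
    moreover have "?M k \<noteq> 0" for k
    proof
      assume "?M k = 0"
      then have "(0 :: complex fls) \<in> unit_series"
        using v' by (auto simp: highest_weight_vector_def dest: spec[of _ k])
      then obtain g where "0 = fps_to_fls (1 + fps_X * g :: complex fps)" by (auto simp only: unit_series_def)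
      then have "fls_nth 0 0 = fls_nth (fps_to_fls (1 + fps_X * g :: complex fps)) 0" by simp
      then show False by simp
    qed
    ultimately show ?thesis
      using tau_word_quotient[of ?M a d hbar js, OF _ C.diag C.off_diag C.symm] by simp
  qed
  then show ?thesis using main by auto
qed

end
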